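(* Let $d,r\in\mathbb{N}$, $m\in\mathbb{N}_0$, and let $\Lambda=\{\nu_1,\ldots,\nu_r\}\subseteq\Lambda_m$ be an ordered multiset with $\nu_1=\mathbf{0}$. Suppose that the generalized Hermite subdivision scheme of type $\Lambda$ with a mask $a\in(l_0(\mathbb{Z}^d))^{r\times r}$ is convergent with limit functions in $\mathscr{C}^m(\mathbb{R}^d)$. Then its basis vector function $\phi$ is a compactly supported vector function in $(\mathscr{C}^m(\mathbb{R}^d))^r$ satisfying $$\widehat{\phi}(\xi)=\lim_{n\to\infty}\Big(\Big[\prod_{j=1}^n\widehat{a}(2^{-j}\xi)\Big]e_1\Big)\quad\text{and}\quad \widehat{\phi}(2\xi)=\widehat{a}(\xi)\widehat{\phi}(\xi),\qquad\forall\,\xi\in\mathbb{R}^d,$$ where $\prod_{j=1}^n\widehat a(2^{-j}\xi):=\widehat a(2^{-1}\xi)\widehat a(2^{-2}\xi)\cdots\widehat a(2^{-n}\xi)$. If in addition $$\operatorname{span}\{\widehat{\phi}(\pi\omega+2\pi k):k\in\mathbb{Z}^d\}=\mathbb{C}^r\qquad\forall\,\omega\in[0,1]^d\cap\mathbb{Z}^d,$$ then $\widehat{\phi}(0)\ne0$ and the following statements hold: (1) $1$ is a simple eigenvalue of the matrix $\widehat{a}(0)=\sum_{k\in\mathbb{Z}^d}a(k)$ and all other eigenvalues of $\widehat{a}(0)$ are less than $2^{-m}$ in modulus. Consequently, there always exists a finitely supported sequence $\upsilon_a\in(l_0(\mathbb{Z}^d))^{1\times r}$ whose values $\widehat{\upsilon_a}^{(\mu)}(0)$,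 $\mu\in\Lambda_m$, are uniquely determined by $$\text{(A)}\qquad \widehat{\upsilon_a}(0)\widehat{a}(0)=\widehat{\upsilon_a}(0)\quad\text{with}\quad\widehat{\upsilon_a}(0)\widehat{\phi}(0)=1$$ and the recursive formula, from $|\mu|=1$ to $|\mu|=m$, $$\text{(B)}\qquad \widehat{\upsilon_a}^{(\mu)}(0)=\sum_{0\le\beta\le\mu,\ \beta\ne\mu}\frac{2^{|\beta|}\mu!}{\beta!(\mu-\beta)!}\widehat{\upsilon_a}^{(\beta)}(0)\,\widehat{a}^{(\mu-\beta)}(0)\,[I_r-2^{|\mu|}\widehat{a}(0)]^{-1},\qquad\mu\in\Lambda_m\setminus\{\mathbf{0}\}.$$ (2) For any $\upsilon_a\in(l_0(\mathbb{Z}^d))^{1\times r}$ satisfying (A) and (B), $$\widehat{\upsilon_a}(\xi)\widehat{\phi}(\xi+2\pi k)=\boldsymbol{\delta}(k)+\mathscr{O}(\|\xi\|^{m+1}),\quad\xi\to0,\ \text{for all }k\in\mathbb{Z}^d.$$ Consequently, $\mathsf{p}=\sum_{k\in\mathbb{Z}^d}(\mathsf{p}*\upsilon_a)(k)\phi(\cdot-k)$ for all $\mathsf{p}\in\Pi_m$. (3) The mask $a$ has order $m+1$ sum rules with a matching filter $\upsilon_a\in(l_0(\mathbb{Z}^d))^{1\times r}$ satisfying $$\widehat{\upsilon_a}(\xi)=\left[(i\xi)^{\nu_1}+\mathscr{O}(\|\xi\|^{|\nu_1|+1}),\ (i\xi)^{\nu_2}+\mathscr{O}(\|\xi\|^{|\nu_2|+1}),\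 \ldots,\ (i\xi)^{\nu_r}+\mathscr{O}(\|\xi\|^{|\nu_r|+1})\right],\quad\xi\to0.$$ (4) Let $\upsilon_a$ be a matching filter as in item (3). For all $\mu\in\Lambda_m$, the vector polynomial $\vec{\mathsf{p}}_\mu:=\frac{(\cdot)^\mu}{\mu!}*\upsilon_a$ satisfies $\mathcal{S}_a\vec{\mathsf{p}}_\mu=2^{-|\mu|}\vec{\mathsf{p}}_\mu$, $\sum_{k\in\mathbb{Z}^d}\vec{\mathsf{p}}_\mu(k)\phi(\cdot-k)=\frac{(\cdot)^\mu}{\mu!}$, and, for all $\ell=1,\ldots,r$, $$\vec{\mathsf{p}}_\mu(x)e_\ell=\begin{cases}\displaystyle\frac{x^{\mu-\nu_\ell}}{(\mu-\nu_\ell)!}+\sum_{0\le\beta\le\mu,\,|\beta|>|\nu_\ell|}\frac{(-i)^{|\beta|}}{\beta!}\frac{x^{\mu-\beta}}{(\mu-\beta)!}\widehat{\upsilon_a}^{(\beta)}(0)e_\ell,&\text{if }\nu_\ell\le\mu,\\[2mm]\displaystyle\sum_{0\le\beta\le\mu,\,|\beta|>|\nu_\ell|}\frac{(-i)^{|\beta|}}{\beta!}\frac{x^{\mu-\beta}}{(\mu-\beta)!}\widehat{\upsilon_a}^{(\beta)}(0)e_\ell,&\text{otherwise.}\end{cases}$$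
   Context: Notation. $\mathbb{N}_0=\mathbb{N}\cup\{0\}$. $(l(\mathbb{Z}^d))^{s\times r}$ is the space of all sequences $u:\mathbb{Z}^d\to\mathbb{C}^{s\times r}$; $(l_0(\mathbb{Z}^d))^{s\times r}$ is the subspace of finitely supported ones, and for such $u$, $\widehat{u}(\xi):=\sum_{k\in\mathbb{Z}^d}u(k)e^{-ik\cdot\xi}$. The Fourier transform of functions is $\widehat{f}(\xi)=\int_{\mathbb{R}^d}f(x)e^{-ix\cdot\xi}dx$. $\boldsymbol{\delta}(0)=1$ and $\boldsymbol{\delta}(k)=0$ for $k\in\mathbb{Z}^d\setminus\{0\}$. $e_\ell$ is the $\ell$th unit coordinate column vector of $\mathbb{R}^r$. Usual multi-index notation: $|\mu|$, $\mu!$, $x^\mu$, $\partial^\mu$ for $\mu\in\mathbb{N}_0^d$; $f^{(\mu)}:=\partial^\mu f$; $\beta\le\mu$ means all entries of $\mu-\beta$ are nonnegative; $(i\xi)^\mu=i^{|\mu|}\xi^\mu$. $\Lambda_m:=\{\mu\in\mathbb{N}_0^d:|\mu|\le m\}$. $\mathscr{C}^m(\mathbb{R}^d)$: functions with continuous partial derivatives up to order $m$. $\Pi_m$: $d$-variate polynomials of total degree at most $m$; polynomials are identified with their restrictions to $\mathbb{Z}^d$. For a polynomial $\mathsf{p}$ and $v\in(l_0(\mathbb{Z}^d))^{1\times r}$, $\mathsf{p}*v:=\sum_{k\in\mathbb{Z}^d}\mathsf{p}(\cdot-k)v(k)$. For smooth $f,g$, "$f(\xi)=g(\xi)+\mathscr{O}(\|\xi\|^{n+1})$,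 $\xi\to0$" means $f^{(\mu)}(0)=g^{(\mu)}(0)$ for all $|\mu|\le n$. Ordered multiset: elements of $\Lambda=\{\nu_1,\ldots,\nu_r\}$ may repeat; $r=\#\Lambda$ counts multiplicity. Subdivision operator. For $a\in(l_0(\mathbb{Z}^d))^{r\times r}$ and $v\in(l(\mathbb{Z}^d))^{s\times r}$, $(\mathcal{S}_av)(j):=2^d\sum_{k\in\mathbb{Z}^d}v(k)a(j-2k)$, $j\in\mathbb{Z}^d$. Generalized Hermite subdivision scheme of type $\Lambda$ with mask $a$. Put $\mathsf{D}_\Lambda:=\mathrm{diag}(2^{-|\nu_1|},\ldots,2^{-|\nu_r|})$; from an initial $w_0\in(l(\mathbb{Z}^d))^{1\times r}$ compute $w_n:=(\mathcal{S}_a^nw_0)\mathsf{D}_\Lambda^{-n}$, $n\in\mathbb{N}$. It is convergent with limit functions in $\mathscr{C}^m(\mathbb{R}^d)$ if for every $w_0\in(l(\mathbb{Z}^d))^{1\times r}$ there is $\eta\in\mathscr{C}^m(\mathbb{R}^d)$ such that for every constant $K>0$, $$\lim_{n\to\infty}\max_{k\in\mathbb{Z}^d\cap[-2^nK,2^nK]^d}|w_n(k)e_\ell-\eta^{(\nu_\ell)}(2^{-n}k)|=0,\qquad\ell=1,\ldots,r.$$ Its basis vector function $\phi=[\phi_1,\ldots,\phi_r]^{\mathsf{T}}$ is defined by $\lim_{n\to\infty}\sup_{k\in\mathbb{Z}^d}\|(\mathcal{S}_a^n(\boldsymbol{\delta}I_r))(k)e_1-\phi(2^{-n}k)\|=0$;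 i.e. $\phi_j$ is the limit function $\eta$ for the initial data $w_0=\boldsymbol{\delta}e_j^{\mathsf{T}}$. Sum rules. $a\in(l_0(\mathbb{Z}^d))^{r\times r}$ has order $m+1$ sum rules with a matching filter $\upsilon_a\in(l_0(\mathbb{Z}^d))^{1\times r}$ if $\widehat{\upsilon_a}(0)\ne0$ and, as $\xi\to0$, $\widehat{\upsilon_a}(2\xi)\widehat{a}(\xi)=\widehat{\upsilon_a}(\xi)+\mathscr{O}(\|\xi\|^{m+1})$ and $\widehat{\upsilon_a}(2\xi)\widehat{a}(\xi+\pi\omega)=\mathscr{O}(\|\xi\|^{m+1})$ for all $\omega\in\Gamma\setminus\{0\}$, where $\Gamma:=[0,1]^d\cap\mathbb{Z}^d$. *)

theory Defs
  imports "HOL-Analysis.Analysis" "HOL-Computational_Algebra.Polynomial"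
begin

text \<open>
  Conventions: the dimension $d$ is the size of the index type \<open>'d\<close> and $r$ the size of \<open>'r\<close>;
  both are linearly ordered, so that \<open>first\<close> stands for the index $1$.  Matrices of size
  $s \times r$ have type \<open>complex^'r^'s\<close>, and row vectors are the case \<open>'s = 1\<close>.
  Note that \<open>*\<close> and \<open>^\<close> on these types are entrywise; products are written \<open>**\<close> and \<open>*v\<close>.
\<close>

definition first :: "'r::{finite,linorder}" where
  "first = Min UNIV"

definition of_int_vec :: "int^'d \<Rightarrow> real^'d" where
  "of_int_vec k = (\<chi> i. real_of_int (k $ i))"

definition mdeg :: "nat^'d \<Rightarrow> nat" where
  "mdeg \<mu> = (\<Sum>i\<in>UNIV. \<mu> $ i)"

definition mfact :: "nat^'d \<Rightarrow> real" where
  "mfact \<mu> = (\<Prod>i\<in>UNIV. fact (\<mu> $ i))"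

definition mpow :: "real^'d \<Rightarrow> nat^'d \<Rightarrow> real" where
  "mpow x \<mu> = (\<Prod>i\<in>UNIV. (x $ i) ^ (\<mu> $ i))"

definition pderiv_dir :: "'d \<Rightarrow> (real^'d \<Rightarrow> 'b::real_normed_vector) \<Rightarrow> real^'d \<Rightarrow> 'b" where
  "pderiv_dir i f x = vector_derivative (\<lambda>t. f (x + t *\<^sub>R axis i 1)) (at 0)"

definition mpartial ::
  "nat^'d::{finite,linorder} \<Rightarrow> (real^'d::{finite,linorder} \<Rightarrow> 'b::real_normed_vector) \<Rightarrow> real^'d::{finite,linorder} \<Rightarrow> 'b" where
  "mpartial \<mu> f = foldr (\<lambda>i. pderiv_dir i ^^ (\<mu> $ i)) (sorted_list_of_set UNIV) f"

primrec C_class :: "nat \<Rightarrow> (real^'d \<Rightarrow> 'b::real_normed_vector) \<Rightarrow> bool" where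
  "C_class 0 f \<longleftrightarrow> continuous_on UNIV f"
| "C_class (Suc m) f \<longleftrightarrow> continuous_on UNIV f \<and>
     (\<forall>i. (\<forall>x. (\<lambda>t. f (x + t *\<^sub>R axis i 1)) differentiable (at 0)) \<and>
          C_class m (pderiv_dir i f))"

text \<open>\<open>eq_O n f g\<close> is $f(\xi) = g(\xi) + O(\|\xi\|^n)$ as $\xi \to 0$, for smooth $f$ and $g$.\<close>

definition eq_O ::
  "nat \<Rightarrow> (real^'d::{finite,linorder} \<Rightarrow> 'b::real_normed_vector) \<Rightarrow> (real^'d::{finite,linorder} \<Rightarrow> 'b) \<Rightarrow> bool" where
  "eq_O n f g \<longleftrightarrow> (\<forall>\<mu>. mdeg \<mu> < n \<longrightarrow> mpartial \<mu> f 0 = mpartial \<mu> g 0)"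

definition poly_fun :: "nat \<Rightarrow> (real^'d \<Rightarrow> complex) set" where
  "poly_fun m = {p. \<exists>c. p = (\<lambda>x. \<Sum>\<mu> | mdeg \<mu> \<le> m. c \<mu> * of_real (mpow x \<mu>))}"

primrec mprod :: "(nat \<Rightarrow> complex^'r^'r) \<Rightarrow> nat \<Rightarrow> complex^'r^'r" where
  "mprod A 0 = mat 1"
| "mprod A (Suc n) = mprod A n ** A (Suc n)"

definition eigenvalue :: "complex^'r^'r \<Rightarrow> complex \<Rightarrow> bool" where
  "eigenvalue A z \<longleftrightarrow> (\<exists>v. v \<noteq> 0 \<and> A *v v = z *s v)"

definition charpoly :: "complex^'r^'r \<Rightarrow> complex poly" where
  "charpoly A = det (\<chi> i j. (if i = j then [:0, 1:] else 0) - [:A $ i $ j:])"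

definition simple_eigenvalue :: "complex^'r^'r \<Rightarrow> complex \<Rightarrow> bool" where
  "simple_eigenvalue A z \<longleftrightarrow> eigenvalue A z \<and> order z (charpoly A) = 1"

definition finsupp :: "('k \<Rightarrow> 'b::zero) \<Rightarrow> bool" where
  "finsupp u \<longleftrightarrow> finite {k. u k \<noteq> 0}"

definition delta :: "int^'d \<Rightarrow> complex" where
  "delta k = (if k = 0 then 1 else 0)"

definition symbol :: "(int^'d \<Rightarrow> complex^'r^'s) \<Rightarrow> real^'d \<Rightarrow> complex^'r^'s" where
  "symbol u \<xi> =
     (\<chi> i j. \<Sum>k | u k \<noteq> 0. u k $ i $ j * exp (- \<i> * of_real (of_int_vec k \<bullet> \<xi>)))"

definition fourier :: "(real^'d \<Rightarrow> complex^'r) \<Rightarrow> real^'d \<Rightarrow> complex^'r" where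
  "fourier f \<xi> = (\<chi> j. LINT x|lborel. f x $ j * exp (- \<i> * of_real (x \<bullet> \<xi>)))"

text \<open>The convolution $p * v$, as a function on all of $R^d$.\<close>

definition poly_conv ::
  "(real^'d \<Rightarrow> complex) \<Rightarrow> (int^'d \<Rightarrow> complex^'r^1) \<Rightarrow> real^'d \<Rightarrow> complex^'r^1" where
  "poly_conv p v x = (\<chi> i j. \<Sum>k | v k \<noteq> 0. p (x - of_int_vec k) * v k $ i $ j)"

text \<open>For finitely supported $a$ the index set below contains all nonzero terms and is finite.\<close>

definition subdivision ::
  "(int^'d \<Rightarrow> complex^'r^'r) \<Rightarrow> (int^'d \<Rightarrow> complex^'r^'s) \<Rightarrow> int^'d \<Rightarrow> complex^'r^'s" where
  "subdivision a v j =
     (2 ^ CARD('d)) *\<^sub>R (\<Sum>k | a (j - 2 *s k) \<noteq> 0. v k ** a (j - 2 *s k))"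

definition D_mat :: "('r \<Rightarrow> nat^'d) \<Rightarrow> complex^'r^'r" where
  "D_mat \<nu> = (\<chi> i j. if i = j then (1 / 2) ^ mdeg (\<nu> i) else 0)"

definition scheme_iter ::
  "('r \<Rightarrow> nat^'d) \<Rightarrow> (int^'d \<Rightarrow> complex^'r^'r) \<Rightarrow> (int^'d \<Rightarrow> complex^'r^1) \<Rightarrow> nat \<Rightarrow>
   int^'d \<Rightarrow> complex^'r^1" where
  "scheme_iter \<nu> a w0 n k =
     (subdivision a ^^ n) w0 k ** mprod (\<lambda>_. matrix_inv (D_mat \<nu>)) n"

definition is_limit_function ::
  "nat \<Rightarrow> ('r \<Rightarrow> nat^'d::{finite,linorder}) \<Rightarrow> (int^'d::{finite,linorder} \<Rightarrow> complex^'r^'r) \<Rightarrow>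
   (int^'d::{finite,linorder} \<Rightarrow> complex^'r^1) \<Rightarrow> (real^'d::{finite,linorder} \<Rightarrow> complex) \<Rightarrow> bool" where
  "is_limit_function m \<nu> a w0 \<eta> \<longleftrightarrow> C_class m \<eta> \<and>
     (\<forall>K>0. \<forall>l.
        (\<lambda>n. Max ((\<lambda>k. cmod (scheme_iter \<nu> a w0 n k $ 1 $ l -
                              mpartial (\<nu> l) \<eta> ((1 / 2) ^ n *\<^sub>R of_int_vec k)))
                  ` {k. \<forall>i. \<bar>real_of_int (k $ i)\<bar> \<le> 2 ^ n * K})) \<longlonglongrightarrow> 0)"

definition hermite_convergent ::
  "nat \<Rightarrow> ('r \<Rightarrow> nat^'d::{finite,linorder}) \<Rightarrow> (int^'d::{finite,linorder} \<Rightarrow> complex^'r^'r) \<Rightarrow> bool" where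
  "hermite_convergent m \<nu> a \<longleftrightarrow> (\<forall>w0. \<exists>\<eta>. is_limit_function m \<nu> a w0 \<eta>)"

text \<open>
  The entry $\phi_j$ is the limit function for the initial data $\delta e_j^T$.  It is unique
  if \<open>\<nu> first = 0\<close>, since it is continuous and determined on the dyadic points.
\<close>

definition basis_vector_function ::
  "nat \<Rightarrow> ('r \<Rightarrow> nat^'d::{finite,linorder}) \<Rightarrow> (int^'d::{finite,linorder} \<Rightarrow> complex^'r^'r) \<Rightarrow>
   (real^'d::{finite,linorder} \<Rightarrow> complex^'r) \<Rightarrow> bool" where
  "basis_vector_function m \<nu> a \<phi> \<longleftrightarrow>
     (\<forall>j. is_limit_function m \<nu> a (\<lambda>k. \<chi> i. delta k *s axis j 1) (\<lambda>x. \<phi> x $ j))"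

definition cube :: "(int^'d) set" where
  "cube = {\<omega>. \<forall>i. 0 \<le> \<omega> $ i \<and> \<omega> $ i \<le> 1}"

definition sum_rules ::
  "nat \<Rightarrow> (int^'d::{finite,linorder} \<Rightarrow> complex^'r^'r) \<Rightarrow> (int^'d::{finite,linorder} \<Rightarrow> complex^'r^1) \<Rightarrow> bool" where
  "sum_rules n a \<upsilon> \<longleftrightarrow> symbol \<upsilon> 0 \<noteq> 0 \<and>
     eq_O n (\<lambda>\<xi>. symbol \<upsilon> (2 *\<^sub>R \<xi>) ** symbol a \<xi>) (symbol \<upsilon>) \<and>
     (\<forall>\<omega>\<in>cube - {0}.
        eq_O n (\<lambda>\<xi>. symbol \<upsilon> (2 *\<^sub>R \<xi>) ** symbol a (\<xi> + pi *\<^sub>R of_int_vec \<omega>)) (\<lambda>_. 0))"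

definition cond_A ::
  "(int^'d \<Rightarrow> complex^'r^'r) \<Rightarrow> (real^'d \<Rightarrow> complex^'r) \<Rightarrow> (int^'d \<Rightarrow> complex^'r^1) \<Rightarrow> bool" where
  "cond_A a \<phi> \<upsilon> \<longleftrightarrow>
     symbol \<upsilon> 0 ** symbol a 0 = symbol \<upsilon> 0 \<and> (symbol \<upsilon> 0 *v fourier \<phi> 0) $ 1 = 1"

definition cond_B ::
  "nat \<Rightarrow> (int^'d::{finite,linorder} \<Rightarrow> complex^'r^'r) \<Rightarrow> (int^'d::{finite,linorder} \<Rightarrow> complex^'r^1) \<Rightarrow> bool" where
  "cond_B m a \<upsilon> \<longleftrightarrow>
     (\<forall>\<mu>. \<mu> \<noteq> 0 \<and> mdeg \<mu> \<le> m \<longrightarrow>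
        mpartial \<mu> (symbol \<upsilon>) 0 =
        (\<Sum>\<beta> | \<beta> \<le> \<mu> \<and> \<beta> \<noteq> \<mu>.
           (2 ^ mdeg \<beta> * mfact \<mu> / (mfact \<beta> * mfact (\<mu> - \<beta>))) *\<^sub>R
           (mpartial \<beta> (symbol \<upsilon>) 0 ** mpartial (\<mu> - \<beta>) (symbol a) 0
              ** matrix_inv (mat 1 - 2 ^ mdeg \<mu> *\<^sub>R symbol a 0))))"

definition hermite_filter ::
  "('r \<Rightarrow> nat^'d::{finite,linorder}) \<Rightarrow> (int^'d::{finite,linorder} \<Rightarrow> complex^'r^1) \<Rightarrow> bool" where
  "hermite_filter \<nu> \<upsilon> \<longleftrightarrow>
     (\<forall>l. eq_O (mdeg (\<nu> l) + 1) (\<lambda>\<xi>. symbol \<upsilon> \<xi> $ 1 $ l)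
            (\<lambda>\<xi>. \<i> ^ mdeg (\<nu> l) * of_real (mpow \<xi> (\<nu> l))))"

end

theory Submission
  imports Defs
begin

text \<open>
  Everything is reduced to finite jets at the origin.  The Fourier transform of $\phi$ is a limit of
  Riemann sums of the iterates, which are products of dilated symbols; the refinement equation
  follows by shifting the product.  Since $\phi$ is $C^m$ with compact support, the jets of
  $\widehat\phi$ at $2^n \cdot 2\pi k$ with $k \neq 0$ decay faster than $2^{-mn}$ (Riemann-Lebesgue),
  while the refinement equation turns these points into powers of $\widehat a(0)$.  Together with the
  spanning hypothesis this splits $C^r$ into the line of $\widehat\phi(0)$ and a space on which
  $2^{mn} \widehat a(0)^n$ tends to zero, and it yields the Strang-Fix conditions and the sum rules.

  Polynomial reproduction needs no Poisson summation: by the sum rules the data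
  $(\cdot)^\mu/\mu! * \upsilon$ is an eigenvector of the subdivision operator, so its limit function can be
  computed directly and equals $\widehat\upsilon_1(0)\, x^\mu/\mu!$.  Convergence of the derivative
  components of the same scheme at the origin forces the Hermite form of the filter.
\<close>

section \<open>Calculus of iterated partial derivatives\<close>

text \<open>The strict bound in item (1) and the jets of top order |\<mu>| = m in item (2) both need
  decay that is little-o of 2^(-mn); a mere bound of that size would lose exactly these cases. Hence
  the induction for the decay starts from the Riemann-Lebesgue lemma, and m = 0 is an ordinary case.
  That the Fourier transform of \<phi> is nonzero at 0 has to be derived: otherwise the powers of
  \<open>symbol a 0\<close> contract every vector, the refinement equation forces the transform to
  vanish identically, and the spanning hypothesis fails. Filters carry two normalisations: pairing 1
  with the transform at 0 in (A), and first entry 1 at 0 in the Hermite form. They agree because a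
  row vector fixed by \<open>symbol a 0\<close> is unchanged by the matrix powers whose first
  columns converge to the transform at 0. Item (4) concerns an arbitrary Hermite filter with sum
  rules, so reproduction is derived from the sum rules and the normalisation at 0, which serves
  items (2) and (4) alike.\<close>

definition smooth :: "(real^'d \<Rightarrow> 'b::real_normed_vector) \<Rightarrow> bool" where
  "smooth f \<longleftrightarrow> (\<forall>n. C_class n f)"

text \<open>Relational companion of \<open>pderiv_dir\<close>: existence and value of the derivative
  travel together, so that calculus rules are proved once and transferred by
  \<open>pderiv_dir_eqI\<close>.\<close>

definition has_pderiv :: "'d \<Rightarrow> (real^'d \<Rightarrow> 'b::real_normed_vector) \<Rightarrow> (real^'d \<Rightarrow> 'b) \<Rightarrow> bool" where
  "has_pderiv i f f' \<longleftrightarrow>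
     (\<forall>x. ((\<lambda>t. f (x + t *\<^sub>R axis i 1)) has_vector_derivative f' x) (at 0))"

lemma has_pderivD:
  "has_pderiv i f f' \<Longrightarrow> ((\<lambda>t. f (x + t *\<^sub>R axis i 1)) has_vector_derivative f' x) (at 0)"
  by (simp add: has_pderiv_def)

lemma pderiv_dir_eqI: "has_pderiv i f f' \<Longrightarrow> pderiv_dir i f = f'"
  by (auto simp: has_pderiv_def pderiv_dir_def intro!: ext vector_derivative_at)

lemma C_class_continuous: "C_class n f \<Longrightarrow> continuous_on UNIV f"
  by (cases n) auto

lemma C_class_SucD:
  assumes "C_class (Suc n) f"
  shows "has_pderiv i f (pderiv_dir i f)" "C_class n (pderiv_dir i f)"
  using assms by (auto simp: has_pderiv_def pderiv_dir_def vector_derivative_works)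

lemma C_class_SucI:
  assumes "continuous_on UNIV f" "\<And>i. has_pderiv i f (f' i)" "\<And>i. C_class n (f' i)"
  shows "C_class (Suc n) f"
  using assms pderiv_dir_eqI[OF assms(2)]
  by (auto simp: has_pderiv_def intro: differentiableI_vector)

lemma C_class_Suc_imp: "C_class (Suc n) f \<Longrightarrow> C_class n f"
  by (induction n arbitrary: f) auto

lemma smooth_continuous: "smooth f \<Longrightarrow> continuous_on UNIV f"
  using C_class_continuous smooth_def by blast

lemma smooth_has_pderiv: "smooth f \<Longrightarrow> has_pderiv i f (pderiv_dir i f)"
  using C_class_SucD(1) smooth_def by blast

lemma smooth_pderiv_dir: "smooth f \<Longrightarrow> smooth (pderiv_dir i f)"
  using C_class_SucD(2) smooth_def by blast

text \<open>Induction on the order: derivatives never leave \<open>P\<close>, and members of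
  \<open>P\<close> are continuous. Symbols, Fourier transforms of compactly supported functions, and
  normalised monomials together with 0 each form such a class.\<close>

lemma smooth_coinduct:
  assumes "P f"
    and "\<And>f. P f \<Longrightarrow> continuous_on UNIV f"
    and "\<And>f i. P f \<Longrightarrow> \<exists>f'. P f' \<and> has_pderiv i f f'"
  shows "smooth f"
proof -
  have "C_class n f" for n
    using assms(1)
  proof (induction n arbitrary: f)
    case 0
    then show ?case using assms(2) by simp
  next
    case (Suc n)
    obtain f' where "\<And>i. P (f' i)" "\<And>i. has_pderiv i f (f' i)"
      using assms(3)[OF Suc.prems] by metis
    then show ?case
      using assms(2) Suc by (intro C_class_SucI) auto
  qed
  then show ?thesis by (simp add: smooth_def)
qed

lemma has_pderiv_const: "has_pderiv i (\<lambda>x. c) (\<lambda>x. 0)"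
  by (simp add: has_pderiv_def)

lemma has_pderiv_add:
  "has_pderiv i f f' \<Longrightarrow> has_pderiv i g g' \<Longrightarrow> has_pderiv i (\<lambda>x. f x + g x) (\<lambda>x. f' x + g' x)"
  by (simp add: has_pderiv_def has_vector_derivative_add)

lemma has_pderiv_sum:
  "(\<And>b. b \<in> B \<Longrightarrow> has_pderiv i (f b) (f' b)) \<Longrightarrow>
     has_pderiv i (\<lambda>x. \<Sum>b\<in>B. f b x) (\<lambda>x. \<Sum>b\<in>B. f' b x)"
  by (auto simp: has_pderiv_def intro!: has_vector_derivative_sum)

lemma has_pderiv_bounded_linear:
  assumes "bounded_linear L" "has_pderiv i f f'"
  shows "has_pderiv i (\<lambda>x. L (f x)) (\<lambda>x. L (f' x))"
  using assms by (auto simp: has_pderiv_def intro: bounded_linear.has_vector_derivative)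

lemma has_pderiv_affine:
  assumes "has_pderiv i f f'"
  shows "has_pderiv i (\<lambda>x. f (c *\<^sub>R x + b)) (\<lambda>x. c *\<^sub>R f' (c *\<^sub>R x + b))"
  unfolding has_pderiv_def
proof
  fix x
  have "((\<lambda>t. c * t) has_vector_derivative c) (at 0)"
    by (auto intro!: derivative_eq_intros)
  \<comment> \<open>Moving x by t along an axis moves the argument of f by c * t along the same
    axis, so only a scalar substitution has to be composed.\<close>
  then have "(((\<lambda>t. f ((c *\<^sub>R x + b) + t *\<^sub>R axis i 1)) \<circ> (\<lambda>t. c * t))
      has_vector_derivative c *\<^sub>R f' (c *\<^sub>R x + b)) (at 0)"
    using has_pderivD[OF assms, of "c *\<^sub>R x + b"] by (intro vector_diff_chain_at) simp_all
  then show "((\<lambda>t. f (c *\<^sub>R (x + t *\<^sub>R axis i 1) + b)) has_vector_derivative c *\<^sub>R f' (c *\<^sub>R x + b)) (at 0)"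
    by (simp add: o_def algebra_simps)
qed

context bounded_bilinear
begin

lemma has_pderiv_prod:
  assumes "has_pderiv i f f'" "has_pderiv i g g'"
  shows "has_pderiv i (\<lambda>x. prod (f x) (g x)) (\<lambda>x. prod (f' x) (g x) + prod (f x) (g' x))"
  unfolding has_pderiv_def
proof
  fix x
  from has_vector_derivative[OF has_pderivD[OF assms(1), of x] has_pderivD[OF assms(2), of x]]
  show "((\<lambda>t. prod (f (x + t *\<^sub>R axis i 1)) (g (x + t *\<^sub>R axis i 1)))
      has_vector_derivative prod (f' x) (g x) + prod (f x) (g' x)) (at 0)"
    by (simp add: add.commute)
qed

end

section \<open>Closure properties of C^n and of smooth functions\<close>

lemma C_class_const: "C_class n (\<lambda>x. c)"
proof (induction n arbitrary: c)
  case (Suc n)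
  then show ?case
    by (intro C_class_SucI[where f' = "\<lambda>i x. 0"] has_pderiv_const) simp_all
qed simp

lemma C_class_add: "C_class n f \<Longrightarrow> C_class n g \<Longrightarrow> C_class n (\<lambda>x. f x + g x)"
proof (induction n arbitrary: f g)
  case 0
  then show ?case by (auto intro: continuous_on_add)
next
  case (Suc n)
  show ?case
    by (intro C_class_SucI[where f' = "\<lambda>i x. pderiv_dir i f x + pderiv_dir i g x"]
        has_pderiv_add continuous_on_add Suc.IH
        C_class_SucD[OF Suc.prems(1)] C_class_SucD[OF Suc.prems(2)]
        C_class_continuous[OF Suc.prems(1)] C_class_continuous[OF Suc.prems(2)])
qed

lemma C_class_bounded_linear:
  "bounded_linear L \<Longrightarrow> C_class n f \<Longrightarrow> C_class n (\<lambda>x. L (f x))"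
proof (induction n arbitrary: f)
  case 0
  then show ?case by (simp add: bounded_linear.continuous_on)
next
  case (Suc n)
  have "continuous_on UNIV f" using Suc.prems C_class_continuous by blast
  then show ?case
    by (intro C_class_SucI[where f' = "\<lambda>i x. L (pderiv_dir i f x)"]
        has_pderiv_bounded_linear[OF Suc.prems(1)] bounded_linear.continuous_on[OF Suc.prems(1)]
        Suc.IH Suc.prems(1)
        C_class_SucD[OF Suc.prems(2)])
qed

lemma C_class_affine:
  fixes f :: "real^'d \<Rightarrow> 'b::real_normed_vector"
  shows "C_class n f \<Longrightarrow> C_class n (\<lambda>x. f (c *\<^sub>R x + b))"
proof (induction n arbitrary: f)
  case 0
  then show ?case
    by (auto intro!: continuous_intros continuous_on_compose2[of UNIV f UNIV])
next
  case (Suc n)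
  have "continuous_on UNIV f" using Suc.prems C_class_continuous by blast
  then have "continuous_on UNIV (\<lambda>x. f (c *\<^sub>R x + b))"
    by (auto intro!: continuous_intros continuous_on_compose2[of UNIV f UNIV])
  moreover have "C_class n (\<lambda>x. c *\<^sub>R pderiv_dir i f (c *\<^sub>R x + b))" for i
    by (intro C_class_bounded_linear[OF bounded_linear_scaleR_right] Suc.IH C_class_SucD[OF Suc.prems])
  ultimately show ?case
    by (intro C_class_SucI[where f' = "\<lambda>i x. c *\<^sub>R pderiv_dir i f (c *\<^sub>R x + b)"]
        has_pderiv_affine[OF C_class_SucD(1)[OF Suc.prems]])
qed

lemma (in bounded_bilinear) C_class_prod:
  "C_class n f \<Longrightarrow> C_class n g \<Longrightarrow> C_class n (\<lambda>x. prod (f x) (g x))"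
proof (induction n arbitrary: f g)
  case 0
  then show ?case by (simp add: continuous_on)
next
  case (Suc n)
  have "continuous_on UNIV f" "continuous_on UNIV g"
    using Suc.prems C_class_continuous by blast+
  \<comment> \<open>Each summand pairs a derivative of class n with an undifferentiated factor of
    class n + 1, which has to be weakened first.\<close>
  moreover have "C_class n (\<lambda>x. prod (pderiv_dir i f x) (g x) + prod (f x) (pderiv_dir i g x))" for i
    by (intro C_class_add Suc.IH C_class_SucD[OF Suc.prems(1)] C_class_SucD[OF Suc.prems(2)]
        C_class_Suc_imp[OF Suc.prems(1)] C_class_Suc_imp[OF Suc.prems(2)])
  ultimately show ?case
    by (intro C_class_SucI[where
          f' = "\<lambda>i x. prod (pderiv_dir i f x) (g x) + prod (f x) (pderiv_dir i g x)"]
        has_pderiv_prod C_class_SucD(1)[OF Suc.prems(1)] C_class_SucD(1)[OF Suc.prems(2)])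
      (auto simp: continuous_on)
qed

lemma smooth_const: "smooth (\<lambda>x. c)"
  by (simp add: smooth_def C_class_const)

lemma smooth_bounded_linear: "bounded_linear L \<Longrightarrow> smooth f \<Longrightarrow> smooth (\<lambda>x. L (f x))"
  by (simp add: smooth_def C_class_bounded_linear)

lemma smooth_affine: "smooth f \<Longrightarrow> smooth (\<lambda>x. f (c *\<^sub>R x + b))"
  by (simp add: smooth_def C_class_affine)

lemma (in bounded_bilinear) smooth_prod:
  "smooth f \<Longrightarrow> smooth g \<Longrightarrow> smooth (\<lambda>x. prod (f x) (g x))"
  by (simp add: smooth_def C_class_prod)

lemma pderiv_dir_bounded_linear:
  "bounded_linear L \<Longrightarrow> smooth f \<Longrightarrow> pderiv_dir i (\<lambda>x. L (f x)) = (\<lambda>x. L (pderiv_dir i f x))"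
  by (rule pderiv_dir_eqI[OF has_pderiv_bounded_linear[OF _ smooth_has_pderiv]])

lemma pderiv_dir_add:
  "smooth f \<Longrightarrow> smooth g \<Longrightarrow>
    pderiv_dir i (\<lambda>x. f x + g x) = (\<lambda>x. pderiv_dir i f x + pderiv_dir i g x)"
  by (intro pderiv_dir_eqI has_pderiv_add smooth_has_pderiv)

lemma (in bounded_bilinear) pderiv_dir_prod:
  "smooth f \<Longrightarrow> smooth g \<Longrightarrow> pderiv_dir i (\<lambda>x. prod (f x) (g x)) =
     (\<lambda>x. prod (pderiv_dir i f x) (g x) + prod (f x) (pderiv_dir i g x))"
  by (intro pderiv_dir_eqI has_pderiv_prod smooth_has_pderiv)

section \<open>Iterated partial derivatives\<close>

lemma mdeg_eq_sum_list: "mdeg \<mu> = (\<Sum>i\<leftarrow>sorted_list_of_set UNIV. \<mu> $ i)"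
  by (simp add: mdeg_def sum_list_distinct_conv_sum_set)

text \<open>The counter in \<open>R\<close> records how many derivatives have been taken so far.\<close>

lemma mpartial_rel:
  assumes step: "\<And>n f g i. R n f g \<Longrightarrow> R (Suc n) (pderiv_dir i f) (pderiv_dir i g)"
    and "R n f g"
  shows "R (n + mdeg \<mu>) (mpartial \<mu> f) (mpartial \<mu> g)"
proof -
  have pow: "R (n + k) ((pderiv_dir i ^^ k) f) ((pderiv_dir i ^^ k) g)" if "R n f g" for i k n f g
    using that by (induction k) (auto intro: step)
  have "R (n + (\<Sum>i\<leftarrow>xs. \<mu> $ i)) (foldr (\<lambda>i. pderiv_dir i ^^ (\<mu> $ i)) xs f)
      (foldr (\<lambda>i. pderiv_dir i ^^ (\<mu> $ i)) xs g)" for xs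
  proof (induction xs)
    case Nil
    then show ?case using assms(2) by simp
  next
    case (Cons i xs)
    from pow[OF this, of "\<mu> $ i" i] show ?case by (simp add: add_ac)
  qed
  then show ?thesis by (simp add: mpartial_def mdeg_eq_sum_list)
qed

lemma mpartial_bounded_linear:
  assumes "bounded_linear L" "smooth f"
  shows "mpartial \<mu> (\<lambda>x. L (f x)) = (\<lambda>x. L (mpartial \<mu> f x))"
  using mpartial_rel[of "\<lambda>n f g. smooth f \<and> g = (\<lambda>x. L (f x))" 0 f "\<lambda>x. L (f x)" \<mu>] assms
  by (auto simp: smooth_pderiv_dir pderiv_dir_bounded_linear)

lemma mpartial_affine:
  fixes f :: "real^'d::{finite,linorder} \<Rightarrow> 'b::real_normed_vector"
  assumes "smooth f"
  shows "mpartial \<mu> (\<lambda>x. f (c *\<^sub>R x + b)) = (\<lambda>x. c ^ mdeg \<mu> *\<^sub>R mpartial \<mu> f (c *\<^sub>R x + b))"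
proof -
  have "pderiv_dir i (\<lambda>x. c ^ n *\<^sub>R f (c *\<^sub>R x + b)) = (\<lambda>x. c ^ Suc n *\<^sub>R pderiv_dir i f (c *\<^sub>R x + b))"
    if "smooth f" for n i and f :: "real^'d::{finite,linorder} \<Rightarrow> 'b"
    using has_pderiv_bounded_linear[OF bounded_linear_scaleR_right
        has_pderiv_affine[OF smooth_has_pderiv[OF that]], of i "c ^ n" c b]
    by (intro pderiv_dir_eqI) (simp add: mult.commute)
  then show ?thesis
    using mpartial_rel[of "\<lambda>n f g. smooth f \<and> g = (\<lambda>x. c ^ n *\<^sub>R f (c *\<^sub>R x + b))" 0 f
        "\<lambda>x. f (c *\<^sub>R x + b)" \<mu>] assms
    by (auto simp: smooth_pderiv_dir)
qed

lemma mpartial_dilate: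
  "smooth f \<Longrightarrow> mpartial \<mu> (\<lambda>x. f (c *\<^sub>R x)) = (\<lambda>x. c ^ mdeg \<mu> *\<^sub>R mpartial \<mu> f (c *\<^sub>R x))"
  using mpartial_affine[of f \<mu> c 0] by simp

lemma mpartial_translate:
  "smooth f \<Longrightarrow> mpartial \<mu> (\<lambda>x. f (x + b)) = (\<lambda>x. mpartial \<mu> f (x + b))"
  using mpartial_affine[of f \<mu> 1 b] by simp

text \<open>Used whenever all derivatives of a function are known in closed form: it suffices that
  one partial derivative raises the index by a unit. The coordinates in the fold are distinct, so
  each entry of the index is built up exactly once.\<close>

lemma mpartial_family:
  fixes \<mu> :: "nat^'d::{finite,linorder}"
  assumes "\<And>i \<mu>. pderiv_dir i (F \<mu>) = F (\<mu> + axis i 1)"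
  shows "mpartial \<mu> (F 0) = F \<mu>"
proof -
  have pow: "(pderiv_dir i ^^ k) (F \<mu>) = F (\<mu> + axis i k)" for i k \<mu>
  proof (induction k)
    case 0
    have "\<mu> + axis i 0 = \<mu>" by (simp add: axis_def vec_eq_iff)
    then show ?case by (simp only: funpow_0)
  next
    case (Suc k)
    have "axis i k + axis i 1 = (axis i (Suc k) :: nat^'d::{finite,linorder})" by (simp add: axis_def vec_eq_iff)
    then show ?case using Suc by (simp add: assms add.assoc)
  qed
  have "foldr (\<lambda>i. pderiv_dir i ^^ (\<mu> $ i)) xs (F 0) = F (\<chi> i. if i \<in> set xs then \<mu> $ i else 0)"
    if "distinct xs" for xs
    using that
  proof (induction xs)
    case Nil
    have "(\<chi> i. 0) = (0 :: nat^'d::{finite,linorder})" by (simp add: vec_eq_iff)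
    then show ?case by simp
  next
    case (Cons j xs)
    have "(\<chi> i. if i \<in> set xs then \<mu> $ i else 0) + axis j (\<mu> $ j) =
       (\<chi> i. if i \<in> set (j # xs) then \<mu> $ i else 0)"
      using Cons.prems by (auto simp: vec_eq_iff axis_def)
    then show ?case using Cons pow by simp
  qed
  from this[of "sorted_list_of_set UNIV"] show ?thesis
    by (simp add: mpartial_def)
qed

lemma mpartial_0:
  fixes f :: "real^'d::{finite,linorder} \<Rightarrow> 'b::real_normed_vector"
  shows "mpartial 0 f = f"
proof -
  have "foldr (\<lambda>i. pderiv_dir i ^^ ((0 :: nat^'d::{finite,linorder}) $ i)) xs f = f" for xs
    by (induction xs) auto
  then show ?thesis by (simp add: mpartial_def)
qed

lemma finite_le_multiindex: "finite {\<beta> :: nat^'d. \<beta> \<le> \<mu>}"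
proof (rule finite_subset)
  show "{\<beta>. \<beta> \<le> \<mu>} \<subseteq> vec_lambda ` (PiE UNIV (\<lambda>i. {..\<mu> $ i}))"
    by (auto simp: less_eq_vec_def intro!: image_eqI[where x = "vec_nth _"])
qed (intro finite_imageI finite_PiE, auto)

section \<open>Multi-index arithmetic and the Leibniz rule\<close>

lemma le_mdeg: "\<mu> $ i \<le> mdeg \<mu>"
  unfolding mdeg_def by (rule member_le_sum) auto

lemma finite_mdeg_le: "finite {\<mu> :: nat^'d. mdeg \<mu> \<le> m}"
proof (rule finite_subset)
  show "{\<mu> :: nat^'d. mdeg \<mu> \<le> m} \<subseteq> {\<mu>. \<mu> \<le> (\<chi> i. m)}"
    by (auto simp: less_eq_vec_def intro: order_trans[OF le_mdeg])
qed (rule finite_le_multiindex)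

text \<open>The product form suits a Leibniz rule proved coordinate by coordinate;
  \<open>mchoose_eq\<close> recovers the quotient of factorials in condition (B).\<close>

definition mchoose :: "nat^'d \<Rightarrow> nat^'d \<Rightarrow> real" where
  "mchoose \<mu> \<beta> = (\<Prod>i\<in>UNIV. of_nat (\<mu> $ i choose \<beta> $ i))"

lemma mfact_pos: "mfact \<mu> > 0"
  by (simp add: mfact_def prod_pos)

lemma mfact_nonzero [simp]: "mfact \<mu> \<noteq> 0"
  using mfact_pos[of \<mu>] by simp

lemma mchoose_eq: "\<beta> \<le> \<mu> \<Longrightarrow> mchoose \<mu> \<beta> = mfact \<mu> / (mfact \<beta> * mfact (\<mu> - \<beta>))"
  by (simp add: mchoose_def mfact_def less_eq_vec_def binomial_fact flip: prod_dividef prod.distrib)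

lemma mchoose_self [simp]: "mchoose \<mu> \<mu> = 1"
  by (simp add: mchoose_def)

lemma mdeg_mono: "\<beta> \<le> \<mu> \<Longrightarrow> mdeg \<beta> \<le> mdeg \<mu>"
  by (simp add: mdeg_def less_eq_vec_def sum_mono)

lemma mdeg_strict_mono:
  fixes \<beta> \<mu> :: "nat^'d"
  assumes "\<beta> \<le> \<mu>" "\<beta> \<noteq> \<mu>" shows "mdeg \<beta> < mdeg \<mu>"
proof -
  obtain i where "\<beta> $ i \<noteq> \<mu> $ i" using assms by (auto simp: vec_eq_iff)
  then show ?thesis
    using assms unfolding mdeg_def
    by (intro sum_strict_mono_ex1) (auto simp: less_eq_vec_def intro!: exI[of _ i] le_neq_implies_less)
qed

lemma mdeg_eq_0_iff [simp]: "mdeg \<mu> = 0 \<longleftrightarrow> \<mu> = 0"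
  by (auto simp: mdeg_def vec_eq_iff)

lemma (in bounded_bilinear) pderiv_dir_funpow_prod:
  fixes f :: "real^'d \<Rightarrow> 'a"
  assumes "smooth f" "smooth g"
  shows "(pderiv_dir i ^^ n) (\<lambda>x. prod (f x) (g x)) =
    (\<lambda>x. \<Sum>j\<le>n. of_nat (n choose j) *\<^sub>R prod ((pderiv_dir i ^^ j) f x) ((pderiv_dir i ^^ (n - j)) g x))"
  using assms
proof (induction n arbitrary: f g)
  case 0
  then show ?case by simp
next
  case (Suc n)
  let ?D = "pderiv_dir i"
  have add: "(?D ^^ n) (\<lambda>x. h x + k x) = (\<lambda>x. (?D ^^ n) h x + (?D ^^ n) k x)"
    if "smooth h" "smooth k" for h k :: "real^'d \<Rightarrow> 'c"
    using that
    by (induction n arbitrary: h k) (auto simp: funpow_Suc_right pderiv_dir_add smooth_pderiv_dir simp del: funpow.simps(2))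
  let ?T = "\<lambda>x j. prod ((?D ^^ j) f x) ((?D ^^ (Suc n - j)) g x)"
  \<comment> \<open>The innermost derivative is split off, so that the induction hypothesis applies
    to the products with \<open>?D f\<close> and with \<open>?D g\<close>.\<close>
  have "(?D ^^ Suc n) (\<lambda>x. prod (f x) (g x)) =
     (?D ^^ n) (\<lambda>x. prod (?D f x) (g x) + prod (f x) (?D g x))"
    using Suc.prems by (simp add: funpow_Suc_right pderiv_dir_prod del: funpow.simps(2))
  also have "\<dots> = (\<lambda>x. (\<Sum>j\<le>n. of_nat (n choose j) *\<^sub>R ?T x (Suc j)) +
      (\<Sum>j\<le>n. of_nat (n choose j) *\<^sub>R ?T x j))"
    using Suc.prems
    by (auto simp: add smooth_prod smooth_pderiv_dir Suc.IH funpow_Suc_right Suc_diff_le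
        simp del: funpow.simps(2) intro!: ext sum.cong)
  also have "\<dots> = (\<lambda>x. \<Sum>j\<le>Suc n. of_nat (Suc n choose j) *\<^sub>R ?T x j)"
  proof
    fix x
    \<comment> \<open>The added term has coefficient \<open>n choose Suc n\<close>, which is 0;
      after the shift the two sums combine by Pascal's rule.\<close>
    have "(\<Sum>j\<le>n. of_nat (n choose j) *\<^sub>R ?T x j) = (\<Sum>j\<le>Suc n. of_nat (n choose j) *\<^sub>R ?T x j)"
      by simp
    also have "\<dots> = ?T x 0 + (\<Sum>j\<le>n. of_nat (n choose Suc j) *\<^sub>R ?T x (Suc j))"
      by (subst sum.atMost_Suc_shift) simp
    finally show "(\<Sum>j\<le>n. of_nat (n choose j) *\<^sub>R ?T x (Suc j)) +
      (\<Sum>j\<le>n. of_nat (n choose j) *\<^sub>R ?T x j) = (\<Sum>j\<le>Suc n. of_nat (Suc n choose j) *\<^sub>R ?T x j)"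
      by (subst sum.atMost_Suc_shift) (simp add: scaleR_add_left sum.distrib)
  qed
  finally show ?case .
qed

lemma smooth_funpow_pderiv_dir: "smooth f \<Longrightarrow> smooth ((pderiv_dir i ^^ n) f)"
  by (induction n) (auto simp: smooth_pderiv_dir)

lemma smooth_foldr_pderiv_dir:
  "smooth f \<Longrightarrow> smooth (foldr (\<lambda>i. pderiv_dir i ^^ n i) xs f)"
  by (induction xs) (auto simp: smooth_funpow_pderiv_dir)

lemma pderiv_dir_sum:
  "(\<And>b. b \<in> B \<Longrightarrow> smooth (f b)) \<Longrightarrow>
    pderiv_dir i (\<lambda>x. \<Sum>b\<in>B. f b x) = (\<lambda>x. \<Sum>b\<in>B. pderiv_dir i (f b) x)"
  by (intro pderiv_dir_eqI has_pderiv_sum smooth_has_pderiv)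

lemma funpow_pderiv_dir_sum:
  fixes f :: "'a \<Rightarrow> real^'d \<Rightarrow> 'b::real_normed_vector"
  assumes "\<And>b. b \<in> B \<Longrightarrow> smooth (f b)"
  shows "(pderiv_dir i ^^ n) (\<lambda>x. \<Sum>b\<in>B. c b *\<^sub>R f b x) =
    (\<lambda>x. \<Sum>b\<in>B. c b *\<^sub>R (pderiv_dir i ^^ n) (f b) x)"
proof (induction n)
  case (Suc n)
  have *: "smooth ((pderiv_dir i ^^ n) (f b))" if "b \<in> B" for b
    using assms[OF that] by (rule smooth_funpow_pderiv_dir)
  have "pderiv_dir i (\<lambda>x. \<Sum>b\<in>B. c b *\<^sub>R (pderiv_dir i ^^ n) (f b) x) =
     (\<lambda>x. \<Sum>b\<in>B. pderiv_dir i (\<lambda>x. c b *\<^sub>R (pderiv_dir i ^^ n) (f b) x) x)"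
    by (intro pderiv_dir_sum smooth_bounded_linear[OF bounded_linear_scaleR_right] *)
  also have "\<dots> = (\<lambda>x. \<Sum>b\<in>B. c b *\<^sub>R pderiv_dir i ((pderiv_dir i ^^ n) (f b)) x)"
    by (intro ext sum.cong refl) (simp add: pderiv_dir_bounded_linear[OF bounded_linear_scaleR_right *])
  finally show ?case using Suc by simp
qed simp

text \<open>Coordinates are treated one at a time, in the order of the fold. \<open>B xs\<close>
  collects the multi-indices supported on the coordinates already treated, and the rule for a single
  direction adds one more entry.\<close>

lemma (in bounded_bilinear) mpartial_prod:
  fixes \<mu> :: "nat^'d::{finite,linorder}"
  assumes "smooth f" "smooth g"
  shows "mpartial \<mu> (\<lambda>x. prod (f x) (g x)) =
    (\<lambda>x. \<Sum>\<beta> | \<beta> \<le> \<mu>. mchoose \<mu> \<beta> *\<^sub>R prod (mpartial \<beta> f x) (mpartial (\<mu> - \<beta>) g x))"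
proof -
  let ?P = "\<lambda>xs \<mu>. foldr (\<lambda>i. pderiv_dir i ^^ (\<mu> $ i)) xs"
  define B where "B xs = {\<beta>. \<beta> \<le> \<mu> \<and> (\<forall>i. i \<notin> set xs \<longrightarrow> \<beta> $ i = 0)}" for xs
  have fin: "finite (B xs)" for xs
    by (rule finite_subset[OF _ finite_le_multiindex[of \<mu>]]) (auto simp: B_def)
  have "?P xs \<mu> (\<lambda>x. prod (f x) (g x)) = (\<lambda>x. \<Sum>\<beta>\<in>B xs.
      (\<Prod>i\<in>set xs. real (\<mu> $ i choose \<beta> $ i)) *\<^sub>R prod (?P xs \<beta> f x) (?P xs (\<mu> - \<beta>) g x))"
    if "distinct xs" for xs
    using that
  proof (induction xs)
    case Nil
    have "B [] = {0}" by (auto simp: B_def vec_eq_iff less_eq_vec_def)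
    then show ?case by simp
  next
    case (Cons i xs)
    let ?c = "\<lambda>\<beta>. (\<Prod>i\<in>set xs. real (\<mu> $ i choose \<beta> $ i))"
    let ?D = "pderiv_dir i"
    define up where "up \<beta> j = (\<chi> k. if k = i then j else \<beta> $ k)" for \<beta> :: "nat^'d::{finite,linorder}" and j
    have i: "i \<notin> set xs" using Cons.prems by simp
    have cong: "?P xs \<beta> x = ?P xs \<beta>' x" if "\<And>k. k \<in> set xs \<Longrightarrow> \<beta> $ k = \<beta>' $ k"
      for \<beta> \<beta>' :: "nat^'d::{finite,linorder}" and x :: "real^'d::{finite,linorder} \<Rightarrow> 'x::real_normed_vector"
      using that by (intro foldr_cong) auto
    have "?P (i # xs) \<mu> (\<lambda>x. prod (f x) (g x)) = (?D ^^ (\<mu> $ i)) (\<lambda>x. \<Sum>\<beta>\<in>B xs.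
        ?c \<beta> *\<^sub>R prod (?P xs \<beta> f x) (?P xs (\<mu> - \<beta>) g x))"
      using Cons by simp
    also have "\<dots> = (\<lambda>x. \<Sum>\<beta>\<in>B xs. ?c \<beta> *\<^sub>R (\<Sum>j\<le>\<mu> $ i. of_nat (\<mu> $ i choose j) *\<^sub>R
        prod ((?D ^^ j) (?P xs \<beta> f) x) ((?D ^^ (\<mu> $ i - j)) (?P xs (\<mu> - \<beta>) g) x)))"
      using assms
      by (simp add: funpow_pderiv_dir_sum smooth_prod smooth_foldr_pderiv_dir pderiv_dir_funpow_prod)
    also have "\<dots> = (\<lambda>x. \<Sum>(\<beta>, j)\<in>B xs \<times> {..\<mu> $ i}. (of_nat (\<mu> $ i choose j) * ?c \<beta>) *\<^sub>R
        prod ((?D ^^ j) (?P xs \<beta> f) x) ((?D ^^ (\<mu> $ i - j)) (?P xs (\<mu> - \<beta>) g) x))"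
      by (simp add: scaleR_sum_right sum.cartesian_product mult.commute)
    also have "\<dots> = (\<lambda>x. \<Sum>\<beta>\<in>B (i # xs). (\<Prod>i\<in>set (i # xs). real (\<mu> $ i choose \<beta> $ i)) *\<^sub>R
        prod (?P (i # xs) \<beta> f x) (?P (i # xs) (\<mu> - \<beta>) g x))"
    \<comment> \<open>A multi-index on \<open>i # xs\<close> corresponds to its part on
      \<open>xs\<close>, with entry 0 at i, together with its entry at i.\<close>
    proof (rule ext, rule sum.reindex_bij_witness[where
            j = "\<lambda>(\<beta>, j). up \<beta> j" and i = "\<lambda>\<beta>. (up \<beta> 0, \<beta> $ i)"], goal_cases)
      case (5 x b)
      obtain \<beta> j where b: "b = (\<beta>, j)" by force
      have 1: "?P xs (up \<beta> j) f = ?P xs \<beta> f" "?P xs (\<mu> - up \<beta> j) g = ?P xs (\<mu> - \<beta>) g"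
        by (rule cong; use i in \<open>auto simp: up_def\<close>)+
      have "(\<Prod>k\<in>set xs. real (\<mu> $ k choose up \<beta> j $ k)) = ?c \<beta>"
        using i by (intro prod.cong) (auto simp: up_def)
      moreover have "up \<beta> j $ i = j" by (simp add: up_def)
      ultimately show ?case using i 1 by (simp add: b)
    qed (use i in \<open>auto simp: B_def up_def vec_eq_iff less_eq_vec_def\<close>)
    finally show ?case .
  qed
  from this[of "sorted_list_of_set UNIV"] show ?thesis
    by (simp add: mpartial_def mchoose_def B_def)
qed

section \<open>Fourier transforms of compactly supported functions\<close>

definition compsupp :: "(real^'d \<Rightarrow> complex) \<Rightarrow> bool" where
  "compsupp f \<longleftrightarrow> continuous_on UNIV f \<and> (\<exists>R. \<forall>x. f x \<noteq> 0 \<longrightarrow> norm x \<le> R)"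

definition ft :: "(real^'d \<Rightarrow> complex) \<Rightarrow> real^'d \<Rightarrow> complex" where
  "ft f \<xi> = (LINT x|lborel. f x * exp (- \<i> * of_real (x \<bullet> \<xi>)))"

lemma fourier_nth: "fourier f \<xi> $ j = ft (\<lambda>x. f x $ j) \<xi>"
  by (simp add: fourier_def ft_def)

definition sbox :: "real \<Rightarrow> (real^'d) set" where
  "sbox R = cbox (\<chi> i. - R) (\<chi> i. R)"

lemma mem_sbox: "x \<in> sbox R \<longleftrightarrow> (\<forall>i. \<bar>x $ i\<bar> \<le> R)"
  by (auto simp: sbox_def mem_box_cart abs_le_iff) (metis minus_le_iff)+

lemma norm_le_sbox: "norm x \<le> R \<Longrightarrow> x \<in> sbox R"
  using component_le_norm_cart order_trans by (auto simp: mem_sbox) blast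

lemma norm_exp_minus_i [simp]: "norm (exp (- (\<i> * complex_of_real t))) = 1"
  by (simp add: norm_exp_eq_Re)

lemma norm_axis_one: "norm (axis i 1 :: real^'d) = 1"
  by (simp add: norm_eq_sqrt_inner inner_axis_axis)

text \<open>Bridge between the Lebesgue integral defining \<open>ft\<close> and the integral over a
  box, for which differentiation under the integral sign is carried out below.\<close>

lemma integral_cbox_continuous:
  fixes f :: "real^'d \<Rightarrow> complex"
  assumes "continuous_on UNIV f" "\<And>x. f x \<noteq> 0 \<Longrightarrow> x \<in> cbox a b"
  shows "integrable lborel f" "integral\<^sup>L lborel f = integral (cbox a b) f"
proof -
  have eq: "(\<lambda>x. indicator (cbox a b) x *\<^sub>R f x) = f"
    using assms(2) by (auto simp: indicator_def fun_eq_iff)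
  have "continuous_on (cbox a b) f" using assms(1) continuous_on_subset by blast
  then show *: "integrable lborel f"
    using borel_integrable_compact[OF compact_cbox, of a b f] by (simp add: eq)
  have "integral (cbox a b) f = integral UNIV (\<lambda>x. if x \<in> cbox a b then f x else 0)"
    by (rule integral_restrict_UNIV [symmetric])
  also have "(\<lambda>x. if x \<in> cbox a b then f x else 0) = f"
    using assms(2) by (auto simp: fun_eq_iff)
  finally show "integral\<^sup>L lborel f = integral (cbox a b) f"
    using integral_lborel[OF *] by simp
qed

lemma integral_sbox_continuous:
  fixes f :: "real^'d \<Rightarrow> complex"
  assumes "continuous_on UNIV f" "\<And>x. f x \<noteq> 0 \<Longrightarrow> norm x \<le> R"
  shows "integrable lborel f" "integral\<^sup>L lborel f = integral (sbox R) f"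
  unfolding sbox_def
  by (rule integral_cbox_continuous[OF assms(1)];
      use assms(2) norm_le_sbox in \<open>auto simp: sbox_def\<close>)+

lemma compsuppE:
  assumes "compsupp f"
  obtains R where "R \<ge> 0" "\<And>x. f x \<noteq> 0 \<Longrightarrow> norm x \<le> R"
proof -
  obtain R where "\<And>x. f x \<noteq> 0 \<Longrightarrow> norm x \<le> R" using assms by (auto simp: compsupp_def)
  then show ?thesis by (intro that[of "max R 0"]) force+
qed

lemma compsupp_continuous: "compsupp f \<Longrightarrow> continuous_on UNIV f"
  by (simp add: compsupp_def)

lemma compsupp_mult: "compsupp f \<Longrightarrow> continuous_on UNIV g \<Longrightarrow> compsupp (\<lambda>x. g x * f x)"
  by (auto simp: compsupp_def intro!: continuous_intros)

lemma compsupp_exp: "compsupp f \<Longrightarrow> compsupp (\<lambda>x. f x * exp (- \<i> * of_real (x \<bullet> \<xi>)))"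
  by (auto simp: compsupp_def intro!: continuous_intros)

lemma compsupp_integrable: "compsupp f \<Longrightarrow> integrable lborel f"
  by (metis compsuppE compsupp_continuous integral_sbox_continuous(1))

lemma compsupp_bounded:
  assumes "compsupp f"
  obtains M where "M \<ge> 0" "\<And>x. norm (f x) \<le> M"
proof -
  obtain R where R: "R \<ge> 0" "\<And>x. f x \<noteq> 0 \<Longrightarrow> norm x \<le> R" by (rule compsuppE[OF assms]) blast
  have "compact (f ` cball 0 R)"
    using compsupp_continuous[OF assms] by (intro compact_continuous_image) (auto intro: continuous_on_subset)
  then obtain M where M: "\<And>y. y \<in> f ` cball 0 R \<Longrightarrow> norm y \<le> M"
    using bounded_iff compact_imp_bounded by metis
  have "norm (f x) \<le> max M 0" for x
    using M[of "f x"] R(2)[of x] by (cases "f x = 0") (auto intro: max.coboundedI1)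
  then show ?thesis by (intro that[of "max M 0"]) auto
qed

lemma compsupp_shift:
  assumes "compsupp f" shows "compsupp (\<lambda>x. f (x + c))"
proof -
  obtain R where R: "R \<ge> 0" "\<And>x. f x \<noteq> 0 \<Longrightarrow> norm x \<le> R" by (rule compsuppE[OF assms]) blast
  have "norm x \<le> R + norm c" if "f (x + c) \<noteq> 0" for x
    using R(2)[OF that] norm_triangle_ineq4[of "x + c" c] by simp
  moreover have "continuous_on UNIV (\<lambda>x. f (x + c))"
    using compsupp_continuous[OF assms]
    by (auto intro!: continuous_intros continuous_on_compose2[of UNIV f UNIV])
  ultimately show ?thesis unfolding compsupp_def by blast
qed

lemma ft_bound:
  assumes "compsupp f"
  shows "norm (ft f \<xi>) \<le> (LINT x|lborel. norm (f x))"
proof -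
  have "norm (ft f \<xi>) \<le> (LINT x|lborel. norm (f x * exp (- \<i> * of_real (x \<bullet> \<xi>))))"
    unfolding ft_def by (rule integral_norm_bound)
  then show ?thesis by (simp add: norm_mult)
qed

section \<open>Translations and the Riemann-Lebesgue lemma\<close>

lemma integral_lborel_shift:
  fixes f :: "real^'d \<Rightarrow> complex"
  assumes "continuous_on UNIV f"
  shows "(LINT x|lborel. f (x + c)) = (LINT x|lborel. f x)"
proof -
  have "f \<in> borel_measurable borel" using assms by (rule borel_measurable_continuous_onI)
  then have "(LINT x|distr lborel borel ((+) c). f x) = (LINT x|lborel. f (c + x))"
    by (intro integral_distr) auto
  then show ?thesis by (simp add: lborel_distr_plus add.commute)
qed

lemma ft_shift:
  assumes "compsupp f"
  shows "ft (\<lambda>x. f (x + c)) \<xi> = exp (\<i> * of_real (c \<bullet> \<xi>)) * ft f \<xi>"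
proof -
  let ?g = "\<lambda>x. f x * exp (- \<i> * of_real (x \<bullet> \<xi>))"
  have g: "compsupp ?g" by (rule compsupp_exp[OF assms])
  have "f (x + c) * exp (- \<i> * of_real (x \<bullet> \<xi>)) = exp (\<i> * of_real (c \<bullet> \<xi>)) * ?g (x + c)" for x
    by (simp add: inner_add_left algebra_simps flip: exp_add)
  then have "ft (\<lambda>x. f (x + c)) \<xi> = (LINT x|lborel. exp (\<i> * of_real (c \<bullet> \<xi>)) * ?g (x + c))"
    by (simp only: ft_def)
  also have "\<dots> = exp (\<i> * of_real (c \<bullet> \<xi>)) * (LINT x|lborel. ?g (x + c))"
    by (rule integral_mult_right_zero)
  also have "(LINT x|lborel. ?g (x + c)) = ft f \<xi>"
    unfolding ft_def by (rule integral_lborel_shift[OF compsupp_continuous[OF g]])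
  finally show ?thesis .
qed

text \<open>Translation by half a period flips the sign of the exponential.\<close>

lemma riemann_lebesgue:
  assumes f: "compsupp f" and \<xi>: "filterlim (\<lambda>n. norm (\<xi> n)) at_top sequentially"
  shows "(\<lambda>n. ft f (\<xi> n)) \<longlonglongrightarrow> 0"
proof -
  \<comment> \<open>The translation along \<xi> with inner product pi, so that the transform of the
    translate is the negative of \<open>ft f (\<xi> n)\<close>.\<close>
  define c where "c n = (pi / (norm (\<xi> n))\<^sup>2) *\<^sub>R \<xi> n" for n
  have nc: "norm (c n) = pi * inverse (norm (\<xi> n))" for n
    by (cases "\<xi> n = 0") (auto simp: c_def power2_eq_square field_simps)
  have "(\<lambda>n. norm (c n)) \<longlonglongrightarrow> pi * 0"
    unfolding nc by (intro tendsto_mult tendsto_const tendsto_inverse_0_at_top[OF \<xi>])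
  then have c0: "c \<longlonglongrightarrow> 0" by (simp add: tendsto_norm_zero_iff)
  \<comment> \<open>One bound for all translations: the cube of half-width \<open>R + K\<close> then
    carries every difference \<open>?s n\<close> and yields a majorant independent of n.\<close>
  then obtain K where K: "\<And>n. norm (c n) \<le> K"
    using convergent_imp_Bseq[of c] by (auto simp: convergent_def Bseq_def)
  obtain R where R: "R \<ge> 0" "\<And>x. f x \<noteq> 0 \<Longrightarrow> norm x \<le> R" by (rule compsuppE[OF f]) blast
  obtain M where M: "M \<ge> 0" "\<And>x. norm (f x) \<le> M" by (rule compsupp_bounded[OF f]) blast
  have "K \<ge> 0" using K[of 0] norm_ge_zero order_trans by blast
  let ?e = "\<lambda>n x. exp (- \<i> * of_real (x \<bullet> \<xi> n))"
  let ?s = "\<lambda>n x. (f x - f (x + c n)) * ?e n x"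
  have cont: "continuous_on UNIV (\<lambda>x. f (x + c n))" for n
    by (rule compsupp_continuous[OF compsupp_shift[OF f]])
  have fc: "continuous_on UNIV f" by (rule compsupp_continuous[OF f])
  have lim: "(\<lambda>n. LINT x|lborel. ?s n x) \<longlonglongrightarrow> (LINT x::real^'a|lborel. 0)"
  proof (rule integral_dominated_convergence[where w = "\<lambda>x. 2 * M * indicator (sbox (R + K)) x"])
    show "?s n \<in> borel_measurable lborel" for n
      using cont fc by (auto intro!: borel_measurable_continuous_onI continuous_intros)
    show "integrable lborel (\<lambda>x::real^'a. 2 * M * indicator (sbox (R + K)) x :: real)"
      using borel_integrable_compact[OF compact_cbox continuous_on_const[of _ "1::real"]]
      by (intro integrable_mult_right) (simp add: sbox_def)
    show "AE x in lborel. (\<lambda>n. ?s n x) \<longlonglongrightarrow> 0"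
    proof (rule AE_I2)
      fix x
      have "(\<lambda>n. x + c n) \<longlonglongrightarrow> x" using tendsto_add[OF tendsto_const c0, of x] by simp
      moreover have "isCont f x" using fc by (simp add: continuous_on_eq_continuous_at)
      ultimately have "(\<lambda>n. f x - f (x + c n)) \<longlonglongrightarrow> f x - f x"
        by (intro tendsto_diff tendsto_const isCont_tendsto_compose[of x f])
      then have "(\<lambda>n. norm (f x - f (x + c n))) \<longlonglongrightarrow> 0" by (simp add: tendsto_norm_zero)
      then have "(\<lambda>n. norm (?s n x)) \<longlonglongrightarrow> 0" by (simp add: norm_mult)
      then show "(\<lambda>n. ?s n x) \<longlonglongrightarrow> 0" by (rule tendsto_norm_zero_cancel)
    qed
    show "AE x in lborel. norm (?s n x) \<le> 2 * M * indicator (sbox (R + K)) x" for n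
    proof (rule AE_I2)
      fix x
      show "norm (?s n x) \<le> 2 * M * indicator (sbox (R + K)) x"
      proof (cases "x \<in> sbox (R + K)")
        case True
        have "norm (f x - f (x + c n)) \<le> norm (f x) + norm (f (x + c n))" by (rule norm_triangle_ineq4)
        also have "\<dots> \<le> 2 * M" using M(2)[of x] M(2)[of "x + c n"] by simp
        finally show ?thesis using True by (simp add: norm_mult)
      next
        case False
        have "f x = 0" using False R(2)[of x] \<open>K \<ge> 0\<close> norm_le_sbox[of x "R + K"] by force
        moreover have "f (x + c n) = 0"
          using False R(2)[of "x + c n"] K[of n] norm_le_sbox[of x "R + K"]
            norm_triangle_ineq4[of "x + c n" "c n"] by force
        ultimately show ?thesis using False by simp
      qed
    qed
  qed (simp_all)
  have "\<forall>\<^sub>F n in sequentially. norm (\<xi> n) > 0"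
    using \<xi> unfolding filterlim_at_top_dense by blast
  then have "\<forall>\<^sub>F n in sequentially. (LINT x|lborel. ?s n x) = 2 * ft f (\<xi> n)"
  proof eventually_elim
    case (elim n)
    have "c n \<bullet> \<xi> n = pi" using elim by (simp add: c_def dot_square_norm)
    then have "ft (\<lambda>x. f (x + c n)) (\<xi> n) = - ft f (\<xi> n)"
      by (simp add: ft_shift[OF f])
    moreover have "(LINT x|lborel. ?s n x) = ft f (\<xi> n) - ft (\<lambda>x. f (x + c n)) (\<xi> n)"
      unfolding ft_def left_diff_distrib
      by (intro Bochner_Integration.integral_diff compsupp_integrable compsupp_exp f compsupp_shift)
    ultimately show ?case by simp
  qed
  from Lim_transform_eventually[OF lim this] have "(\<lambda>n. 2 * ft f (\<xi> n)) \<longlonglongrightarrow> 0"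
    by (simp only: integral_zero)
  then have "(\<lambda>n. (1/2) * (2 * ft f (\<xi> n))) \<longlonglongrightarrow> (1/2) * 0" by (intro tendsto_mult tendsto_const)
  then show ?thesis by simp
qed

section \<open>Derivatives under the Fourier transform\<close>

lemma exp_inner_has_vector_derivative:
  fixes x \<xi> :: "real^'d"
  shows "((\<lambda>t. exp (- \<i> * of_real (x \<bullet> (\<xi> + t *\<^sub>R axis i 1)))) has_vector_derivative
    - \<i> * of_real (x $ i) * exp (- \<i> * of_real (x \<bullet> (\<xi> + t *\<^sub>R axis i 1)))) (at t)"
proof -
  have eq: "(\<lambda>t. - \<i> * of_real (x \<bullet> (\<xi> + t *\<^sub>R axis i 1))) =
      (\<lambda>t. - \<i> * of_real (x \<bullet> \<xi>) + t *\<^sub>R (- \<i> * of_real (x $ i)))"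
    by (simp add: fun_eq_iff inner_add_right inner_axis scaleR_conv_of_real[where 'a = complex] algebra_simps)
  have "((\<lambda>t. - \<i> * of_real (x \<bullet> (\<xi> + t *\<^sub>R axis i 1))) has_vector_derivative
      - \<i> * of_real (x $ i)) (at t)"
    unfolding eq by (auto intro!: derivative_eq_intros)
  from field_vector_diff_chain_at[OF this DERIV_exp] show ?thesis
    by (simp add: o_def mult_ac)
qed

lemma has_pderiv_exp_inner:
  "has_pderiv i (\<lambda>\<xi>. exp (- \<i> * of_real (x \<bullet> \<xi>)))
    (\<lambda>\<xi>. - \<i> * of_real (x $ i) * exp (- \<i> * of_real (x \<bullet> \<xi>)))"
  using exp_inner_has_vector_derivative[of x _ i 0] by (simp add: has_pderiv_def)

text \<open>Differentiation under the integral over a cube that contains the support. The new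
  integrand again has compact support, so the rule can be iterated.\<close>

lemma has_pderiv_ft:
  assumes f: "compsupp f"
  shows "has_pderiv i (ft f) (ft (\<lambda>x. - \<i> * of_real (x $ i) * f x))"
  unfolding has_pderiv_def
proof
  fix \<xi> :: "real^'a"
  obtain R where R: "R \<ge> 0" "\<And>x. f x \<noteq> 0 \<Longrightarrow> norm x \<le> R" by (rule compsuppE[OF f]) blast
  note fc [continuous_intros] = compsupp_continuous[OF f]
  let ?e = "\<lambda>t x. exp (- \<i> * of_real (x \<bullet> (\<xi> + t *\<^sub>R axis i 1)))"
  let ?F = "\<lambda>t x. f x * ?e t x"
  let ?F' = "\<lambda>t x. - \<i> * of_real (x $ i) * f x * ?e t x"
  have F: "continuous_on UNIV (?F t)" for t
    by (intro continuous_intros)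
  have fc': "continuous_on A (\<lambda>p. f (snd p))" for A :: "(real \<times> (real^'a)) set"
    by (rule continuous_on_compose2[OF fc]) (auto intro: continuous_intros)
  have eF: "ft f (\<xi> + t *\<^sub>R axis i 1) = integral (sbox R) (?F t)" for t
    unfolding ft_def using F R by (intro integral_sbox_continuous) auto
  have eF': "ft (\<lambda>x. - \<i> * of_real (x $ i) * f x) \<xi> = integral (sbox R) (?F' 0)"
    unfolding ft_def using R
    by (subst integral_sbox_continuous[where R = R]) (auto intro!: continuous_intros)
  have "((\<lambda>t. integral (sbox R) (?F t)) has_vector_derivative integral (sbox R) (?F' 0)) (at 0 within UNIV)"
    unfolding sbox_def
  proof (rule leibniz_rule_vector_derivative)
    show "((\<lambda>t. ?F t x) has_vector_derivative ?F' t x) (at t within UNIV)" for t x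
    proof -
      note exp_inner_has_vector_derivative[of x \<xi> i t]
      then show ?thesis
        using has_vector_derivative_mult_right[of "\<lambda>t. ?e t x" "- \<i> * of_real (x $ i) * ?e t x" "at t" "f x"]
        by (simp add: mult_ac)
    qed
    show "?F t integrable_on cbox (\<chi> i. - R) (\<chi> i. R)" for t
      by (rule integrable_continuous, rule continuous_on_subset[OF F]) simp
    show "continuous_on (UNIV \<times> cbox (\<chi> i. - R) (\<chi> i. R)) (\<lambda>(t, x). ?F' t x)"
      unfolding split_beta by (intro continuous_intros fc')
  qed auto
  then show "((\<lambda>t. ft f (\<xi> + t *\<^sub>R axis i 1)) has_vector_derivative
      ft (\<lambda>x. - \<i> * of_real (x $ i) * f x) \<xi>) (at 0)"
    unfolding eF eF' by simp
qed

lemma continuous_ft: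
  fixes f :: "real^'d \<Rightarrow> complex"
  assumes f: "compsupp f" shows "continuous_on UNIV (ft f)"
proof -
  obtain R where R: "R \<ge> 0" "\<And>x. f x \<noteq> 0 \<Longrightarrow> norm x \<le> R" by (rule compsuppE[OF f]) blast
  note fc [continuous_intros] = compsupp_continuous[OF f]
  let ?F = "\<lambda>\<xi> x. f x * exp (- \<i> * of_real (x \<bullet> \<xi>))"
  have "ft f \<xi> = integral (sbox R) (?F \<xi>)" for \<xi>
    unfolding ft_def using R by (intro integral_sbox_continuous) (auto intro!: continuous_intros)
  then have eq: "ft f = (\<lambda>\<xi>. integral (sbox R) (?F \<xi>))" by blast
  have "continuous_on A (\<lambda>p. f (snd p))" for A :: "((real^'d) \<times> (real^'d)) set"
    by (rule continuous_on_compose2[OF fc]) (auto intro: continuous_intros)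
  then show ?thesis
    unfolding eq sbox_def
    by (intro integral_continuous_on_param) (simp add: split_beta continuous_intros)
qed

text \<open>The complement of a closed ball is open, so f vanishes on a short segment through such a
  point and its derivative there is 0.\<close>

lemma has_pderiv_zero_outside:
  assumes "has_pderiv i f f'" "\<And>x. f x \<noteq> 0 \<Longrightarrow> norm x \<le> R" "f' x \<noteq> 0"
  shows "norm x \<le> R"
proof (rule ccontr)
  assume "\<not> norm x \<le> R"
  then have x: "norm x > R" by simp
  have "((\<lambda>t. norm (x + t *\<^sub>R axis i 1)) \<longlongrightarrow> norm (x + 0 *\<^sub>R axis i 1)) (nhds 0)"
    by (intro tendsto_intros filterlim_ident)
  then have "\<forall>\<^sub>F t in nhds 0. norm (x + t *\<^sub>R axis i 1) > R"
    using x by (intro order_tendstoD) auto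
  then have "\<forall>\<^sub>F t in nhds 0. f (x + t *\<^sub>R axis i 1) = 0"
    by eventually_elim (use assms(2) in force)
  then have "((\<lambda>t. f (x + t *\<^sub>R axis i 1)) has_vector_derivative 0) (at 0)"
    by (subst has_vector_derivative_cong_ev[where g = "\<lambda>t. 0"])
      (auto dest: eventually_nhds_x_imp_x simp: eventually_mono)
  then show False
    using has_pderivD[OF assms(1), of x] assms(3) vector_derivative_unique_at by blast
qed

text \<open>In place of integration by parts, the translation identity for
  \<open>f (x + t *\<^sub>R axis i 1)\<close> is differentiated at t = 0: under the integral on one
  side, and in the exponential factor on the other.\<close>

lemma ft_has_pderiv:
  assumes f: "compsupp f" and d: "has_pderiv i f f'" and f': "continuous_on UNIV f'"
  shows "compsupp f'" "ft f' \<xi> = \<i> * of_real (\<xi> $ i) * ft f \<xi>"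
proof -
  obtain R where R: "R \<ge> 0" "\<And>x. f x \<noteq> 0 \<Longrightarrow> norm x \<le> R" by (rule compsuppE[OF f]) blast
  have R': "norm x \<le> R" if "f' x \<noteq> 0" for x
    using has_pderiv_zero_outside[OF d R(2) that] by blast
  then show "compsupp f'" using f' by (auto simp: compsupp_def)
  note fc [continuous_intros] = compsupp_continuous[OF f]
  let ?e = "\<lambda>x. exp (- \<i> * of_real (x \<bullet> \<xi>))"
  let ?F = "\<lambda>t x. f (x + t *\<^sub>R axis i 1) * ?e x"
  let ?F' = "\<lambda>t x. f' (x + t *\<^sub>R axis i 1) * ?e x"
  \<comment> \<open>For |t| at most 1 all translates are supported in one fixed cube, as the rule
    for parameter integrals requires.\<close>
  have shift: "norm x \<le> R + 1" if "norm (x + t *\<^sub>R axis i 1) \<le> R" "t \<in> {-1..1}" for x :: "real^'a" and t :: real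
    using that norm_triangle_ineq4[of "x + t *\<^sub>R axis i 1" "t *\<^sub>R axis i 1"] by (auto simp: norm_axis_one)
  have F: "continuous_on UNIV (?F t)" for t
    by (intro continuous_intros continuous_on_compose2[OF fc]) auto
  have F': "continuous_on UNIV (?F' t)" for t
    by (intro continuous_intros continuous_on_compose2[OF f']) auto
  have eF: "exp (\<i> * of_real (t * \<xi> $ i)) * ft f \<xi> = integral (sbox (R + 1)) (?F t)" if "t \<in> {-1..1}" for t
  proof -
    have "exp (\<i> * of_real (t * \<xi> $ i)) * ft f \<xi> = ft (\<lambda>x. f (x + t *\<^sub>R axis i 1)) \<xi>"
      by (simp add: ft_shift[OF f] inner_axis' )
    also have "\<dots> = integral (sbox (R + 1)) (?F t)"
      unfolding ft_def using F R shift that by (intro integral_sbox_continuous) force+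
    finally show ?thesis .
  qed
  have eF': "ft f' \<xi> = integral (sbox (R + 1)) (?F' 0)"
    unfolding ft_def using R' f'
    by (subst integral_sbox_continuous[where R = "R + 1"]) (force intro!: continuous_intros)+
  have at: "at 0 within {-1..1} = at (0 :: real)"
    by (rule at_within_interior) simp
  have "((\<lambda>t. integral (sbox (R + 1)) (?F t)) has_vector_derivative integral (sbox (R + 1)) (?F' 0))
      (at 0 within {-1..1})"
    unfolding sbox_def
  proof (rule leibniz_rule_vector_derivative)
    show "((\<lambda>t. ?F t x) has_vector_derivative ?F' t x) (at t within {-1..1})" for t x
    proof -
      have "((\<lambda>s. f ((x + t *\<^sub>R axis i 1) + s *\<^sub>R axis i 1)) has_vector_derivative f' (x + t *\<^sub>R axis i 1)) (at (t - t))"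
        using has_pderivD[OF d] by simp
      moreover have "((\<lambda>s. s - t) has_vector_derivative 1) (at t)"
        by (auto intro!: derivative_eq_intros)
      ultimately
      have "((\<lambda>s. f (x + s *\<^sub>R axis i 1)) has_vector_derivative f' (x + t *\<^sub>R axis i 1)) (at t)"
        using vector_diff_chain_at[of "\<lambda>s. s - t" 1 t] by (fastforce simp: o_def algebra_simps)
      then show ?thesis
        using has_vector_derivative_at_within has_vector_derivative_mult_left by blast
    qed
    show "?F t integrable_on cbox (\<chi> i. - (R + 1)) (\<chi> i. R + 1)" for t
      by (rule integrable_continuous, rule continuous_on_subset[OF F]) simp
    show "continuous_on ({-1..1} \<times> cbox (\<chi> i. - (R + 1)) (\<chi> i. R + 1)) (\<lambda>(t, x). ?F' t x)"
      unfolding split_beta by (intro continuous_intros continuous_on_compose2[OF f']) auto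
  qed auto
  then have "((\<lambda>t. integral (sbox (R + 1)) (?F t)) has_vector_derivative ft f' \<xi>) (at 0 within {-1..1})"
    by (simp only: eF')
  then have "((\<lambda>t. exp (\<i> * of_real (t * \<xi> $ i)) * ft f \<xi>) has_vector_derivative ft f' \<xi>) (at 0 within {-1..1})"
    by (rule has_vector_derivative_transform[rotated 2]) (simp, rule eF)
  moreover have "((\<lambda>t. exp (\<i> * of_real (t * \<xi> $ i)) * ft f \<xi>) has_vector_derivative
      \<i> * of_real (\<xi> $ i) * ft f \<xi>) (at 0)"
  proof -
    have "((\<lambda>t. \<i> * of_real (t * \<xi> $ i)) has_vector_derivative \<i> * of_real (\<xi> $ i)) (at 0)"
      by (auto intro!: derivative_eq_intros simp: has_vector_derivative_def scaleR_conv_of_real fun_eq_iff)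
    from field_vector_diff_chain_at[OF this DERIV_exp]
    have "((\<lambda>t. exp (\<i> * of_real (t * \<xi> $ i))) has_vector_derivative \<i> * of_real (\<xi> $ i)) (at 0)"
      by (simp add: o_def)
    then show ?thesis by (rule has_vector_derivative_mult_left)
  qed
  ultimately show "ft f' \<xi> = \<i> * of_real (\<xi> $ i) * ft f \<xi>"
    unfolding at by (rule vector_derivative_unique_at)
qed

text \<open>Each derivative of f supplies a factor \<open>2 ^ n * \<xi> $ i\<close> for a coordinate
  with \<open>\<xi> $ i \<noteq> 0\<close>. The Riemann-Lebesgue lemma at the bottom makes the limit
  0 instead of a mere bound.\<close>

lemma ft_decay:
  assumes "compsupp f" "C_class m f" "\<xi> \<noteq> 0"
  shows "(\<lambda>n. 2 ^ (m * n) * ft f (2 ^ n *\<^sub>R \<xi>)) \<longlonglongrightarrow> 0"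
  using assms(1,2)
proof (induction m arbitrary: f)
  case 0
  have "filterlim (\<lambda>n. 2 ^ n :: real) at_top sequentially"
    by (rule filterlim_at_top_mono[OF filterlim_real_sequentially])
      (simp add: order_less_imp_le of_nat_less_two_power)
  then have "filterlim (\<lambda>n. norm \<xi> * 2 ^ n) at_top sequentially"
    using assms(3) by (intro filterlim_tendsto_pos_mult_at_top[OF tendsto_const]) auto
  then show ?case
    using riemann_lebesgue[OF 0(1), of "\<lambda>n. 2 ^ n *\<^sub>R \<xi>"] by (simp add: mult.commute)
next
  case (Suc m)
  obtain i where i: "\<xi> $ i \<noteq> 0" using assms(3) by (auto simp: vec_eq_iff)
  let ?f' = "pderiv_dir i f"
  note d = C_class_SucD[OF Suc.prems(2), of i]
  note f' = ft_has_pderiv[OF Suc.prems(1) d(1) C_class_continuous[OF d(2)]]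
  have "(\<lambda>n. 2 ^ (m * n) * ft ?f' (2 ^ n *\<^sub>R \<xi>)) \<longlonglongrightarrow> 0"
    by (rule Suc.IH[OF f'(1) d(2)])
  from tendsto_mult[OF tendsto_const[of "1 / (\<i> * of_real (\<xi> $ i))"] this]
  have "(\<lambda>n. 1 / (\<i> * of_real (\<xi> $ i)) * (2 ^ (m * n) * ft ?f' (2 ^ n *\<^sub>R \<xi>))) \<longlonglongrightarrow> 0"
    by simp
  also have "(\<lambda>n. 1 / (\<i> * of_real (\<xi> $ i)) * (2 ^ (m * n) * ft ?f' (2 ^ n *\<^sub>R \<xi>))) =
    (\<lambda>n. 2 ^ (Suc m * n) * ft f (2 ^ n *\<^sub>R \<xi>))"
    using i by (simp add: f'(2) power_add field_simps)
  finally show ?case .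
qed

section \<open>Dyadic Riemann sums\<close>

definition ibox :: "real \<Rightarrow> (int^'d) set" where
  "ibox K = {k. \<forall>i. \<bar>real_of_int (k $ i)\<bar> \<le> K}"

text \<open>Index of the half-open dyadic cell of side 2^(-n) containing x; the cells of one level
  partition the space.\<close>

definition dyadic_floor :: "nat \<Rightarrow> real^'d \<Rightarrow> int^'d" where
  "dyadic_floor n x = (\<chi> i. \<lfloor>2 ^ n * x $ i\<rfloor>)"

lemma of_int_vec_nth [simp]: "of_int_vec k $ i = real_of_int (k $ i)"
  by (simp add: of_int_vec_def)

lemma of_int_vec_0 [simp]: "of_int_vec 0 = 0"
  by (simp add: vec_eq_iff)

lemma of_int_vec_add: "of_int_vec (k + l) = of_int_vec k + of_int_vec l"
  by (simp add: vec_eq_iff)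

lemma of_int_vec_diff: "of_int_vec (k - l) = of_int_vec k - of_int_vec l"
  by (simp add: vec_eq_iff)

lemma of_int_vec_smult: "of_int_vec (c *s k) = real_of_int c *\<^sub>R of_int_vec k"
  by (simp add: vec_eq_iff)

text \<open>The bound is of order d in K, so that with K replaced by 2^n K it is balanced by the
  cell volume 2^(-dn) in the Riemann sums.\<close>

lemma ibox_card:
  assumes "K \<ge> 0"
  shows "finite (ibox K :: (int^'d) set)" "real (card (ibox K :: (int^'d) set)) \<le> (2 * K + 1) ^ CARD('d)"
proof -
  have img: "(ibox K :: (int^'d) set) = vec_lambda ` (PiE UNIV (\<lambda>i. {- \<lfloor>K\<rfloor>..\<lfloor>K\<rfloor>}))"
  proof -
    have "k \<in> vec_lambda ` (PiE UNIV (\<lambda>i. {- \<lfloor>K\<rfloor>..\<lfloor>K\<rfloor>}))" if "k \<in> ibox K" for k :: "int^'d"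
    proof -
      have "k $ i \<le> \<lfloor>K\<rfloor> \<and> - (k $ i) \<le> \<lfloor>K\<rfloor>" for i
        using that by (auto simp: le_floor_iff ibox_def abs_le_iff)
      then have "- \<lfloor>K\<rfloor> \<le> k $ i \<and> k $ i \<le> \<lfloor>K\<rfloor>" for i by (metis minus_le_iff)
      then show ?thesis by (intro image_eqI[where x = "vec_nth k"]) (auto simp: PiE_iff)
    qed
    moreover have "\<bar>real_of_int j\<bar> \<le> K" if "- \<lfloor>K\<rfloor> \<le> j" "j \<le> \<lfloor>K\<rfloor>" for j
      using that by linarith
    ultimately show ?thesis by (auto simp: ibox_def PiE_iff)
  qed
  have fin: "finite (PiE (UNIV :: 'd set) (\<lambda>i. {- \<lfloor>K\<rfloor>..\<lfloor>K\<rfloor>}))"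
    by (intro finite_PiE) auto
  then show "finite (ibox K :: (int^'d) set)" by (simp add: img)
  have "card (ibox K :: (int^'d) set) \<le> card (PiE (UNIV :: 'd set) (\<lambda>i. {- \<lfloor>K\<rfloor>..\<lfloor>K\<rfloor>}))"
    unfolding img by (rule card_image_le[OF fin])
  also have "\<dots> = nat (2 * \<lfloor>K\<rfloor> + 1) ^ CARD('d)"
    by (simp add: card_PiE)
  finally have "real (card (ibox K :: (int^'d) set)) \<le> real (nat (2 * \<lfloor>K\<rfloor> + 1)) ^ CARD('d)"
    by (metis of_nat_le_iff of_nat_power)
  also have "\<dots> \<le> (2 * K + 1) ^ CARD('d)"
  proof (rule power_mono)
    have "real (nat (2 * \<lfloor>K\<rfloor> + 1)) = real_of_int (2 * \<lfloor>K\<rfloor> + 1)"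
      using assms by (intro of_nat_nat) simp
    then show "real (nat (2 * \<lfloor>K\<rfloor> + 1)) \<le> 2 * K + 1" by linarith
  qed simp
  finally show "real (card (ibox K :: (int^'d) set)) \<le> (2 * K + 1) ^ CARD('d)" .
qed

lemma dyadic_floor_bounds:
  fixes x :: "real^'d" and n :: nat
  defines "y \<equiv> (1 / 2) ^ n *\<^sub>R of_int_vec (dyadic_floor n x)"
  shows "y $ i \<le> x $ i" "x $ i < y $ i + (1 / 2) ^ n"
proof -
  have "real_of_int \<lfloor>2 ^ n * x $ i\<rfloor> \<le> 2 ^ n * x $ i" "2 ^ n * x $ i < real_of_int \<lfloor>2 ^ n * x $ i\<rfloor> + 1"
    by linarith+
  then show "y $ i \<le> x $ i" "x $ i < y $ i + (1 / 2) ^ n"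
    by (auto simp: y_def dyadic_floor_def field_simps)
qed

lemma half_power_tendsto_0: "(\<lambda>n. (1 / 2 :: real) ^ n) \<longlonglongrightarrow> 0"
  by (rule LIMSEQ_power_zero) simp

lemma dyadic_approx:
  fixes x :: "real^'d"
  shows "(\<lambda>n. (1 / 2) ^ n *\<^sub>R of_int_vec (dyadic_floor n x)) \<longlonglongrightarrow> x"
proof (rule vec_tendstoI)
  fix i
  let ?y = "\<lambda>n. ((1 / 2) ^ n *\<^sub>R of_int_vec (dyadic_floor n x)) $ i"
  show "?y \<longlonglongrightarrow> x $ i"
  proof (rule tendsto_sandwich[where f = "\<lambda>n. x $ i - (1 / 2) ^ n" and h = "\<lambda>n. x $ i"])
    show "\<forall>\<^sub>F n in sequentially. x $ i - (1 / 2) ^ n \<le> ?y n" "\<forall>\<^sub>F n in sequentially. ?y n \<le> x $ i"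
      using dyadic_floor_bounds[where x = x and i = i] by (auto intro!: always_eventually simp: less_imp_le algebra_simps)
    show "(\<lambda>n. x $ i - (1 / 2) ^ n) \<longlonglongrightarrow> x $ i"
      using tendsto_diff[OF tendsto_const half_power_tendsto_0, of "x $ i"] by simp
  qed auto
qed

lemma dyadic_ext:
  fixes f g :: "real^'d \<Rightarrow> 'b::real_normed_vector"
  assumes "continuous_on UNIV f" "continuous_on UNIV g"
    and "\<And>n k. f ((1 / 2) ^ n *\<^sub>R of_int_vec k) = g ((1 / 2) ^ n *\<^sub>R of_int_vec k)"
  shows "f = g"
proof
  fix x
  have "isCont f x" "isCont g x" using assms by (auto simp: continuous_on_eq_continuous_at)
  then have "(\<lambda>n. f ((1 / 2) ^ n *\<^sub>R of_int_vec (dyadic_floor n x))) \<longlonglongrightarrow> f x"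
    "(\<lambda>n. g ((1 / 2) ^ n *\<^sub>R of_int_vec (dyadic_floor n x))) \<longlonglongrightarrow> g x"
    using dyadic_approx isCont_tendsto_compose by blast+
  then show "f x = g x" unfolding assms(3) using LIMSEQ_unique by blast
qed

text \<open>A half-open cell lies between the open and the closed box with the same corners, and
  these have the same volume.\<close>

lemma dyadic_cell:
  fixes k :: "int^'d"
  shows "{x. dyadic_floor n x = k} \<in> sets lborel"
    "measure lborel {x. dyadic_floor n x = k} = (1 / 2) ^ (CARD('d) * n)"
    "emeasure lborel {x. dyadic_floor n x = k} < \<infinity>"
proof -
  let ?h = "(1 / 2 :: real) ^ n"
  let ?Q = "{x. dyadic_floor n x = k}"
  define a where "a = ?h *\<^sub>R of_int_vec k"
  define b where "b = a + ?h *\<^sub>R 1"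
  have floor: "\<lfloor>2 ^ n * t\<rfloor> = j \<longleftrightarrow> ?h * j \<le> t \<and> t < ?h * j + ?h" for t :: real and j :: int
    by (simp add: floor_eq_iff field_simps)
  have Q: "?Q = (\<Inter>i. {x. a $ i \<le> x $ i} \<inter> {x. x $ i < b $ i})"
    by (auto simp: dyadic_floor_def vec_eq_iff floor a_def b_def)
  show meas: "?Q \<in> sets lborel"
  proof -
    have "{x :: real^'d. a $ i \<le> x $ i} \<inter> {x. x $ i < b $ i} \<in> sets borel" for i
      by (intro sets.Int borel_closed borel_open closed_Collect_le open_Collect_less continuous_intros)
    then show ?thesis unfolding Q by auto
  qed
  have sub: "box a b \<subseteq> ?Q" "?Q \<subseteq> cbox a b"
    unfolding Q by (force simp: mem_box_cart intro: less_imp_le)+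
  have ab: "\<forall>u\<in>Basis. a \<bullet> u \<le> b \<bullet> u"
    by (auto simp: b_def Basis_vec_def inner_axis)
  have "(\<Prod>u\<in>Basis. (b - a) \<bullet> u) = (\<Prod>u\<in>(Basis :: (real^'d) set). ?h)"
    by (intro prod.cong) (auto simp: b_def Basis_vec_def inner_axis)
  then have vol: "(\<Prod>u\<in>Basis. (b - a) \<bullet> u) = (1 / 2) ^ (CARD('d) * n)"
    by (simp add: power_mult mult.commute)
  have fin: "cbox a b \<in> fmeasurable lborel" "box a b \<in> fmeasurable lborel"
    by (simp_all add: fmeasurable_def emeasure_lborel_cbox_eq emeasure_lborel_box_eq)
  then have Qf: "?Q \<in> fmeasurable lborel"
    using sub meas fmeasurableI2 by blast
  then show "emeasure lborel ?Q < \<infinity>" by (simp add: fmeasurable_def)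
  have "measure lborel (box a b) \<le> measure lborel ?Q"
    by (rule measure_mono_fmeasurable[OF sub(1) _ Qf]) simp
  moreover have "measure lborel ?Q \<le> measure lborel (cbox a b)"
    by (rule measure_mono_fmeasurable[OF sub(2) meas fin(1)])
  moreover have "measure lborel (box a b) = (1 / 2) ^ (CARD('d) * n)"
    "measure lborel (cbox a b) = (1 / 2) ^ (CARD('d) * n)"
    using ab vol by (simp_all add: measure_lborel_box_eq measure_lborel_cbox_eq)
  ultimately show "measure lborel ?Q = (1 / 2) ^ (CARD('d) * n)" by simp
qed

text \<open>The sum is the integral of the step function that evaluates f at the corner of the cell
  of x. By continuity it converges pointwise, and domination gives the limit.\<close>

lemma riemann_sum_tendsto:
  fixes f :: "real^'d \<Rightarrow> complex"
  assumes f: "compsupp f" and K: "K \<ge> 0" "\<And>x i. f x \<noteq> 0 \<Longrightarrow> \<bar>x $ i\<bar> \<le> K"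
  shows "(\<lambda>n. (1 / 2) ^ (CARD('d) * n) * (\<Sum>k\<in>ibox (2 ^ n * K). f ((1 / 2) ^ n *\<^sub>R of_int_vec k)))
    \<longlonglongrightarrow> (LINT x|lborel. f x)"
proof -
  let ?y = "\<lambda>n x. (1 / 2) ^ n *\<^sub>R of_int_vec (dyadic_floor n x) :: real^'d"
  let ?Q = "\<lambda>n k. {x :: real^'d. dyadic_floor n x = k}"
  let ?g = "\<lambda>n k. f ((1 / 2) ^ n *\<^sub>R of_int_vec k)"
  have fin: "finite (ibox (2 ^ n * K) :: (int^'d) set)" for n
    using K by (intro ibox_card) simp
  have step: "f (?y n x) = (\<Sum>k\<in>ibox (2 ^ n * K). indicator (?Q n k) x *\<^sub>R ?g n k)" for n x
  proof (cases "dyadic_floor n x \<in> ibox (2 ^ n * K)")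
    case True
    have "(\<Sum>k\<in>ibox (2 ^ n * K). indicator (?Q n k) x *\<^sub>R ?g n k) =
        (\<Sum>k\<in>ibox (2 ^ n * K). if k = dyadic_floor n x then ?g n k else 0)"
      by (intro sum.cong) (auto simp: indicator_def)
    then show ?thesis using True fin by simp
  next
    case False
    then obtain i where "\<bar>real_of_int (dyadic_floor n x $ i)\<bar> > 2 ^ n * K"
      by (auto simp: ibox_def not_le)
    then have "\<bar>?y n x $ i\<bar> > K" by (simp add: abs_mult field_simps)
    then have "f (?y n x) = 0" using K(2)[of "?y n x" i] by fastforce
    moreover have "(\<Sum>k\<in>ibox (2 ^ n * K). indicator (?Q n k) x *\<^sub>R ?g n k) = 0"
      using False by (intro sum.neutral) (auto simp: indicator_def)
    ultimately show ?thesis by simp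
  qed
  have int: "integrable lborel (\<lambda>x. indicator (?Q n k) x *\<^sub>R ?g n k)" for n k
    using dyadic_cell[of n k] by (intro integrable_scaleR_left integrable_real_indicator) auto
  have I: "(LINT x|lborel. f (?y n x)) = (1 / 2) ^ (CARD('d) * n) * (\<Sum>k\<in>ibox (2 ^ n * K). ?g n k)" for n
  proof -
    have "(LINT x|lborel. f (?y n x)) = (\<Sum>k\<in>ibox (2 ^ n * K). LINT x|lborel. indicator (?Q n k) x *\<^sub>R ?g n k)"
      unfolding step by (rule Bochner_Integration.integral_sum) (rule int)
    also have "\<dots> = (\<Sum>k\<in>ibox (2 ^ n * K). (1 / 2) ^ (CARD('d) * n) * ?g n k)"
    proof (rule sum.cong[OF refl])
      fix k
      have "(LINT x|lborel. indicator (?Q n k) x *\<^sub>R ?g n k) = (LINT x|lborel. indicator (?Q n k) x) *\<^sub>R ?g n k"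
        using dyadic_cell[of n k] by (intro integral_scaleR_left integrable_real_indicator) auto
      then show "(LINT x|lborel. indicator (?Q n k) x *\<^sub>R ?g n k) = (1 / 2) ^ (CARD('d) * n) * ?g n k"
        using dyadic_cell[of n k] by (simp add: scaleR_conv_of_real)
    qed
    finally show ?thesis by (simp add: sum_distrib_left)
  qed
  obtain M where M: "M \<ge> 0" "\<And>x. norm (f x) \<le> M" by (rule compsupp_bounded[OF f]) blast
  have "(\<lambda>n. LINT x|lborel. f (?y n x)) \<longlonglongrightarrow> (LINT x|lborel. f x)"
  \<comment> \<open>A point differs from its cell corner by at most 1 in each coordinate at every
    level, hence the margin 1 around the support.\<close>
  proof (rule integral_dominated_convergence[where w = "\<lambda>x. M * indicator (sbox (K + 1)) x"])
    show "f \<in> borel_measurable lborel"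
      using compsupp_continuous[OF f] by (simp add: borel_measurable_continuous_onI)
    show "(\<lambda>x. f (?y n x)) \<in> borel_measurable lborel" for n
      unfolding step by (rule borel_measurable_sum) (use int in auto)
    show "integrable lborel (\<lambda>x::real^'d. M * indicator (sbox (K + 1)) x :: real)"
      using borel_integrable_compact[OF compact_cbox continuous_on_const[of _ "1::real"]]
      by (intro integrable_mult_right) (simp add: sbox_def)
    show "AE x in lborel. (\<lambda>n. f (?y n x)) \<longlonglongrightarrow> f x"
    proof (rule AE_I2)
      fix x
      have "isCont f x" using compsupp_continuous[OF f] by (simp add: continuous_on_eq_continuous_at)
      then show "(\<lambda>n. f (?y n x)) \<longlonglongrightarrow> f x" by (rule isCont_tendsto_compose) (rule dyadic_approx)
    qed
    show "AE x in lborel. norm (f (?y n x)) \<le> M * indicator (sbox (K + 1)) x" for n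
    proof (rule AE_I2)
      fix x
      show "norm (f (?y n x)) \<le> M * indicator (sbox (K + 1)) x"
      proof (cases "x \<in> sbox (K + 1)")
        case False
        then obtain i where i: "\<bar>x $ i\<bar> > K + 1" by (auto simp: mem_sbox not_le)
        have "(1 / 2 :: real) ^ n \<le> 1" by (intro power_le_one) auto
        then have "\<bar>?y n x $ i\<bar> > K" using i dyadic_floor_bounds[where n = n and x = x and i = i] by linarith
        then have "f (?y n x) = 0" using K(2)[of "?y n x" i] by fastforce
        then show ?thesis using False by simp
      qed (use M in auto)
    qed
  qed
  then show ?thesis unfolding I .
qed

section \<open>Symbols and the subdivision operator\<close>

text \<open>Complex scalar multiplication on matrices; \<open>scaleR\<close> provides real factors
  only, and \<open>*\<close> is entrywise.\<close>

definition cscale :: "complex \<Rightarrow> complex^'r^'s \<Rightarrow> complex^'r^'s" where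
  "cscale z A = (\<chi> i j. z * A $ i $ j)"

lemma cscale_nth [simp]: "cscale z A $ i $ j = z * A $ i $ j"
  by (simp add: cscale_def)

lemma cscale_cscale: "cscale z (cscale w A) = cscale (z * w) A"
  by (simp add: vec_eq_iff mult.assoc)

lemma cscale_1 [simp]: "cscale 1 A = A"
  by (simp add: vec_eq_iff)

lemma cscale_0 [simp]: "cscale z 0 = 0" "cscale 0 A = 0"
  by (simp_all add: vec_eq_iff)

lemma cscale_matrix_mult:
  "cscale z A ** B = cscale z (A ** B)" "A ** cscale z B = cscale z (A ** B)"
  by (simp_all add: vec_eq_iff matrix_matrix_mult_def sum_distrib_left mult_ac)

lemma bounded_bilinear_cscale: "bounded_bilinear cscale"
  unfolding bilinear_conv_bounded_bilinear [symmetric] bilinear_def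
  by (auto intro!: linearI simp: vec_eq_iff algebra_simps)

lemma bounded_bilinear_matrix_mult:
  "bounded_bilinear ((**) :: complex^'b^'a \<Rightarrow> complex^'c^'b \<Rightarrow> complex^'c^'a)"
  unfolding bilinear_conv_bounded_bilinear [symmetric] bilinear_def
  by (auto intro!: linearI simp: vec_eq_iff matrix_matrix_mult_def algebra_simps sum.distrib
      scaleR_sum_right)

lemma bounded_bilinear_matrix_vector_mult:
  "bounded_bilinear ((*v) :: complex^'b^'a \<Rightarrow> complex^'b \<Rightarrow> complex^'a)"
  unfolding bilinear_conv_bounded_bilinear [symmetric] bilinear_def
  by (auto intro!: linearI simp: vec_eq_iff matrix_vector_mult_def algebra_simps sum.distrib
      scaleR_sum_right)

interpretation cscale: bounded_bilinear cscale
  by (rule bounded_bilinear_cscale)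

interpretation matmul: bounded_bilinear "(**) :: complex^'b^'a \<Rightarrow> complex^'c^'b \<Rightarrow> complex^'c^'a"
  by (rule bounded_bilinear_matrix_mult)

interpretation matvec: bounded_bilinear "(*v) :: complex^'b^'a \<Rightarrow> complex^'b \<Rightarrow> complex^'a"
  by (rule bounded_bilinear_matrix_vector_mult)

abbreviation char_fun :: "int^'d \<Rightarrow> real^'d \<Rightarrow> complex" where
  "char_fun k \<xi> \<equiv> exp (- \<i> * of_real (of_int_vec k \<bullet> \<xi>))"

lemma symbol_eq_sum:
  assumes "finite K" "\<And>k. u k \<noteq> 0 \<Longrightarrow> k \<in> K"
  shows "symbol u \<xi> = (\<Sum>k\<in>K. cscale (char_fun k \<xi>) (u k))"
proof -
  have "(\<Sum>k | u k \<noteq> 0. u k $ i $ j * char_fun k \<xi>) = (\<Sum>k\<in>K. char_fun k \<xi> * u k $ i $ j)" for i j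
    using assms by (intro sum.mono_neutral_cong_left) auto
  then show ?thesis by (simp add: vec_eq_iff symbol_def)
qed

lemma symbol_eq: "finsupp u \<Longrightarrow> symbol u \<xi> = (\<Sum>k | u k \<noteq> 0. cscale (char_fun k \<xi>) (u k))"
  by (rule symbol_eq_sum) (auto simp: finsupp_def)

lemma subdivision_eq_sum:
  fixes a :: "int^'d \<Rightarrow> complex^'r^'r" and v :: "int^'d \<Rightarrow> complex^'r^'s"
  assumes "finsupp a" "finite K" "\<And>k. a (j - 2 *s k) \<noteq> 0 \<Longrightarrow> v k \<noteq> 0 \<Longrightarrow> k \<in> K"
  shows "subdivision a v j = (2 ^ CARD('d)) *\<^sub>R (\<Sum>k\<in>K. v k ** a (j - 2 *s k))"
proof -
  have "inj (\<lambda>k :: int^'d. j - 2 *s k)" by (auto simp: inj_def vec_eq_iff)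
  then have "finite ((\<lambda>k. j - 2 *s k) -` {k. a k \<noteq> 0})"
    using assms(1) by (intro finite_vimageI) (auto simp: finsupp_def)
  then have fin: "finite {k. a (j - 2 *s k) \<noteq> 0}" by (simp add: vimage_def)
  have "(\<Sum>k | a (j - 2 *s k) \<noteq> 0. v k ** a (j - 2 *s k)) = (\<Sum>k\<in>K. v k ** a (j - 2 *s k))"
  proof (rule sum.mono_neutral_cong)
    fix k assume "k \<in> {k. a (j - 2 *s k) \<noteq> 0} - K"
    then have "v k = 0" using assms(3) by auto
    then show "v k ** a (j - 2 *s k) = 0" by simp
  qed (use assms fin in auto)
  then show ?thesis by (simp add: subdivision_def)
qed

lemma subdivision_support:
  fixes a :: "int^'d \<Rightarrow> complex^'r^'r" and v :: "int^'d \<Rightarrow> complex^'r^'s"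
  assumes "finsupp a" "subdivision a v j \<noteq> 0"
  shows "j \<in> (\<lambda>(k, l). 2 *s k + l) ` ({k. v k \<noteq> 0} \<times> {k. a k \<noteq> 0})"
proof -
  obtain k where "a (j - 2 *s k) \<noteq> 0" "v k \<noteq> 0"
    using assms subdivision_eq_sum[of a "{}" j v] by fastforce
  then show ?thesis by (intro image_eqI[where x = "(k, j - 2 *s k)"]) auto
qed

text \<open>With j = 2k + l the exponential splits into the character of k at 2 \<xi> and that of l
  at \<xi>, so the double sum factors.\<close>

lemma symbol_subdivision:
  fixes a :: "int^'d \<Rightarrow> complex^'r^'r" and v :: "int^'d \<Rightarrow> complex^'r^'s"
  assumes a: "finsupp a" and v: "finsupp v"
  shows "finsupp (subdivision a v)"
    "symbol (subdivision a v) \<xi> = (2 ^ CARD('d)) *\<^sub>R (symbol v (2 *\<^sub>R \<xi>) ** symbol a \<xi>)"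
proof -
  let ?A = "{k. a k \<noteq> 0}" and ?V = "{k. v k \<noteq> 0}"
  let ?c = "2 ^ CARD('d) :: real"
  define J where "J = (\<lambda>(k, l). 2 *s k + l) ` (?V \<times> ?A)"
  have fin: "finite ?A" "finite ?V" "finite J" using a v by (auto simp: finsupp_def J_def)
  have S: "subdivision a v j = ?c *\<^sub>R (\<Sum>k\<in>?V. v k ** a (j - 2 *s k))" for j
    using a fin by (intro subdivision_eq_sum) auto
  have J: "j \<in> J" if "subdivision a v j \<noteq> 0" for j
    unfolding J_def by (rule subdivision_support[OF a that])
  then show "finsupp (subdivision a v)"
    unfolding finsupp_def by (intro finite_subset[OF _ fin(3)]) auto
  have "symbol (subdivision a v) \<xi> = (\<Sum>j\<in>J. cscale (char_fun j \<xi>) (?c *\<^sub>R (\<Sum>k\<in>?V. v k ** a (j - 2 *s k))))"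
    unfolding S[symmetric] using fin J by (intro symbol_eq_sum)
  also have "\<dots> = ?c *\<^sub>R (\<Sum>k\<in>?V. \<Sum>j\<in>J. cscale (char_fun j \<xi>) (v k ** a (j - 2 *s k)))"
    by (simp add: cscale.scaleR_right cscale.sum_right scaleR_sum_right sum.swap[of _ J])
  also have "(\<Sum>k\<in>?V. \<Sum>j\<in>J. cscale (char_fun j \<xi>) (v k ** a (j - 2 *s k))) =
      (\<Sum>k\<in>?V. \<Sum>l\<in>?A. cscale (char_fun (2 *s k + l) \<xi>) (v k ** a l))"
  proof (rule sum.cong[OF refl])
    fix k assume k: "k \<in> ?V"
    have "(\<Sum>j\<in>J. cscale (char_fun j \<xi>) (v k ** a (j - 2 *s k))) =
      (\<Sum>j\<in>(\<lambda>l. 2 *s k + l) ` ?A. cscale (char_fun j \<xi>) (v k ** a (j - 2 *s k)))"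
    proof (rule sum.mono_neutral_right[OF fin(3)])
      show "(\<lambda>l. 2 *s k + l) ` ?A \<subseteq> J" using k by (auto simp: J_def)
      have "a (j - 2 *s k) = 0" if "j \<notin> (\<lambda>l. 2 *s k + l) ` ?A" for j
        using that by (auto simp: image_iff algebra_simps)
      then show "\<forall>j\<in>J - (\<lambda>l. 2 *s k + l) ` ?A. cscale (char_fun j \<xi>) (v k ** a (j - 2 *s k)) = 0"
        by simp
    qed
    also have "\<dots> = (\<Sum>l\<in>?A. cscale (char_fun (2 *s k + l) \<xi>) (v k ** a l))"
      by (subst sum.reindex) (auto simp: inj_on_def)
    finally show "(\<Sum>j\<in>J. cscale (char_fun j \<xi>) (v k ** a (j - 2 *s k))) = \<dots>" .
  qed
  also have "\<dots> = (\<Sum>k\<in>?V. \<Sum>l\<in>?A. cscale (char_fun k (2 *\<^sub>R \<xi>)) (v k) ** cscale (char_fun l \<xi>) (a l))"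
    by (intro sum.cong refl)
      (simp add: cscale_matrix_mult cscale_cscale of_int_vec_add of_int_vec_smult inner_add_left
        algebra_simps flip: exp_add)
  also have "\<dots> = symbol v (2 *\<^sub>R \<xi>) ** symbol a \<xi>"
    by (simp add: symbol_eq[OF a] symbol_eq[OF v] matmul.sum_left matmul.sum_right) (rule sum.swap)
  finally show "symbol (subdivision a v) \<xi> = ?c *\<^sub>R (symbol v (2 *\<^sub>R \<xi>) ** symbol a \<xi>)" .
qed

text \<open>The evaluation point is scaled with n so that every further step appends its factor on
  the right, at the next smaller dilate, exactly as in \<open>mprod\<close>.\<close>

lemma symbol_funpow_subdivision:
  fixes a :: "int^'d \<Rightarrow> complex^'r^'r" and v :: "int^'d \<Rightarrow> complex^'r^'s"
  assumes a: "finsupp a" and v: "finsupp v"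
  shows "finsupp ((subdivision a ^^ n) v) \<and>
    symbol ((subdivision a ^^ n) v) ((1 / 2) ^ n *\<^sub>R \<xi>) =
    (2 ^ (CARD('d) * n)) *\<^sub>R (symbol v \<xi> ** mprod (\<lambda>j. symbol a ((1 / 2) ^ j *\<^sub>R \<xi>)) n)"
proof (induction n)
  case 0
  then show ?case using v by simp
next
  case (Suc n)
  then show ?case
    using symbol_subdivision[OF a, of "(subdivision a ^^ n) v"]
    by (simp add: matmul.scaleR_left matrix_mul_assoc power_add)
qed

text \<open>A support radius t becomes 2t + R in one step; the bound is the solution of this
  recursion with initial value \<rho>.\<close>

lemma funpow_subdivision_support:
  fixes v :: "int^'d \<Rightarrow> complex^'r^'s"
  assumes a: "finsupp a" "\<And>k i. a k \<noteq> 0 \<Longrightarrow> \<bar>real_of_int (k $ i)\<bar> \<le> R"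
    and v: "\<And>k i. v k \<noteq> 0 \<Longrightarrow> \<bar>real_of_int (k $ i)\<bar> \<le> \<rho>"
  shows "(subdivision a ^^ n) v k \<noteq> 0 \<Longrightarrow> \<bar>real_of_int (k $ i)\<bar> \<le> 2 ^ n * (\<rho> + R) - R"
proof (induction n arbitrary: k)
  case 0
  then show ?case using v by simp
next
  case (Suc n)
  let ?w = "(subdivision a ^^ n) v"
  have "subdivision a ?w k \<noteq> 0" using Suc.prems by simp
  then obtain l where l: "a (k - 2 *s l) \<noteq> 0" "?w l \<noteq> 0"
    using subdivision_support[OF a(1), of ?w k] by auto (metis add_diff_cancel_left')
  have "\<bar>real_of_int (k $ i) - 2 * real_of_int (l $ i)\<bar> \<le> R" using a(2)[OF l(1), of i] by simp
  moreover have "\<bar>real_of_int (l $ i)\<bar> \<le> 2 ^ n * (\<rho> + R) - R" by (rule Suc.IH[OF l(2)])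
  moreover have "\<bar>x\<bar> \<le> 2 * t + R" if "\<bar>x - 2 * y\<bar> \<le> R" "\<bar>y\<bar> \<le> t" for x y t :: real
    using that by linarith
  ultimately have "\<bar>real_of_int (k $ i)\<bar> \<le> 2 * (2 ^ n * (\<rho> + R) - R) + R" by blast
  then show ?case by (simp add: algebra_simps)
qed

text \<open>Dual to the growth of supports: agreement within radius t about y gives agreement within
  2t - R about 2y. The fixed point of this recursion is R, so for \<rho> = R the radius is the same
  at all levels.\<close>

lemma funpow_subdivision_local:
  fixes v v' :: "int^'d \<Rightarrow> complex^'r^'s"
  assumes a: "\<And>k i. a k \<noteq> 0 \<Longrightarrow> \<bar>real_of_int (k $ i)\<bar> \<le> R"
    and v: "\<And>k. (\<And>i. \<bar>real_of_int (k $ i) - y i\<bar> \<le> \<rho>) \<Longrightarrow> v k = v' k"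
  shows "(\<And>i. \<bar>real_of_int (k $ i) - 2 ^ n * y i\<bar> \<le> 2 ^ n * (\<rho> - R) + R) \<Longrightarrow>
    (subdivision a ^^ n) v k = (subdivision a ^^ n) v' k"
proof (induction n arbitrary: k)
  case 0
  then show ?case using v by simp
next
  case (Suc n)
  have "(subdivision a ^^ n) v l = (subdivision a ^^ n) v' l" if "a (k - 2 *s l) \<noteq> 0" for l
  proof (rule Suc.IH)
    fix i
    have "\<bar>real_of_int (k $ i) - 2 * real_of_int (l $ i)\<bar> \<le> R" using a[OF that, of i] by simp
    moreover have "\<bar>real_of_int (k $ i) - 2 * (2 ^ n * y i)\<bar> \<le> 2 * (2 ^ n * (\<rho> - R)) + R"
      using Suc.prems[of i] by (simp add: mult.assoc)
    ultimately show "\<bar>real_of_int (l $ i) - 2 ^ n * y i\<bar> \<le> 2 ^ n * (\<rho> - R) + R" by linarith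
  qed
  moreover have "subdivision a w k = subdivision a w' k"
    if "\<And>l. a (k - 2 *s l) \<noteq> 0 \<Longrightarrow> w l = w' l" for w w' :: "int^'d \<Rightarrow> complex^'r^'s"
    unfolding subdivision_def using that by (intro arg_cong[where f = "scaleR _"] sum.cong) auto
  ultimately have "subdivision a ((subdivision a ^^ n) v) k = subdivision a ((subdivision a ^^ n) v') k"
    by blast
  then show ?case by simp
qed

section \<open>Limit functions of the subdivision scheme\<close>

lemma matrix_inv:
  fixes A :: "complex^'r^'r"
  assumes "invertible A"
  shows "A ** matrix_inv A = mat 1" "matrix_inv A ** A = mat 1"
  using someI_ex[OF assms[unfolded invertible_def]] by (simp_all add: matrix_inv_def)

lemma matrix_inv_eqI:
  fixes A :: "complex^'r^'r"
  assumes "A ** B = mat 1" "B ** A = mat 1"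
  shows "matrix_inv A = B"
proof -
  have "invertible A" using assms by (auto simp: invertible_def)
  then have "B ** (A ** matrix_inv A) = B" by (simp add: matrix_inv)
  then show ?thesis by (simp add: matrix_mul_assoc assms)
qed

lemma mprod_matrix_inv_D_mat:
  fixes \<nu> :: "'r::finite \<Rightarrow> nat^'d"
  shows "mprod (\<lambda>_. matrix_inv (D_mat \<nu>)) n = (\<chi> i j. if i = j then 2 ^ (n * mdeg (\<nu> i)) else 0)"
proof -
  let ?D = "\<lambda>c. (\<chi> i j. if i = j then c i else 0) :: complex^'r^'r"
  have mult: "?D c ** ?D c' = ?D (\<lambda>i. c i * c' i)" for c c' :: "'r \<Rightarrow> complex"
  proof -
    have "(\<Sum>k\<in>UNIV. (if i = k then c i else 0) * (if k = j then c' k else 0)) =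
        (\<Sum>k\<in>UNIV. if k = i then (if i = j then c i * c' i else 0) else 0)" for i j
      by (intro sum.cong) auto
    then show ?thesis by (simp add: vec_eq_iff matrix_matrix_mult_def)
  qed
  have one: "?D c = mat 1" if "\<And>i. c i = 1" for c
    using that by (auto simp: mat_def vec_eq_iff)
  have inv: "matrix_inv (D_mat \<nu>) = ?D (\<lambda>i. 2 ^ mdeg (\<nu> i))"
    unfolding D_mat_def
    by (rule matrix_inv_eqI; simp add: mult; intro one; simp add: power_divide)
  show ?thesis
  proof (induction n)
    case 0
    then show ?case by (auto simp: mat_def vec_eq_iff)
  next
    case (Suc n)
    then have "mprod (\<lambda>_. matrix_inv (D_mat \<nu>)) (Suc n) =
        ?D (\<lambda>i. 2 ^ (n * mdeg (\<nu> i))) ** ?D (\<lambda>i. 2 ^ mdeg (\<nu> i))"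
      by (simp add: inv)
    then show ?case
      unfolding mult by (auto simp: vec_eq_iff power_add mult.commute)
  qed
qed

lemma scheme_iter_nth:
  fixes w :: "int^'d::{finite,linorder} \<Rightarrow> complex^'r^1"
  shows "scheme_iter \<nu> a w n k $ 1 $ l = 2 ^ (n * mdeg (\<nu> l)) * (subdivision a ^^ n) w k $ 1 $ l"
  unfolding scheme_iter_def mprod_matrix_inv_D_mat
  by (simp add: matrix_matrix_mult_def if_distrib mult.commute cong: if_cong)

section \<open>Limit functions at dyadic points\<close>

lemma limit_function_bound:
  assumes "is_limit_function m \<nu> a w \<eta>" "K > 0"
  obtains \<epsilon> where "\<epsilon> \<longlonglongrightarrow> (0 :: real)"
    "\<And>n k. k \<in> ibox (2 ^ n * K) \<Longrightarrow> cmod (scheme_iter \<nu> a w n k $ 1 $ l -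
        mpartial (\<nu> l) \<eta> ((1 / 2) ^ n *\<^sub>R of_int_vec k)) \<le> \<epsilon> n"
proof
  let ?f = "\<lambda>n k. cmod (scheme_iter \<nu> a w n k $ 1 $ l - mpartial (\<nu> l) \<eta> ((1 / 2) ^ n *\<^sub>R of_int_vec k))"
  show "(\<lambda>n. Max (?f n ` ibox (2 ^ n * K))) \<longlonglongrightarrow> 0"
    using assms unfolding is_limit_function_def ibox_def by blast
  show "?f n k \<le> Max (?f n ` ibox (2 ^ n * K))" if "k \<in> ibox (2 ^ n * K)" for n k
    using that assms(2) by (intro Max_ge finite_imageI ibox_card) auto
qed

text \<open>The dyadic point with index k at level n has index 2^N k at level N + n, so the
  derivative is evaluated at one fixed point and no continuity is involved.\<close>

lemma limit_function_dyadic: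
  assumes "is_limit_function m \<nu> a w \<eta>"
  shows "(\<lambda>N. scheme_iter \<nu> a w (N + n) (2 ^ N *s k) $ 1 $ l) \<longlonglongrightarrow>
    mpartial (\<nu> l) \<eta> ((1 / 2) ^ n *\<^sub>R of_int_vec k)"
proof -
  let ?x = "(1 / 2) ^ n *\<^sub>R of_int_vec k"
  \<comment> \<open>The margin 1 keeps the radius positive also for ?x = 0.\<close>
  have "norm ?x + 1 > 0" using norm_ge_zero[of ?x] by linarith
  then obtain \<epsilon> where \<epsilon>: "\<epsilon> \<longlonglongrightarrow> 0"
    "\<And>n k. k \<in> ibox (2 ^ n * (norm ?x + 1)) \<Longrightarrow> cmod (scheme_iter \<nu> a w n k $ 1 $ l -
        mpartial (\<nu> l) \<eta> ((1 / 2) ^ n *\<^sub>R of_int_vec k)) \<le> \<epsilon> n"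
    by (rule limit_function_bound[OF assms]) blast
  have x: "(1 / 2) ^ (N + n) *\<^sub>R of_int_vec (2 ^ N *s k) = ?x" for N
    by (simp add: of_int_vec_smult power_add power_divide)
  have box: "2 ^ N *s k \<in> ibox (2 ^ (N + n) * (norm ?x + 1))" for N
  proof -
    have "\<bar>real_of_int ((2 ^ N *s k) $ i)\<bar> \<le> 2 ^ (N + n) * (norm ?x + 1)" for i
    proof -
      have "\<bar>real_of_int ((2 ^ N *s k) $ i)\<bar> = 2 ^ (N + n) * \<bar>?x $ i\<bar>"
        by (simp add: abs_mult power_add power_divide)
      also have "\<bar>?x $ i\<bar> \<le> norm ?x + 1" using component_le_norm_cart[of ?x i] by linarith
      finally show ?thesis by simp
    qed
    then show ?thesis by (simp add: ibox_def)
  qed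
  have "(\<lambda>N. scheme_iter \<nu> a w (N + n) (2 ^ N *s k) $ 1 $ l - mpartial (\<nu> l) \<eta> ?x) \<longlonglongrightarrow> 0"
  proof (rule Lim_null_comparison)
    show "\<forall>\<^sub>F N in sequentially. norm (scheme_iter \<nu> a w (N + n) (2 ^ N *s k) $ 1 $ l -
        mpartial (\<nu> l) \<eta> ?x) \<le> \<epsilon> (N + n)"
      using \<epsilon>(2)[OF box] unfolding x by simp
    show "(\<lambda>N. \<epsilon> (N + n)) \<longlonglongrightarrow> 0" using \<epsilon>(1) by (rule LIMSEQ_ignore_initial_segment)
  qed
  then show ?thesis by (rule LIM_zero_cancel)
qed

lemma subdivision_sum:
  fixes v :: "'b \<Rightarrow> int^'d \<Rightarrow> complex^'r^'s"
  shows "subdivision a (\<lambda>k. \<Sum>b\<in>B. cscale (c b) (v b k)) = (\<lambda>k. \<Sum>b\<in>B. cscale (c b) (subdivision a (v b) k))"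
  by (rule ext)
    (simp add: subdivision_def matmul.sum_left cscale_matrix_mult cscale.scaleR_right cscale.sum_right
      scaleR_sum_right sum.swap[of _ B])

lemma funpow_subdivision_sum:
  fixes v :: "'b \<Rightarrow> int^'d \<Rightarrow> complex^'r^'s"
  shows "(subdivision a ^^ n) (\<lambda>k. \<Sum>b\<in>B. cscale (c b) (v b k)) =
    (\<lambda>k. \<Sum>b\<in>B. cscale (c b) ((subdivision a ^^ n) (v b) k))"
  by (induction n) (simp_all add: subdivision_sum)

lemma subdivision_shift:
  fixes v :: "int^'d \<Rightarrow> complex^'r^'s"
  shows "subdivision a (\<lambda>k. v (k - j)) = (\<lambda>k. subdivision a v (k - 2 *s j))"
proof
  fix k
  have "k - 2 *s (l + j) = k - 2 *s j - 2 *s l" "k - 2 *s j - 2 *s (l - j) = k - 2 *s l" for l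
    by (simp_all add: vec_eq_iff algebra_simps)
  note eq = this
  have "(\<Sum>l | a (k - 2 *s l) \<noteq> 0. v (l - j) ** a (k - 2 *s l)) =
    (\<Sum>l | a (k - 2 *s j - 2 *s l) \<noteq> 0. v l ** a (k - 2 *s j - 2 *s l))"
    by (rule sum.reindex_bij_witness[where i = "\<lambda>l. l + j" and j = "\<lambda>l. l - j"])
      (simp_all only: mem_Collect_eq add_diff_cancel diff_add_cancel eq simp_thms)
  then show "subdivision a (\<lambda>k. v (k - j)) k = subdivision a v (k - 2 *s j)"
    by (simp add: subdivision_def)
qed

lemma funpow_subdivision_shift:
  fixes v :: "int^'d \<Rightarrow> complex^'r^'s"
  shows "(subdivision a ^^ n) (\<lambda>k. v (k - j)) = (\<lambda>k. (subdivision a ^^ n) v (k - 2 ^ n *s j))"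
proof (induction n)
  case (Suc n)
  have "2 *s (2 ^ n *s j) = 2 ^ Suc n *s j" by (simp add: vec_eq_iff)
  then show ?case
    using Suc subdivision_shift[of a "(subdivision a ^^ n) v" "2 ^ n *s j"] by simp
qed (simp add: vec_eq_iff)

definition unit_data :: "'r \<Rightarrow> int^'d \<Rightarrow> complex^'r^1" where
  "unit_data l k = (\<chi> i. delta k *s axis l 1)"

lemma unit_data_nth: "unit_data l k $ i $ j = (if k = 0 \<and> j = l then 1 else 0)"
  by (simp add: unit_data_def delta_def axis_def)

lemma unit_data_eq_0: "k \<noteq> 0 \<Longrightarrow> unit_data l k = 0"
  by (simp add: vec_eq_iff unit_data_nth)

lemma symbol_unit_data: "symbol (unit_data l) \<xi> = (\<chi> i. axis l 1)"
proof -
  have "symbol (unit_data l) \<xi> = (\<Sum>k\<in>{0}. cscale (char_fun k \<xi>) (unit_data l k))"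
    using unit_data_eq_0 by (intro symbol_eq_sum) auto
  then show ?thesis by (simp add: vec_eq_iff unit_data_nth axis_def)
qed

lemma row_axis_mult:
  fixes M :: "complex^'r^'r"
  shows "((\<chi> i. axis l 1) ** M :: complex^'r^1) $ 1 $ j = M $ l $ j"
proof -
  have "axis l 1 $ k * M $ k $ j = (if k = l then M $ k $ j else 0)" for k
    by (simp add: axis_def)
  then show ?thesis by (simp add: matrix_matrix_mult_def)
qed

lemma mult_axis_nth:
  fixes M :: "complex^'r^'s"
  shows "(M *v axis j 1) $ l = M $ l $ j"
  by (simp add: matrix_vector_mul_component axis_def if_distrib inner_vec_def matrix_vector_mult_def cong: if_cong)

section \<open>Compact support and Fourier transform of the basis functions\<close>

locale hermite_scheme =
  fixes m :: nat
    and \<nu> :: "'r::{finite,linorder} \<Rightarrow> nat^'d::{finite,linorder}"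
    and a :: "int^'d::{finite,linorder} \<Rightarrow> complex^'r::{finite,linorder}^'r::{finite,linorder}"
    and \<phi> :: "real^'d::{finite,linorder} \<Rightarrow> complex^'r::{finite,linorder}"
  assumes mdeg_\<nu>: "\<And>l. mdeg (\<nu> l) \<le> m"
    and \<nu>_first: "\<nu> first = 0"
    and a: "finsupp a"
    and convergent: "hermite_convergent m \<nu> a"
    and basis: "basis_vector_function m \<nu> a \<phi>"
begin

text \<open>A coordinate bound for the mask support, fixed for the whole locale. Positivity makes it
  admissible as the radius in the definition of limit functions.\<close>

definition "R = (SOME R. R > 0 \<and> (\<forall>k i. a k \<noteq> 0 \<longrightarrow> \<bar>real_of_int (k $ i)\<bar> \<le> R))"

lemma R: "R > 0" "\<And>k i. a k \<noteq> 0 \<Longrightarrow> \<bar>real_of_int (k $ i)\<bar> \<le> R"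
proof -
  let ?S = "(\<lambda>(k, i). \<bar>real_of_int (k $ i)\<bar>) ` ({k. a k \<noteq> 0} \<times> UNIV)"
  have fin: "finite ?S" using a by (auto simp: finsupp_def)
  have "\<bar>real_of_int (k $ i)\<bar> \<le> Max (insert 1 ?S)" if "a k \<noteq> 0" for k i
    using that fin by (intro Max_ge) force+
  moreover have "1 \<le> Max (insert 1 ?S)" using fin by (intro Max_ge) auto
  ultimately have "\<exists>R. R > 0 \<and> (\<forall>k i. a k \<noteq> 0 \<longrightarrow> \<bar>real_of_int (k $ i)\<bar> \<le> R)"
    by (intro exI[of _ "Max (insert 1 ?S)"]) auto
  from someI_ex[OF this] show "R > 0" "\<And>k i. a k \<noteq> 0 \<Longrightarrow> \<bar>real_of_int (k $ i)\<bar> \<le> R"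
    unfolding R_def by blast+
qed

lemma limit_\<phi>: "is_limit_function m \<nu> a (unit_data l) (\<lambda>x. \<phi> x $ l)"
  using basis by (simp add: basis_vector_function_def unit_data_def [abs_def])

lemma C_class_\<phi>: "C_class m (\<lambda>x. \<phi> x $ l)"
  using limit_\<phi> by (simp add: is_limit_function_def)

lemma continuous_\<phi>: "continuous_on UNIV (\<lambda>x. \<phi> x $ l)"
  using C_class_\<phi> C_class_continuous by blast

lemma iter_first: "scheme_iter \<nu> a w n k $ 1 $ first = (subdivision a ^^ n) w k $ 1 $ first"
  by (simp add: scheme_iter_nth \<nu>_first mdeg_def)

lemma mpartial_first: "mpartial (\<nu> first) f = f"
  by (simp add: \<nu>_first mpartial_0)

lemma unit_data_support:
  assumes "(subdivision a ^^ n) (unit_data l) k \<noteq> 0"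
  shows "\<bar>real_of_int (k $ i)\<bar> \<le> 2 ^ n * R"
proof -
  have "\<bar>real_of_int (k $ i)\<bar> \<le> 2 ^ n * (0 + R) - R"
    by (rule funpow_subdivision_support[OF a _ _ assms], use R(2) in blast) (metis abs_zero of_int_0 order_refl unit_data_eq_0 zero_index)
  then show ?thesis using R(1) by simp
qed

lemma \<phi>_dyadic_limit:
  "(\<lambda>N. (subdivision a ^^ (N + n)) (unit_data l) (2 ^ N *s k) $ 1 $ first) \<longlonglongrightarrow>
    \<phi> ((1 / 2) ^ n *\<^sub>R of_int_vec k) $ l"
  using limit_function_dyadic[OF limit_\<phi>, of l n k first] by (simp add: iter_first mpartial_first)

text \<open>The iterates of the unit data vanish outside the cube of half-width 2^n R, hence \<phi>
  vanishes at the dyadic points close to x, and continuity carries this over to x.\<close>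

lemma \<phi>_support:
  assumes "\<phi> x \<noteq> 0" shows "\<bar>x $ i\<bar> \<le> R"
proof (rule ccontr)
  assume i: "\<not> \<bar>x $ i\<bar> \<le> R"
  obtain l where l: "\<phi> x $ l \<noteq> 0" using assms by (auto simp: vec_eq_iff)
  let ?y = "\<lambda>n. (1 / 2) ^ n *\<^sub>R of_int_vec (dyadic_floor n x) :: real^'d::{finite,linorder}"
  have "(\<lambda>n. \<bar>?y n $ i\<bar>) \<longlonglongrightarrow> \<bar>x $ i\<bar>"
    by (intro tendsto_rabs tendsto_vec_nth dyadic_approx)
  then have "\<forall>\<^sub>F n in sequentially. \<bar>?y n $ i\<bar> > R" using i by (intro order_tendstoD) auto
  then have "\<forall>\<^sub>F n in sequentially. \<phi> (?y n) $ l = 0"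
  proof eventually_elim
    case (elim n)
    have zero: "(subdivision a ^^ (N + n)) (unit_data l) (2 ^ N *s dyadic_floor n x) = 0" for N
    proof (rule ccontr)
      assume "\<not> ?thesis"
      from unit_data_support[OF this, of i] have "\<bar>?y n $ i\<bar> \<le> R"
        by (simp add: abs_mult power_add power_divide field_simps)
      then show False using elim by simp
    qed
    show ?case using \<phi>_dyadic_limit[of n l "dyadic_floor n x"] by (simp add: zero LIMSEQ_const_iff)
  qed
  moreover have "isCont (\<lambda>x. \<phi> x $ l) x" using continuous_\<phi> by (simp add: continuous_on_eq_continuous_at)
  then have "(\<lambda>n. \<phi> (?y n) $ l) \<longlonglongrightarrow> \<phi> x $ l"
    by (rule isCont_tendsto_compose) (rule dyadic_approx)
  ultimately have "(\<lambda>n. 0) \<longlonglongrightarrow> \<phi> x $ l" using Lim_transform_eventually by fastforce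
  then show False using l by (simp add: LIMSEQ_const_iff)
qed

lemma compact_support_\<phi>: "compact (closure {x. \<phi> x \<noteq> 0})"
proof -
  have "{x. \<phi> x \<noteq> 0} \<subseteq> sbox R" using \<phi>_support by (auto simp: mem_sbox)
  moreover have "bounded (sbox R)" by (simp add: sbox_def bounded_cbox)
  ultimately show ?thesis using bounded_subset by (auto simp: compact_closure)
qed

lemma compsupp_\<phi>: "compsupp (\<lambda>x. \<phi> x $ l)"
proof -
  obtain B where B: "\<And>x. x \<in> closure {x. \<phi> x \<noteq> 0} \<Longrightarrow> norm x \<le> B"
    using compact_support_\<phi> compact_imp_bounded bounded_iff by metis
  have "\<forall>x. \<phi> x $ l \<noteq> 0 \<longrightarrow> norm x \<le> B"
  proof (intro allI impI)
    fix x assume "\<phi> x $ l \<noteq> 0"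
    then have "x \<in> {x. \<phi> x \<noteq> 0}" by (auto simp: vec_eq_iff)
    then show "norm x \<le> B" by (intro B subsetD[OF closure_subset])
  qed
  then show ?thesis unfolding compsupp_def using continuous_\<phi> by blast
qed

text \<open>Data \<delta> times the l-th unit row select row l of the product, and the symbol of the
  iterate is by definition a dyadic sum. The first column is the relevant one, because there the
  values tend to \<phi> without rescaling.\<close>

lemma symbol_iterate_sum:
  "(mprod (\<lambda>j. symbol a ((1 / 2) ^ j *\<^sub>R \<xi>)) n *v axis first 1) $ l =
    (1 / 2) ^ (CARD('d) * n) * (\<Sum>k\<in>ibox (2 ^ n * R).
      (subdivision a ^^ n) (unit_data l) k $ 1 $ first * char_fun k ((1 / 2) ^ n *\<^sub>R \<xi>))"
proof -
  let ?v = "(subdivision a ^^ n) (unit_data l)" and ?M = "mprod (\<lambda>j. symbol a ((1 / 2) ^ j *\<^sub>R \<xi>)) n"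
  have "finsupp (unit_data l :: int^'d::{finite,linorder} \<Rightarrow> _)"
    unfolding finsupp_def by (rule finite_subset[of _ "{0}"]) (use unit_data_eq_0 in auto)
  from symbol_funpow_subdivision[OF a this, of n \<xi>]
  have "symbol ?v ((1 / 2) ^ n *\<^sub>R \<xi>) $ 1 $ first = 2 ^ (CARD('d) * n) * (?M $ l $ first)"
    by (simp add: symbol_unit_data row_axis_mult) (simp add: scaleR_conv_of_real)
  moreover have "symbol ?v ((1 / 2) ^ n *\<^sub>R \<xi>) =
      (\<Sum>k\<in>ibox (2 ^ n * R). cscale (char_fun k ((1 / 2) ^ n *\<^sub>R \<xi>)) (?v k))"
    using R(1) unit_data_support by (intro symbol_eq_sum ibox_card) (auto simp: ibox_def)
  ultimately have "2 ^ (CARD('d) * n) * (?M $ l $ first) =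
      (\<Sum>k\<in>ibox (2 ^ n * R). ?v k $ 1 $ first * char_fun k ((1 / 2) ^ n *\<^sub>R \<xi>))"
    by (simp add: mult.commute)
  then show ?thesis by (simp add: mult_axis_nth power_divide field_simps)
qed

lemma fourier_\<phi>_limit:
  "(\<lambda>n. mprod (\<lambda>j. symbol a ((1 / 2) ^ j *\<^sub>R \<xi>)) n *v axis first 1) \<longlonglongrightarrow> fourier \<phi> \<xi>"
proof (rule vec_tendstoI)
  fix l
  let ?e = "\<lambda>x. exp (- \<i> * of_real (x \<bullet> \<xi>))" and ?h = "\<lambda>n. (1 / 2) ^ (CARD('d) * n)"
  let ?T = "\<lambda>n k. (subdivision a ^^ n) (unit_data l) k $ 1 $ first"
  let ?x = "\<lambda>n k. (1 / 2) ^ n *\<^sub>R of_int_vec k :: real^'d::{finite,linorder}"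
  \<comment> \<open>A and B are the same dyadic sum, taken over the subdivision values and over the
    samples of \<phi>, respectively.\<close>
  define A where "A n = ?h n * (\<Sum>k\<in>ibox (2 ^ n * R). ?T n k * ?e (?x n k))" for n
  define B where "B n = ?h n * (\<Sum>k\<in>ibox (2 ^ n * R). \<phi> (?x n k) $ l * ?e (?x n k))" for n
  have A: "(mprod (\<lambda>j. symbol a ((1 / 2) ^ j *\<^sub>R \<xi>)) n *v axis first 1) $ l = A n" for n
    unfolding symbol_iterate_sum A_def by simp
  have B: "B \<longlonglongrightarrow> fourier \<phi> \<xi> $ l"
    unfolding B_def [abs_def] fourier_nth ft_def
  proof (rule riemann_sum_tendsto[OF compsupp_exp[OF compsupp_\<phi>]])
    show "\<bar>x $ i\<bar> \<le> R" if "\<phi> x $ l * ?e x \<noteq> 0" for x i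
      using that by (intro \<phi>_support) auto
  qed (use R in simp)
  obtain \<epsilon> where \<epsilon>: "\<epsilon> \<longlonglongrightarrow> 0" "\<And>n k. k \<in> ibox (2 ^ n * R) \<Longrightarrow> cmod (?T n k - \<phi> (?x n k) $ l) \<le> \<epsilon> n"
    using limit_function_bound[OF limit_\<phi> R(1), of l first]
    unfolding iter_first mpartial_first by metis
  have eps0: "\<epsilon> n \<ge> 0" for n
  proof -
    have "0 \<in> ibox (2 ^ n * R)" using R by (simp add: ibox_def)
    from \<epsilon>(2)[OF this] show ?thesis using norm_ge_zero order_trans by blast
  qed
  have "(\<lambda>n. A n - B n) \<longlonglongrightarrow> 0"
  proof (rule Lim_null_comparison)
    show "(\<lambda>n. (2 * R + 1) ^ CARD('d) * \<epsilon> n) \<longlonglongrightarrow> 0"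
      using tendsto_mult[OF tendsto_const \<epsilon>(1)] by simp
    show "\<forall>\<^sub>F n in sequentially. norm (A n - B n) \<le> (2 * R + 1) ^ CARD('d) * \<epsilon> n"
    proof (rule always_eventually, rule allI)
      fix n
      have "A n - B n = ?h n * (\<Sum>k\<in>ibox (2 ^ n * R). (?T n k - \<phi> (?x n k) $ l) * ?e (?x n k))"
        by (simp add: A_def B_def right_diff_distrib left_diff_distrib sum_subtractf)
      also have "norm \<dots> = ?h n * norm (\<Sum>k\<in>ibox (2 ^ n * R). (?T n k - \<phi> (?x n k) $ l) * ?e (?x n k))"
        by (simp add: norm_mult norm_power norm_divide)
      \<comment> \<open>The uniform error is multiplied by cell volume times number of lattice
        points, which stays below \<open>(2 * R + 1) ^ CARD('d)\<close>.\<close>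
      also have "\<dots> \<le> ?h n * (real (card (ibox (2 ^ n * R) :: (int^'d::{finite,linorder}) set)) * \<epsilon> n)"
        using \<epsilon>(2) by (intro mult_left_mono sum_norm_bound) (auto simp: norm_mult)
      also have "\<dots> \<le> ?h n * ((2 * (2 ^ n * R) + 1) ^ CARD('d) * \<epsilon> n)"
        using R eps0 by (intro mult_left_mono mult_right_mono ibox_card) auto
      also have "\<dots> = ((1 / 2) ^ n * (2 * (2 ^ n * R) + 1)) ^ CARD('d) * \<epsilon> n"
        by (simp add: power_mult_distrib power_mult [symmetric] mult.commute)
      also have "\<dots> \<le> (2 * R + 1) ^ CARD('d) * \<epsilon> n"
      proof (intro mult_right_mono power_mono)
        have "(1 / 2 :: real) ^ n \<le> 1" by (intro power_le_one) auto
        then show "(1 / 2) ^ n * (2 * (2 ^ n * R) + 1) \<le> 2 * R + 1"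
          by (simp add: distrib_left power_divide)
      qed (use R eps0 in auto)
      finally show "norm (A n - B n) \<le> (2 * R + 1) ^ CARD('d) * \<epsilon> n" .
    qed
  qed
  from tendsto_add[OF this B]
  show "(\<lambda>n. (mprod (\<lambda>j. symbol a ((1 / 2) ^ j *\<^sub>R \<xi>)) n *v axis first 1) $ l) \<longlonglongrightarrow> fourier \<phi> \<xi> $ l"
    unfolding A by simp
qed

lemma mprod_Suc_left: "mprod A (Suc n) = A 1 ** mprod (\<lambda>j. A (Suc j)) n"
  by (induction n) (simp_all add: matrix_mul_assoc)

lemma refinement: "fourier \<phi> (2 *\<^sub>R \<xi>) = symbol a \<xi> *v fourier \<phi> \<xi>"
proof (rule LIMSEQ_unique)
  let ?M = "\<lambda>\<xi> n. mprod (\<lambda>j. symbol a ((1 / 2) ^ j *\<^sub>R \<xi>)) n"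
  show "(\<lambda>n. ?M (2 *\<^sub>R \<xi>) (Suc n) *v axis first 1) \<longlonglongrightarrow> fourier \<phi> (2 *\<^sub>R \<xi>)"
    using fourier_\<phi>_limit by (rule LIMSEQ_Suc)
  have "?M (2 *\<^sub>R \<xi>) (Suc n) = symbol a \<xi> ** ?M \<xi> n" for n
    unfolding mprod_Suc_left by simp
  then show "(\<lambda>n. ?M (2 *\<^sub>R \<xi>) (Suc n) *v axis first 1) \<longlonglongrightarrow> symbol a \<xi> *v fourier \<phi> \<xi>"
    by (simp add: matvec.tendsto[OF tendsto_const fourier_\<phi>_limit] flip: matrix_vector_mul_assoc)
qed

text \<open>Near a dyadic point the iterates see only the data in a bounded window. Truncated to it,
  the data are a finite combination of shifted unit data, whose limits are translates of \<phi>.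
  Continuity extends the formula to all points.\<close>

lemma limit_function_local:
  assumes "is_limit_function m \<nu> a w \<eta>" "norm x + R < K"
  shows "\<eta> x = (\<Sum>k\<in>ibox K. (w k *v \<phi> (x - of_int_vec k)) $ 1)"
proof -
  have K: "K \<ge> 0" using assms(2) R(1) norm_ge_zero[of x] by linarith
  have fin: "finite (ibox K :: (int^'d::{finite,linorder}) set)" by (rule ibox_card[OF K])
  let ?F = "\<lambda>x. \<Sum>k\<in>ibox K. (w k *v \<phi> (x - of_int_vec k)) $ 1"
  have dyadic: "\<eta> y = ?F y" if y: "y = (1 / 2) ^ n *\<^sub>R of_int_vec k" "norm y + R < K" for y n k
  proof (rule LIMSEQ_unique)
    show "(\<lambda>N. (subdivision a ^^ (N + n)) w (2 ^ N *s k) $ 1 $ first) \<longlonglongrightarrow> \<eta> y"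
      using limit_function_dyadic[OF assms(1), of n k first] by (simp add: iter_first mpartial_first y(1))
    define w' where "w' k = (\<Sum>(j, l)\<in>ibox K \<times> UNIV. cscale (w j $ 1 $ l) (unit_data l (k - j)))" for k
    have w': "w' k = (if k \<in> ibox K then w k else 0)" for k
    proof -
      have "w' k $ 1 $ i = (if k \<in> ibox K then w k else 0) $ 1 $ i" for i
      proof -
        have "w' k $ 1 $ i = (\<Sum>j\<in>ibox K. \<Sum>l\<in>UNIV. if l = i then if j = k then w k $ 1 $ i else 0 else 0)"
          unfolding w'_def sum.cartesian_product [symmetric] sum_component cscale_nth unit_data_nth
          by (intro sum.cong refl) auto
        then show ?thesis using fin by simp
      qed
      then show ?thesis by (simp add: vec_eq_iff forall_1)
    qed
    have eq: "(subdivision a ^^ (N + n)) w (2 ^ N *s k) $ 1 $ first = (\<Sum>(j, l)\<in>ibox K \<times> UNIV.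
        w j $ 1 $ l * (subdivision a ^^ (N + n)) (unit_data l) (2 ^ N *s (k - 2 ^ n *s j)) $ 1 $ first)" for N
    proof -
      have arg: "2 ^ N *s k - 2 ^ (N + n) *s j = 2 ^ N *s (k - 2 ^ n *s j)" for j
        by (simp add: vec_eq_iff power_add algebra_simps)
      have "(subdivision a ^^ (N + n)) w (2 ^ N *s k) = (subdivision a ^^ (N + n)) w' (2 ^ N *s k)"
      \<comment> \<open>With \<rho> = R the agreement radius at level N + n is again R, enough for
        the point itself, and indices within R of y lie in \<open>ibox K\<close>, where w and w'
        coincide.\<close>
      proof (rule funpow_subdivision_local[where R = R and \<rho> = R and y = "\<lambda>i. y $ i"])
        show "w j = w' j" if "\<And>i. \<bar>real_of_int (j $ i) - y $ i\<bar> \<le> R" for j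
        proof -
          have "\<bar>real_of_int (j $ i)\<bar> \<le> K" for i
            using that[of i] component_le_norm_cart[of y i] y(2) by linarith
          then show ?thesis by (simp add: w' ibox_def)
        qed
        show "\<bar>real_of_int ((2 ^ N *s k) $ i) - 2 ^ (N + n) * y $ i\<bar> \<le> 2 ^ (N + n) * (R - R) + R" for i
          using R(1) by (simp add: y(1) power_add power_divide)
      qed (use R(2) in blast)
      also have "\<dots> = (\<Sum>(j, l)\<in>ibox K \<times> UNIV.
        cscale (w j $ 1 $ l) ((subdivision a ^^ (N + n)) (unit_data l) (2 ^ N *s k - 2 ^ (N + n) *s j)))"
        unfolding w'_def [abs_def] split_beta funpow_subdivision_sum funpow_subdivision_shift ..
      finally show ?thesis by (simp add: sum_component split_beta arg)
    qed
    have arg: "(1 / 2) ^ n *\<^sub>R of_int_vec (k - 2 ^ n *s j) = y - of_int_vec j" for j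
      by (simp add: y(1) of_int_vec_diff of_int_vec_smult scaleR_diff_right power_divide)
    have "(\<lambda>N. (subdivision a ^^ (N + n)) w (2 ^ N *s k) $ 1 $ first) \<longlonglongrightarrow>
        (\<Sum>(j, l)\<in>ibox K \<times> UNIV. w j $ 1 $ l * \<phi> ((1 / 2) ^ n *\<^sub>R of_int_vec (k - 2 ^ n *s j)) $ l)"
      unfolding eq split_beta by (intro tendsto_sum tendsto_mult tendsto_const \<phi>_dyadic_limit)
    also have "(\<Sum>(j, l)\<in>ibox K \<times> UNIV.
        w j $ 1 $ l * \<phi> ((1 / 2) ^ n *\<^sub>R of_int_vec (k - 2 ^ n *s j)) $ l) = ?F y"
      unfolding arg by (simp add: sum.cartesian_product [symmetric] matrix_vector_mult_def)
    finally show "(\<lambda>N. (subdivision a ^^ (N + n)) w (2 ^ N *s k) $ 1 $ first) \<longlonglongrightarrow> ?F y" .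
  qed
  let ?y = "\<lambda>n. (1 / 2) ^ n *\<^sub>R of_int_vec (dyadic_floor n x) :: real^'d::{finite,linorder}"
  have "(\<lambda>n. norm (?y n)) \<longlonglongrightarrow> norm x" by (intro tendsto_norm dyadic_approx)
  \<comment> \<open>The strict inequality in the hypothesis leaves room for the approximating dyadic
    points, so that one finite sum serves all of them.\<close>
  then have "\<forall>\<^sub>F n in sequentially. norm (?y n) < K - R"
    using assms(2) by (intro order_tendstoD) auto
  then have ev: "\<forall>\<^sub>F n in sequentially. ?F (?y n) = \<eta> (?y n)"
    by eventually_elim (rule dyadic[symmetric, OF refl], simp)
  have "(\<lambda>n. (w k *v \<phi> (?y n - of_int_vec k)) $ 1) \<longlonglongrightarrow> (w k *v \<phi> (x - of_int_vec k)) $ 1" for k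
  proof -
    have "isCont (\<lambda>x. \<phi> x $ l) y" for l y
      using continuous_\<phi> by (simp add: continuous_on_eq_continuous_at)
    then have "(\<lambda>n. \<phi> (?y n - of_int_vec k) $ l) \<longlonglongrightarrow> \<phi> (x - of_int_vec k) $ l" for l
      by (rule isCont_tendsto_compose) (intro tendsto_diff tendsto_const dyadic_approx)
    then show ?thesis
      unfolding matrix_vector_mult_def by (simp add: tendsto_sum tendsto_mult)
  qed
  then have "(\<lambda>n. ?F (?y n)) \<longlonglongrightarrow> ?F x" by (rule tendsto_sum)
  from Lim_transform_eventually[OF this ev] have "(\<lambda>n. \<eta> (?y n)) \<longlonglongrightarrow> ?F x" .
  moreover have "isCont \<eta> x"
    using assms(1) C_class_continuous by (auto simp: is_limit_function_def continuous_on_eq_continuous_at)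
  then have "(\<lambda>n. \<eta> (?y n)) \<longlonglongrightarrow> \<eta> x" by (rule isCont_tendsto_compose) (rule dyadic_approx)
  ultimately show ?thesis using LIMSEQ_unique by blast
qed

lemma limit_function_has_sum:
  assumes "is_limit_function m \<nu> a w \<eta>"
  shows "((\<lambda>k. (w k *v \<phi> (x - of_int_vec k)) $ 1) has_sum \<eta> x) UNIV"
proof -
  let ?K = "norm x + R + 1"
  have K: "?K \<ge> 0" using R(1) by (simp add: add_nonneg_nonneg less_imp_le)
  have zero: "(w k *v \<phi> (x - of_int_vec k)) $ 1 = 0" if k: "k \<notin> ibox ?K" for k
  proof -
    obtain i where "\<bar>real_of_int (k $ i)\<bar> > ?K" using k by (auto simp: ibox_def not_le)
    then have "\<bar>(x - of_int_vec k) $ i\<bar> > R" using component_le_norm_cart[of x i] by simp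
    then have "\<phi> (x - of_int_vec k) = 0" using \<phi>_support by (metis not_less)
    then show ?thesis by simp
  qed
  have "((\<lambda>k. (w k *v \<phi> (x - of_int_vec k)) $ 1) has_sum \<eta> x) (ibox ?K)"
    using limit_function_local[OF assms, of x ?K] has_sum_finite[OF ibox_card(1)[OF K]] by simp
  then show ?thesis
    by (subst has_sum_cong_neutral[where T = "ibox ?K" and S = UNIV and g = "\<lambda>k. (w k *v \<phi> (x - of_int_vec k)) $ 1"]) (auto simp: zero)
qed

end

section \<open>Spectral decomposition\<close>

lemma invertible_iff_ker:
  fixes A :: "complex^'r^'r"
  shows "invertible A \<longleftrightarrow> (\<forall>x. A *v x = 0 \<longrightarrow> x = 0)"
  unfolding matrix_left_invertible_ker [symmetric] invertible_def
  using matrix_left_right_inverse by blast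

lemma det_eq_0_iff_ker:
  fixes A :: "complex^'r^'r"
  shows "det A = 0 \<longleftrightarrow> (\<exists>x. x \<noteq> 0 \<and> A *v x = 0)"
  using invertible_det_nz[of A] invertible_iff_ker[of A] by blast

lemma poly_det:
  fixes M :: "'a::comm_ring_1 poly^'n^'n"
  shows "poly (det M) z = det (\<chi> i j. poly (M $ i $ j) z)"
  by (simp add: det_def poly_sum poly_prod)

lemma det_scale_column:
  fixes u :: "'n::finite \<Rightarrow> 'a::comm_ring_1"
  shows "det (\<chi> i j. if j = k then c * u i else M i j) = c * det (\<chi> i j. if j = k then u i else M i j)"
proof -
  have tr: "transpose (\<chi> i j. if j = k then v i else M i j) =
      (\<chi> j. if j = k then (\<chi> i. v i) else (\<chi> i. M i j))" for v
    by (simp add: transpose_def vec_eq_iff)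
  have "(\<chi> i. c * u i) = c *s (\<chi> i. u i)" by (simp add: vec_eq_iff)
  then show ?thesis
    unfolding det_transpose[symmetric, of "\<chi> i j. if j = k then _ i else M i j"] tr
    by (simp only: det_row_mul)
qed

text \<open>Powers act on v with size little-o of 2^(-mn). They are written as iterated
  matrix-vector products, since \<open>^\<close> is entrywise on matrices.\<close>

definition decays :: "nat \<Rightarrow> complex^'r^'r \<Rightarrow> complex^'r \<Rightarrow> bool" where
  "decays m A v \<longleftrightarrow> (\<lambda>n. 2 ^ (m * n) *\<^sub>R (((*v) A ^^ n) v)) \<longlonglongrightarrow> 0"

lemma funpow_mult_vec_add: "((*v) A ^^ n) (v + w) = ((*v) A ^^ n) v + ((*v) A ^^ n) w"
  for A :: "complex^'r^'r"
  by (induction n) (simp_all add: matrix_vector_right_distrib)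

lemma funpow_mult_vec_scale: "((*v) A ^^ n) (c *s v) = c *s ((*v) A ^^ n) v"
  for A :: "complex^'r^'r"
  by (induction n) (simp_all add: vector_scalar_commute)

lemma funpow_mult_vec_eigen: "A *v v = z *s v \<Longrightarrow> ((*v) A ^^ n) v = z ^ n *s v"
  for A :: "complex^'r^'r"
  by (induction n) (simp_all add: vector_scalar_commute mult.commute)

lemma decays_add: "decays m A v \<Longrightarrow> decays m A w \<Longrightarrow> decays m A (v + w)"
  unfolding decays_def funpow_mult_vec_add scaleR_right_distrib by (rule tendsto_add_zero)

lemma decays_scale:
  assumes "decays m A v" shows "decays m A (c *s v)"
  unfolding decays_def
proof (rule vec_tendstoI)
  fix i
  have "(\<lambda>n. c * (2 ^ (m * n) *\<^sub>R ((*v) A ^^ n) v) $ i) \<longlonglongrightarrow> c * 0 $ i"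
    using assms by (intro tendsto_mult tendsto_const tendsto_vec_nth) (simp add: decays_def)
  then show "(\<lambda>n. (2 ^ (m * n) *\<^sub>R ((*v) A ^^ n) (c *s v)) $ i) \<longlonglongrightarrow> 0 $ i"
    by (simp add: funpow_mult_vec_scale)
qed

lemma decays_mult:
  assumes "decays m A v" shows "decays m A (A *v v)"
proof -
  have "(\<lambda>n. A *v (2 ^ (m * n) *\<^sub>R (((*v) A ^^ n) v))) \<longlonglongrightarrow> A *v 0"
    using assms by (intro matvec.tendsto tendsto_const) (simp add: decays_def)
  then show ?thesis by (simp add: decays_def matvec.scaleR_right funpow_swap1)
qed

lemma decays_diff: "decays m A v \<Longrightarrow> decays m A w \<Longrightarrow> decays m A (v - w)"
  using decays_add[of m A v "(-1) *s w"] decays_scale[of m A w "-1"] by simp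

text \<open>On an eigenvector the rescaled iterate is v times a number of modulus
  \<open>(2 ^ m * cmod z) ^ n\<close>, which is at least 1.\<close>

lemma decays_eigen:
  assumes "decays m A v" "A *v v = z *s v" "2 ^ m * cmod z \<ge> 1"
  shows "v = 0"
proof -
  have "v $ i = 0" for i
  proof -
    have "(\<lambda>n. norm ((2 ^ (m * n) *\<^sub>R (((*v) A ^^ n) v)) $ i)) \<longlonglongrightarrow> norm ((0 :: complex^'a) $ i)"
      using assms(1) by (intro tendsto_norm tendsto_vec_nth) (simp add: decays_def)
    moreover have "norm ((2 ^ (m * n) *\<^sub>R (((*v) A ^^ n) v)) $ i) \<ge> norm (v $ i)" for n
    proof -
      have "norm ((2 ^ (m * n) *\<^sub>R (((*v) A ^^ n) v)) $ i) = (2 ^ m * cmod z) ^ n * norm (v $ i)"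
        by (simp add: funpow_mult_vec_eigen[OF assms(2)] norm_mult norm_power power_mult_distrib power_mult)
      moreover have "(2 ^ m * cmod z) ^ n \<ge> 1" using assms(3) by (rule one_le_power)
      ultimately show ?thesis by (metis mult_1 mult_right_mono norm_ge_zero)
    qed
    ultimately have "norm (v $ i) \<le> norm ((0 :: complex^'a) $ i)"
      by (intro LIMSEQ_le_const) auto
    then show ?thesis by simp
  qed
  then show ?thesis by (simp add: vec_eq_iff)
qed

text \<open>The vectors of this form are a subspace that contains S. It is applied to the lattice
  values of the Fourier transform, all of which decay except the one at 0.\<close>

lemma decays_span:
  assumes "\<And>v. v \<in> S \<Longrightarrow> v = u \<or> decays m A v" "vec.span S = UNIV"
  obtains c w where "v = c *s u + w" "decays m A w"
proof -
  let ?T = "{c *s u + w | c w. decays m A w}"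
  have zero: "decays m A 0" using decays_scale[of m A _ 0] assms by (simp add: decays_def funpow_mult_vec_eigen[of A 0 0])
  have "vec.subspace ?T"
  proof (rule vec.subspaceI)
    show "0 \<in> ?T" using zero by (intro CollectI exI[of _ 0]) simp
    show "x + y \<in> ?T" if xy: "x \<in> ?T" "y \<in> ?T" for x y
    proof -
      obtain c w c' w' where "x = c *s u + w" "y = c' *s u + w'" "decays m A w" "decays m A w'"
        using xy by blast
      then show ?thesis
        by (intro CollectI exI[of _ "c + c'"] exI[of _ "w + w'"])
          (simp add: vector_sadd_rdistrib decays_add algebra_simps)
    qed
    show "b *s x \<in> ?T" if x: "x \<in> ?T" for b x
    proof -
      obtain c w where "x = c *s u + w" "decays m A w" using x by blast
      then show ?thesis
        by (intro CollectI exI[of _ "b * c"] exI[of _ "b *s w"])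
          (simp add: vector_add_ldistrib decays_scale)
    qed
  qed
  moreover have "S \<subseteq> ?T"
  proof
    fix v assume "v \<in> S"
    from assms(1)[OF this] show "v \<in> ?T"
    proof
      assume "v = u" then show ?thesis using zero by (intro CollectI exI[of _ 1] exI[of _ 0]) simp
    next
      assume "decays m A v" then show ?thesis by (intro CollectI exI[of _ 0] exI[of _ v]) simp
    qed
  qed
  ultimately have "vec.span S \<subseteq> ?T" by (rule vec.span_minimal[rotated])
  then have "v \<in> ?T" using assms(2) by blast
  then show ?thesis using that by blast
qed

text \<open>This splitting is all that the spectral statements take from the scheme. The sum is
  direct, because a decaying fixed vector vanishes.\<close>

locale split_matrix =
  fixes m :: nat and A :: "complex^'r^'r" and u :: "complex^'r"
  assumes fixed: "A *v u = u" and u_nonzero: "u \<noteq> 0"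
    and split: "\<And>v. \<exists>c w. v = c *s u + w \<and> decays m A w"
begin

lemma decays_fixed: "decays m A v \<Longrightarrow> A *v v = v \<Longrightarrow> v = 0"
  using decays_eigen[of m A v 1] by simp

lemma not_decays_scale_u: "decays m A (c *s u) \<Longrightarrow> c = 0"
  using decays_fixed[of "c *s u"] u_nonzero by (simp add: vector_scalar_commute fixed)

text \<open>Inserting the splitting into the eigenvector equation expresses the multiple c (1 - z)
  of u through decaying vectors, and no nonzero multiple of u decays.\<close>

lemma eigenvector_decays:
  assumes "A *v v = z *s v" "z \<noteq> 1" shows "decays m A v"
proof -
  obtain c w where v: "v = c *s u + w" and w: "decays m A w" using split by blast
  have "A *v v = c *s u + A *v w"
    by (simp add: v matrix_vector_right_distrib vector_scalar_commute fixed)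
  then have "(c * (1 - z)) *s u = z *s w - A *v w"
    using assms(1) by (simp add: v vec_eq_iff algebra_simps)
  then have "decays m A ((c * (1 - z)) *s u)"
    using w by (simp add: decays_diff decays_scale decays_mult)
  then have "c = 0" using not_decays_scale_u assms(2) by force
  then show ?thesis using v w by simp
qed

lemma eigenvalue_bound:
  assumes "eigenvalue A z" "z \<noteq> 1" shows "cmod z < (1 / 2) ^ m"
proof (rule ccontr)
  assume "\<not> ?thesis"
  then have *: "2 ^ m * cmod z \<ge> 1" by (simp add: power_divide field_simps)
  obtain v where "v \<noteq> 0" "A *v v = z *s v" using assms(1) by (auto simp: eigenvalue_def)
  then show False using decays_eigen[OF eigenvector_decays _ *] assms(2) by blast
qed

text \<open>A kernel vector would be an eigenvector for 2^(-k). As k is at least 1 this differs from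
  1, so the vector decays; as k is at most m the eigenvalue is too large for that.\<close>

lemma invertible_dilated:
  assumes "1 \<le> k" "k \<le> m" shows "invertible (mat 1 - 2 ^ k *\<^sub>R A)"
  unfolding invertible_iff_ker
proof (intro allI impI)
  fix v assume "(mat 1 - 2 ^ k *\<^sub>R A) *v v = 0"
  then have v: "v = 2 ^ k *\<^sub>R (A *v v)"
    by (simp add: matrix_vector_mult_diff_rdistrib matvec.scaleR_left)
  have Av: "A *v v = (1 / 2) ^ k *s v"
  proof -
    have "(1 / 2) ^ k *s v = (1 / 2) ^ k *s (2 ^ k *\<^sub>R (A *v v))" by (rule arg_cong[OF v])
    then show ?thesis by (simp add: vec_eq_iff power_divide scaleR_conv_of_real[where 'a = complex])
  qed
  have ne: "(1 / 2 :: complex) ^ k \<noteq> 1"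
  proof
    assume "(1 / 2 :: complex) ^ k = 1"
    then have "norm ((1 / 2 :: complex) ^ k) = 1" by simp
    then have "(1 / 2 :: real) ^ k = 1" by (simp add: norm_power norm_divide)
    then show False using assms(1) power_strict_decreasing[of 0 k "1 / 2 :: real"] by simp
  qed
  have "(2 :: real) ^ k \<le> 2 ^ m" using assms(2) by (intro power_increasing) auto
  then have "2 ^ m * cmod ((1 / 2) ^ k) \<ge> 1" by (simp add: norm_power norm_divide power_divide)
  from decays_eigen[OF eigenvector_decays[OF Av ne] Av this] show "v = 0" .
qed

text \<open>Replacing column $k$ of $z - A$ by $(z - A) u = (z - 1) u$ multiplies the determinant by $u_k$
  and pulls out the factor $z - 1$; the cofactor \<open>q\<close> does not vanish at 1.\<close>

lemma simple_eigenvalue_1: "simple_eigenvalue A 1"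
proof -
  have eig: "eigenvalue A 1" using fixed u_nonzero by (auto simp: eigenvalue_def)
  obtain k where k: "u $ k \<noteq> 0" using u_nonzero by (auto simp: vec_eq_iff)
  let ?M = "\<lambda>i j. (if i = j then [:0, 1:] else 0) - [:A $ i $ j:]"
  define q where "q = det (\<chi> i j. if j = k then [:u $ i:] else ?M i j)"
  let ?N = "\<lambda>z i j. (if i = j then z else 0) - A $ i $ j"
  have q: "poly q z = det (\<chi> i j. if j = k then u $ i else ?N z i j)" for z
  proof -
    have "poly (if j = k then [:u $ i:] else ?M i j) z = (if j = k then u $ i else ?N z i j)" for i j
      by simp
    then show ?thesis unfolding q_def poly_det by simp
  qed
  have p: "poly (charpoly A) z = det (\<chi> i j. ?N z i j)" for z
  proof -
    have "poly (?M i j) z = ?N z i j" for i j by simp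
    then show ?thesis unfolding charpoly_def poly_det by simp
  qed
  have "smult (u $ k) (charpoly A) = [:-1, 1:] * q"
  \<comment> \<open>The polynomials are compared through their values, where Cramer's lemma applies
    to complex matrices.\<close>
  proof (rule iffD1[OF poly_eq_poly_eq_iff], rule ext)
    fix z
    have mv: "((\<chi> i j. ?N z i j) *v u) $ i = (z - 1) * u $ i" for i
    proof -
      have "((\<chi> i j. ?N z i j) *v u) $ i = (\<Sum>j\<in>UNIV. (if j = i then z * u $ i else 0)) - (A *v u) $ i"
        unfolding matrix_vector_mult_def
        by (simp add: left_diff_distrib sum_subtractf if_distrib[of "\<lambda>x. x * _"] eq_commute[of i] cong: if_cong)
      then show ?thesis by (simp add: fixed algebra_simps)
    qed
    have "u $ k * poly (charpoly A) z = det (\<chi> i j. if j = k then ((\<chi> i j. ?N z i j) *v u) $ i else ?N z i j)"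
      unfolding p cramer_lemma[of k "\<chi> i j. ?N z i j" u, symmetric] by (simp only: vec_lambda_beta)
    also have "\<dots> = (z - 1) * poly q z"
      unfolding q mv by (rule det_scale_column)
    finally show "poly (smult (u $ k) (charpoly A)) z = poly ([:-1, 1:] * q) z" by (simp add: algebra_simps)
  qed
  moreover have q1: "poly q 1 \<noteq> 0"
  proof
    assume "poly q 1 = 0"
    then obtain x where x: "x \<noteq> 0" "(\<chi> i j. if j = k then u $ i else ?N 1 i j) *v x = 0"
      unfolding q det_eq_0_iff_ker by blast
    \<comment> \<open>Column k of the modified matrix is u, so a kernel vector x means
      \<open>x $ k *s u + (y - A *v y) = 0\<close> for y equal to x with entry k erased.\<close>
    define y where "y = (\<chi> j. if j = k then 0 else x $ j)"
    have "(x $ k *s u + (y - A *v y)) $ i = 0" for i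
    proof -
      have "0 = (\<Sum>j\<in>UNIV. (if j = k then u $ i else ?N 1 i j) * x $ j)"
        using x(2) by (simp add: vec_eq_iff matrix_vector_mult_def)
      also have "\<dots> = (\<Sum>j\<in>UNIV. (if j = k then x $ k * u $ i else 0) + (if j = i then y $ i else 0) - A $ i $ j * y $ j)"
        by (intro sum.cong) (auto simp: y_def algebra_simps)
      also have "\<dots> = (x $ k *s u + (y - A *v y)) $ i"
        by (simp add: sum.distrib sum_subtractf matrix_vector_mult_def)
      finally show ?thesis by simp
    qed
    then have eq: "x $ k *s u + (y - A *v y) = 0" by (simp add: vec_eq_iff)
    obtain c w where y: "y = c *s u + w" and w: "decays m A w" using split by blast
    have yAy: "y - A *v y = w - A *v w"
      by (simp add: y matrix_vector_right_distrib vector_scalar_commute fixed)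
    \<comment> \<open>A multiple of u is thereby decaying, so \<open>x $ k = 0\<close>; then w is
      fixed and decaying, hence 0, and y is a multiple of u whose k-th entry is 0.\<close>
    have "x $ k *s u = A *v w - w" using eq unfolding yAy by (simp add: algebra_simps eq_neg_iff_add_eq_0)
    then have "decays m A (x $ k *s u)" using w by (simp add: decays_diff decays_mult)
    then have xk: "x $ k = 0" by (rule not_decays_scale_u)
    then have "w = 0" using eq w decays_fixed[of w] unfolding yAy by simp
    moreover have "y $ k = 0" by (simp add: y_def)
    ultimately have "c * u $ k = 0" using arg_cong[OF y, of "\<lambda>v. v $ k"] by simp
    then have "y = 0" using k y \<open>w = 0\<close> by simp
    moreover have "x $ j = y $ j" for j using xk by (simp add: y_def)
    ultimately show False using x(1) by (simp add: vec_eq_iff)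
  qed
  then have "[:-1, 1::complex:] * q \<noteq> 0"
    by (metis mult_eq_0_iff pCons_eq_0_iff poly_0 zero_neq_one)
  ultimately have "order 1 (smult (u $ k) (charpoly A)) = order 1 [:-1, 1::complex:] + order 1 q"
    by (metis order_mult)
  then have "order 1 (charpoly A) = 1"
    using k q1 order_power_n_n[of "1 :: complex" 1] by (simp add: order_smult order_0I)
  then show ?thesis using eig by (simp add: simple_eigenvalue_def)
qed

text \<open>Invariance of r makes its value on all iterates of w constant, while even the rescaled
  values tend to 0.\<close>

lemma left_mult_decays:
  fixes r :: "complex^'r^1"
  assumes "r ** A = r" "decays m A w" shows "r *v w = 0"
proof (rule LIMSEQ_unique)
  have const: "r *v (((*v) A ^^ n) w) = r *v w" for n
    by (induction n) (simp_all add: matrix_vector_mul_assoc assms(1))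
  have "(\<lambda>n. r *v (2 ^ (m * n) *\<^sub>R ((*v) A ^^ n) w)) \<longlonglongrightarrow> r *v 0"
    using assms(2) by (intro matvec.tendsto tendsto_const) (simp add: decays_def)
  then have lim: "(\<lambda>n. 2 ^ (m * n) *\<^sub>R (r *v w)) \<longlonglongrightarrow> 0"
    by (simp add: matvec.scaleR_right const)
  show "(\<lambda>n. r *v w) \<longlonglongrightarrow> 0"
  proof (rule Lim_null_comparison[OF always_eventually tendsto_norm_zero[OF lim]], rule allI)
    fix n
    have "(1 :: real) \<le> 2 ^ (m * n)" by simp
    then show "norm (r *v w) \<le> norm ((2 :: real) ^ (m * n) *\<^sub>R (r *v w))"
      using mult_right_mono[of 1 "2 ^ (m * n)" "norm (r *v w)"] by simp
  qed
qed auto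

lemma left_eigenvector_unique:
  fixes r r' :: "complex^'r^1"
  assumes "r ** A = r" "r' ** A = r'" "r *v u = r' *v u"
  shows "r = r'"
proof -
  have "r *v v = r' *v v" for v
  proof -
    obtain c w where v: "v = c *s u + w" and w: "decays m A w" using split by blast
    show ?thesis
      using left_mult_decays[OF assms(1) w] left_mult_decays[OF assms(2) w] assms(3)
      by (simp add: v matrix_vector_right_distrib vector_scalar_commute)
  qed
  then show ?thesis by (simp add: matrix_eq)
qed

lemma left_eigenvector_exists:
  obtains r :: "complex^'r^1" where "r ** A = r" "(r *v u) $ 1 = 1"
proof -
  have "det (mat 1 - A) = 0"
    using fixed u_nonzero by (auto simp: det_eq_0_iff_ker matrix_vector_mult_diff_rdistrib)
  then obtain x where x: "x \<noteq> 0" "transpose (mat 1 - A) *v x = 0"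
    unfolding det_transpose[of "mat 1 - A", symmetric] det_eq_0_iff_ker by blast
  define r :: "complex^'r^1" where "r = (\<chi> i. x)"
  have "(r ** (mat 1 - A)) $ i $ j = (transpose (mat 1 - A) *v x) $ j" for i j
    by (simp add: r_def matrix_matrix_mult_def matrix_vector_mult_def transpose_def mult.commute)
  then have "r ** (mat 1 - A) = 0" using x(2) by (simp add: vec_eq_iff)
  then have rA: "r ** A = r" by (simp add: matmul.diff_right)
  \<comment> \<open>If it vanished, r and 0 would be fixed rows with the same value on u, so r = 0
    by uniqueness.\<close>
  have "(r *v u) $ 1 \<noteq> 0"
  proof
    assume "(r *v u) $ 1 = 0"
    then have "r *v u = 0 *v u" by (simp add: vec_eq_iff forall_1)
    then have "r = 0" using left_eigenvector_unique[OF rA, of 0] by simp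
    then show False using x(1) by (simp add: r_def vec_eq_iff)
  qed
  moreover have "cscale c r *v u = c *s (r *v u)" for c
    by (simp add: vec_eq_iff matrix_vector_mult_def sum_distrib_left mult.assoc)
  ultimately show ?thesis
    using rA by (intro that[of "cscale (1 / (r *v u) $ 1) r"]) (simp_all add: cscale_matrix_mult)
qed

end

section \<open>Jets of symbols and Fourier transforms\<close>

lemma mdeg_add: "mdeg (\<mu> + \<beta>) = mdeg \<mu> + mdeg \<beta>"
  by (simp add: mdeg_def sum.distrib)

lemma mdeg_axis: "mdeg (axis i 1) = 1"
  by (simp add: mdeg_def axis_def)

lemma mpow_add: "mpow x (\<mu> + \<beta>) = mpow x \<mu> * mpow x \<beta>"
  by (simp add: mpow_def power_add prod.distrib)

lemma mpow_axis: "mpow x (axis i 1) = x $ i"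
proof -
  have "(x $ j) ^ (axis i 1 $ j) = (if j = i then x $ i else 1)" for j
    by (simp add: axis_def)
  then show ?thesis by (simp add: mpow_def)
qed

lemma mpow_0 [simp]: "mpow x 0 = 1"
  by (simp add: mpow_def)

lemma mdeg_0 [simp]: "mdeg 0 = 0"
  by (simp add: mdeg_def)

lemma mfact_0 [simp]: "mfact 0 = 1"
  by (simp add: mfact_def)

lemma mpow_zero_left: "mpow 0 \<mu> = (if \<mu> = 0 then 1 else 0)"
  by (auto simp: mpow_def vec_eq_iff)

text \<open>The factor $(-ix)^\mu$ by which $\partial^\mu$ acts under the Fourier transform.\<close>

definition dweight :: "real^'d \<Rightarrow> nat^'d \<Rightarrow> complex" where
  "dweight x \<mu> = (- \<i>) ^ mdeg \<mu> * of_real (mpow x \<mu>)"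

lemma dweight_0 [simp]: "dweight x 0 = 1"
  by (simp add: dweight_def)

lemma dweight_Suc: "dweight x (\<mu> + axis i 1) = - \<i> * of_real (x $ i) * dweight x \<mu>"
  by (simp add: dweight_def mdeg_add mdeg_axis mpow_add mpow_axis power_add mult_ac del: One_nat_def)

lemma has_pderiv_symbol:
  assumes "finsupp u"
  shows "has_pderiv i (symbol u) (symbol (\<lambda>k. cscale (- \<i> * of_int (k $ i)) (u k)))"
proof -
  let ?K = "{k. u k \<noteq> 0}"
  have fin: "finite ?K" using assms by (simp add: finsupp_def)
  have "has_pderiv i (\<lambda>\<xi>. \<Sum>k\<in>?K. cscale (char_fun k \<xi>) (u k))
      (\<lambda>\<xi>. \<Sum>k\<in>?K. cscale (- \<i> * of_real (of_int_vec k $ i) * char_fun k \<xi>) (u k))"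
    by (intro has_pderiv_sum has_pderiv_bounded_linear[OF cscale.bounded_linear_left] has_pderiv_exp_inner)
  moreover have "symbol u = (\<lambda>\<xi>. \<Sum>k\<in>?K. cscale (char_fun k \<xi>) (u k))"
    using symbol_eq[OF assms] by blast
  \<comment> \<open>The new coefficients may vanish where \<open>k $ i = 0\<close>, so both symbols
    are summed over the support of u.\<close>
  moreover have "symbol (\<lambda>k. cscale (- \<i> * of_int (k $ i)) (u k)) =
      (\<lambda>\<xi>. \<Sum>k\<in>?K. cscale (- \<i> * of_real (of_int_vec k $ i) * char_fun k \<xi>) (u k))"
    using fin by (subst fun_eq_iff, intro allI, subst symbol_eq_sum[OF fin]) (auto simp: cscale_cscale mult_ac)
  ultimately show ?thesis by simp
qed

lemma finsupp_cscale: "finsupp u \<Longrightarrow> finsupp (\<lambda>k. cscale (c k) (u k))"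
  unfolding finsupp_def by (rule finite_subset[rotated]) auto

lemma smooth_symbol:
  assumes "finsupp u" shows "smooth (symbol u)"
proof (rule smooth_coinduct[where P = "\<lambda>f. \<exists>u. finsupp u \<and> f = symbol u"])
  show "continuous_on UNIV f" if f: "\<exists>u. finsupp u \<and> f = symbol u" for f :: "real^'a \<Rightarrow> complex^'b^'c"
  proof -
    obtain u where u: "finsupp u" "f = symbol u" using f by blast
    have "f = (\<lambda>\<xi>. \<Sum>k | u k \<noteq> 0. cscale (char_fun k \<xi>) (u k))"
      using symbol_eq[OF u(1)] u(2) by blast
    then show ?thesis by (auto intro!: continuous_intros cscale.continuous_on)
  qed
  show "\<exists>f'. (\<exists>u. finsupp u \<and> f' = symbol u) \<and> has_pderiv i f f'"
    if f: "\<exists>u. finsupp u \<and> f = symbol u" for f :: "real^'a \<Rightarrow> complex^'b^'c" and i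
  proof -
    obtain u where u: "finsupp u" "f = symbol u" using f by blast
    show ?thesis
      unfolding u(2) by (intro exI conjI, rule finsupp_cscale[OF u(1)], rule refl, rule has_pderiv_symbol[OF u(1)])
  qed
qed (use assms in auto)

lemma mpartial_symbol:
  fixes u :: "int^'d::{finite,linorder} \<Rightarrow> complex^'r^'s"
  assumes "finsupp u"
  shows "mpartial \<mu> (symbol u) = symbol (\<lambda>k. cscale (dweight (of_int_vec k) \<mu>) (u k))"
proof -
  let ?F = "\<lambda>\<mu>. symbol (\<lambda>k. cscale (dweight (of_int_vec k) \<mu>) (u k))"
  have "pderiv_dir i (?F \<mu>) = ?F (\<mu> + axis i 1)" for i \<mu>
    using pderiv_dir_eqI[OF has_pderiv_symbol[OF finsupp_cscale[OF assms]], of i "\<lambda>k. dweight (of_int_vec k) \<mu>"]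
    by (simp add: cscale_cscale dweight_Suc del: One_nat_def)
  from mpartial_family[of ?F, OF this] show ?thesis by simp
qed

lemma has_pderiv_vec:
  fixes f :: "real^'d \<Rightarrow> complex^'r"
  assumes "\<And>j. has_pderiv i (\<lambda>x. f x $ j) (\<lambda>x. f' x $ j)"
  shows "has_pderiv i f f'"
proof -
  have ax: "v = (\<Sum>j\<in>UNIV. axis j (v $ j))" for v :: "complex^'r"
    by (simp add: vec_eq_iff axis_def)
  have bl: "bounded_linear (axis j :: complex \<Rightarrow> complex^'r)" for j
    by (intro linear_conv_bounded_linear[THEN iffD1] linearI) (auto simp: vec_eq_iff axis_def)
  have "has_pderiv i (\<lambda>x. \<Sum>j\<in>UNIV. axis j (f x $ j)) (\<lambda>x. \<Sum>j\<in>UNIV. axis j (f' x $ j))"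
    by (intro has_pderiv_sum has_pderiv_bounded_linear[OF bl] assms)
  then show ?thesis unfolding ax[symmetric] .
qed

lemma has_pderiv_fourier:
  assumes "\<And>j. compsupp (\<lambda>x. f x $ j)"
  shows "has_pderiv i (fourier f) (fourier (\<lambda>x. (- \<i> * of_real (x $ i)) *s f x))"
  using has_pderiv_ft[OF assms] by (intro has_pderiv_vec) (simp add: fourier_nth)

lemma compsupp_scale:
  assumes "\<And>j. compsupp (\<lambda>x. f x $ j)" "continuous_on UNIV g"
  shows "compsupp (\<lambda>x. (g x *s f x) $ j)"
  using compsupp_mult[OF assms(1)[of j] assms(2)] by simp

lemma smooth_fourier:
  fixes f :: "real^'d \<Rightarrow> complex^'r"
  assumes "\<And>j. compsupp (\<lambda>x. f x $ j)" shows "smooth (fourier f)"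
proof (rule smooth_coinduct[where P = "\<lambda>g. \<exists>f. (\<forall>j. compsupp (\<lambda>x. f x $ j)) \<and> g = fourier f"])
  fix g :: "real^'d \<Rightarrow> complex^'r" and i
  assume "\<exists>f. (\<forall>j. compsupp (\<lambda>x. f x $ j)) \<and> g = fourier f"
  then obtain f where f: "\<And>j. compsupp (\<lambda>x. f x $ j)" "g = fourier f" by blast
  let ?g = "\<lambda>x. (- \<i> * of_real (x $ i)) *s f x"
  have "\<forall>j. compsupp (\<lambda>x. ?g x $ j)"
    using f by (intro allI compsupp_scale) (auto intro!: continuous_intros)
  then have "\<exists>f. (\<forall>j. compsupp (\<lambda>x. f x $ j)) \<and> fourier ?g = fourier f"
    by (rule exI[of _ ?g, OF conjI]) (rule refl)
  moreover have "has_pderiv i g (fourier ?g)"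
    unfolding f(2) by (rule has_pderiv_fourier[OF f(1)])
  ultimately show "\<exists>g'. (\<exists>f. (\<forall>j. compsupp (\<lambda>x. f x $ j)) \<and> g' = fourier f) \<and> has_pderiv i g g'"
    by (rule exI[of _ "fourier ?g", OF conjI])
next
  fix g :: "real^'d \<Rightarrow> complex^'r"
  assume "\<exists>f. (\<forall>j. compsupp (\<lambda>x. f x $ j)) \<and> g = fourier f"
  then obtain f where f: "\<And>j. compsupp (\<lambda>x. f x $ j)" "g = fourier f" by blast
  have "continuous_on UNIV (\<lambda>\<xi>. fourier f \<xi> $ j)" for j
    unfolding fourier_nth by (rule continuous_ft[OF f(1)])
  then have "continuous_on UNIV (\<lambda>\<xi>. \<chi> j. fourier f \<xi> $ j)"
    by (rule continuous_on_vec_lambda)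
  then show "continuous_on UNIV g" by (simp add: f(2))
qed (use assms in blast)

lemma mpartial_fourier:
  fixes f :: "real^'d::{finite,linorder} \<Rightarrow> complex^'r"
  assumes "\<And>j. compsupp (\<lambda>x. f x $ j)"
  shows "mpartial \<mu> (fourier f) = fourier (\<lambda>x. dweight x \<mu> *s f x)"
proof -
  let ?F = "\<lambda>\<mu>. fourier (\<lambda>x. dweight x \<mu> *s f x)"
  have "continuous_on UNIV (\<lambda>x :: real^'d::{finite,linorder}. dweight x \<mu>)" for \<mu>
    unfolding dweight_def mpow_def by (intro continuous_intros)
  then have "compsupp (\<lambda>x. (dweight x \<mu> *s f x) $ j)" for j \<mu>
    using assms by (intro compsupp_scale)
  then have "pderiv_dir i (?F \<mu>) = ?F (\<mu> + axis i 1)" for i \<mu>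
    using pderiv_dir_eqI[OF has_pderiv_fourier, of "\<lambda>x. dweight x \<mu> *s f x" i]
    by (simp add: vector_smult_assoc dweight_Suc del: One_nat_def)
  from mpartial_family[of ?F, OF this] show ?thesis by simp
qed

text \<open>With the factorial built in, differentiation is a pure shift of the index and the
  binomial theorem has no coefficients.\<close>

definition monom_fun :: "nat^'d \<Rightarrow> real^'d \<Rightarrow> complex" where
  "monom_fun \<mu> x = of_real (mpow x \<mu> / mfact \<mu>)"

lemma monom_fun_split:
  fixes x :: "real^'d"
  shows "monom_fun \<mu> x = of_real ((x $ i) ^ (\<mu> $ i) / fact (\<mu> $ i)) *
    of_real (\<Prod>j\<in>UNIV - {i}. (x $ j) ^ (\<mu> $ j) / fact (\<mu> $ j))"
  unfolding monom_fun_def mpow_def mfact_def prod_dividef [symmetric]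
  by (subst prod.remove[of UNIV i]) auto

lemma has_pderiv_monom_fun:
  fixes \<mu> :: "nat^'d"
  shows "has_pderiv i (monom_fun \<mu>) (if \<mu> $ i = 0 then (\<lambda>x. 0) else monom_fun (\<mu> - axis i 1))"
  unfolding has_pderiv_def
proof
  fix x :: "real^'d"
  let ?c = "complex_of_real (\<Prod>j\<in>UNIV - {i}. (x $ j) ^ (\<mu> $ j) / fact (\<mu> $ j))"
  have eq: "monom_fun \<mu> (x + t *\<^sub>R axis i 1) = of_real ((x $ i + t) ^ (\<mu> $ i) / fact (\<mu> $ i)) * ?c" for t
  proof -
    have "(\<Prod>j\<in>UNIV - {i}. ((x + t *\<^sub>R axis i 1) $ j) ^ (\<mu> $ j) / fact (\<mu> $ j)) =
        (\<Prod>j\<in>UNIV - {i}. (x $ j) ^ (\<mu> $ j) / fact (\<mu> $ j))"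
      by (intro prod.cong) (auto simp: axis_def)
    then show ?thesis unfolding monom_fun_split[of _ _ i] by (simp add: axis_def)
  qed
  have D: "((\<lambda>t. (x $ i + t) ^ (\<mu> $ i) / fact (\<mu> $ i)) has_real_derivative
      real (\<mu> $ i) * (x $ i) ^ (\<mu> $ i - 1) / fact (\<mu> $ i)) (at 0)"
    by (auto intro!: derivative_eq_intros)
  have "((\<lambda>t. monom_fun \<mu> (x + t *\<^sub>R axis i 1)) has_vector_derivative
      of_real (real (\<mu> $ i) * (x $ i) ^ (\<mu> $ i - 1) / fact (\<mu> $ i)) * ?c) (at 0)"
    unfolding eq by (intro has_vector_derivative_mult_left has_vector_derivative_of_real) (rule D)
  moreover have "of_real (real (\<mu> $ i) * (x $ i) ^ (\<mu> $ i - 1) / fact (\<mu> $ i)) * ?c =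
      (if \<mu> $ i = 0 then (\<lambda>x. 0) else monom_fun (\<mu> - axis i 1)) x"
  proof (cases "\<mu> $ i")
    case (Suc n)
    have "(\<Prod>j\<in>UNIV - {i}. (x $ j) ^ ((\<mu> - axis i 1) $ j) / fact ((\<mu> - axis i 1) $ j)) =
        (\<Prod>j\<in>UNIV - {i}. (x $ j) ^ (\<mu> $ j) / fact (\<mu> $ j))"
      by (intro prod.cong) (auto simp: axis_def)
    then show ?thesis
      unfolding monom_fun_split[of _ _ i] by (simp add: Suc axis_def field_simps del: of_nat_Suc)
  qed simp
  ultimately show "((\<lambda>t. monom_fun \<mu> (x + t *\<^sub>R axis i 1)) has_vector_derivative
      (if \<mu> $ i = 0 then (\<lambda>x. 0) else monom_fun (\<mu> - axis i 1)) x) (at 0)"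
    by simp
qed

lemma continuous_monom_fun: "continuous_on UNIV (monom_fun \<mu>)"
  unfolding monom_fun_def [abs_def] mpow_def by (intro continuous_intros) auto

lemma smooth_monom_fun: "smooth (monom_fun \<mu> :: real^'d \<Rightarrow> complex)"
proof (rule smooth_coinduct[where P = "\<lambda>f. f = (\<lambda>x. 0) \<or> (\<exists>\<mu>. f = monom_fun \<mu>)"])
  fix f :: "real^'d \<Rightarrow> complex" and i
  assume f: "f = (\<lambda>x. 0) \<or> (\<exists>\<mu>. f = monom_fun \<mu>)"
  then show "continuous_on UNIV f" using continuous_monom_fun by auto
  from f show "\<exists>f'. (f' = (\<lambda>x. 0) \<or> (\<exists>\<mu>. f' = monom_fun \<mu>)) \<and> has_pderiv i f f'"
    using has_pderiv_const has_pderiv_monom_fun by metis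
qed blast

lemma mpartial_monom_fun:
  fixes \<mu> \<nu> :: "nat^'d::{finite,linorder}"
  shows "mpartial \<mu> (monom_fun \<nu>) = (if \<mu> \<le> \<nu> then monom_fun (\<nu> - \<mu>) else (\<lambda>x. 0))"
proof -
  let ?F = "\<lambda>\<mu>. if \<mu> \<le> \<nu> then monom_fun (\<nu> - \<mu>) else (\<lambda>x. 0)"
  have "pderiv_dir i (?F \<mu>) = ?F (\<mu> + axis i 1)" for i \<mu>
  proof -
    \<comment> \<open>Subtraction of multi-indices truncates at 0, so the case of a vanishing
      derivative must be separated before the index is lowered.\<close>
    have le: "\<mu> + axis i 1 \<le> \<nu> \<longleftrightarrow> \<mu> \<le> \<nu> \<and> (\<nu> - \<mu>) $ i \<noteq> 0"
    proof
      assume *: "\<mu> + axis i 1 \<le> \<nu>"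
      have "\<mu> $ j \<le> \<nu> $ j" for j using spec[OF *[unfolded less_eq_vec_def], of j] by simp
      then show "\<mu> \<le> \<nu> \<and> (\<nu> - \<mu>) $ i \<noteq> 0"
        using spec[OF *[unfolded less_eq_vec_def], of i] by (auto simp: less_eq_vec_def axis_def)
    qed (auto simp: less_eq_vec_def axis_def)
    have "\<nu> - \<mu> - axis i 1 = \<nu> - (\<mu> + axis i 1)" by (simp add: vec_eq_iff)
    then show ?thesis
      using pderiv_dir_eqI[OF has_pderiv_monom_fun, of i "\<nu> - \<mu>"]
        pderiv_dir_eqI[OF has_pderiv_const, of i "0 :: complex"]
      by (auto simp: le simp del: One_nat_def)
  qed
  from mpartial_family[of ?F, OF this] show ?thesis by (simp add: less_eq_vec_def)
qed

lemma mpartial_monom_fun_0: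
  "mpartial \<mu> (monom_fun \<nu>) 0 = (if \<mu> = \<nu> then 1 else 0)"
proof -
  have "\<mu> \<le> \<nu> \<Longrightarrow> \<nu> - \<mu> = 0 \<longleftrightarrow> \<mu> = \<nu>"
    by (auto simp: less_eq_vec_def vec_eq_iff) (metis le_antisym)
  then show ?thesis
    by (auto simp: mpartial_monom_fun monom_fun_def mpow_zero_left less_eq_vec_def)
qed

section \<open>Strang-Fix conditions from the spanning property\<close>

lemma sum_le_split:
  fixes f :: "nat^'d \<Rightarrow> 'b::comm_monoid_add"
  shows "(\<Sum>\<beta> | \<beta> \<le> \<mu>. f \<beta>) = f \<mu> + (\<Sum>\<beta> | \<beta> \<le> \<mu> \<and> \<beta> \<noteq> \<mu>. f \<beta>)"
proof -
  have "{\<beta>. \<beta> \<le> \<mu>} - {\<mu>} = {\<beta>. \<beta> \<le> \<mu> \<and> \<beta> \<noteq> \<mu>}" by auto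
  then show ?thesis
    using sum.remove[OF finite_le_multiindex, of \<mu> \<mu> f] by (simp add: less_eq_vec_def)
qed

lemma smooth_dilate: "smooth f \<Longrightarrow> smooth (\<lambda>x. f (c *\<^sub>R x))"
  using smooth_affine[of f c 0] by simp

lemma smooth_translate: "smooth f \<Longrightarrow> smooth (\<lambda>x. f (x + b))"
  using smooth_affine[of f 1 b] by simp

lemma mpartial_zero: "mpartial \<mu> (\<lambda>x. 0) = (\<lambda>x. 0)"
  using mpartial_bounded_linear[OF bounded_linear_zero smooth_const] by blast

lemma mpartial_const_0:
  fixes c :: complex
  shows "mpartial \<mu> (\<lambda>x. c) 0 = (if \<mu> = 0 then c else 0)"
proof -
  have "mpartial \<mu> (\<lambda>x. monom_fun 0 x * c) 0 = mpartial \<mu> (monom_fun 0) 0 * c"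
    by (simp only: mpartial_bounded_linear[OF bounded_linear_mult_left smooth_monom_fun])
  then show ?thesis by (cases "\<mu> = 0") (simp_all add: mpartial_monom_fun_0 mpartial_0 monom_fun_def)
qed

lemma (in bounded_bilinear) mpartial_prod_cong:
  assumes "smooth f" "smooth f'" "smooth g"
    and "\<And>\<beta>. \<beta> \<le> \<mu> \<Longrightarrow> mpartial \<beta> f x = mpartial \<beta> f' x"
  shows "mpartial \<mu> (\<lambda>x. prod (f x) (g x)) x = mpartial \<mu> (\<lambda>x. prod (f' x) (g x)) x"
  using assms by (simp add: mpartial_prod)

lemma matrix_eq_0_on_span:
  fixes M :: "complex^'r^'s"
  assumes "\<And>v. v \<in> S \<Longrightarrow> M *v v = 0" "vec.span S = UNIV"
  shows "M = 0"
proof -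
  have "vec.subspace {v. M *v v = 0}"
    by (rule vec.subspaceI) (auto simp: matrix_vector_right_distrib vector_scalar_commute)
  then have "vec.span S \<subseteq> {v. M *v v = 0}" using assms(1) by (intro vec.span_minimal) auto
  then have "M *v v = 0 *v v" for v using assms(2) by auto
  then show ?thesis using matrix_eq[of M 0] by blast
qed

lemma char_fun_periodic: "char_fun j (\<xi> + (2 * pi) *\<^sub>R of_int_vec k) = char_fun j \<xi>"
proof -
  define N where "N = (\<Sum>i\<in>UNIV. j $ i * k $ i)"
  have "of_int_vec j \<bullet> of_int_vec k = real_of_int N"
    by (simp add: inner_vec_def N_def)
  then have "- \<i> * of_real (of_int_vec j \<bullet> (\<xi> + (2 * pi) *\<^sub>R of_int_vec k)) =
      - \<i> * of_real (of_int_vec j \<bullet> \<xi>) + \<i> * (of_int (- N) * (of_real pi * 2))"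
    by (simp add: inner_add_right algebra_simps)
  moreover have "exp (\<i> * (of_int (- N) * (of_real pi * 2))) = 1"
    by (rule exp_2pi_1_int)
  ultimately show ?thesis by (simp only: exp_add mult_1_right)
qed

lemma symbol_periodic: "symbol u (\<xi> + (2 * pi) *\<^sub>R of_int_vec k) = symbol u \<xi>"
  unfolding symbol_def char_fun_periodic ..

text \<open>Left-hand side of both kinds of sum rules: \<open>c = 0\<close> for the first,
  \<open>c = pi *\<^sub>R of_int_vec \<omega>\<close> for the second.\<close>

definition two_scale ::
  "(int^'d \<Rightarrow> complex^'r^1) \<Rightarrow> (int^'d \<Rightarrow> complex^'r^'r) \<Rightarrow> real^'d \<Rightarrow> real^'d \<Rightarrow> complex^'r^1" where
  "two_scale \<upsilon> a c \<xi> = symbol \<upsilon> (2 *\<^sub>R \<xi>) ** symbol a (\<xi> + c)"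

lemma smooth_two_scale: "finsupp \<upsilon> \<Longrightarrow> finsupp a \<Longrightarrow> smooth (two_scale \<upsilon> a c)"
  unfolding two_scale_def [abs_def]
  by (intro matmul.smooth_prod smooth_dilate smooth_translate smooth_symbol)

lemma mpartial_two_scale_0:
  fixes a :: "int^'d::{finite,linorder} \<Rightarrow> complex^'r^'r"
  assumes "finsupp \<upsilon>" "finsupp a"
  shows "mpartial \<mu> (two_scale \<upsilon> a 0) 0 = (\<Sum>\<beta> | \<beta> \<le> \<mu>. (2 ^ mdeg \<beta> * mchoose \<mu> \<beta>) *\<^sub>R
    (mpartial \<beta> (symbol \<upsilon>) 0 ** mpartial (\<mu> - \<beta>) (symbol a) 0))"
proof -
  have "two_scale \<upsilon> a 0 = (\<lambda>\<xi>. symbol \<upsilon> (2 *\<^sub>R \<xi>) ** symbol a \<xi>)"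
    by (simp add: two_scale_def fun_eq_iff)
  then show ?thesis
    using assms
    by (simp add: matmul.mpartial_prod smooth_dilate smooth_symbol mpartial_dilate matmul.scaleR_left mult.commute)
qed

text \<open>In the Leibniz expansion at 0 the term \<beta> = \<mu> is 2^|\<mu>| times the unknown
  jet times \<open>symbol a 0\<close>. Moving it to the other side and inverting turns the first sum
  rule at order \<mu> into (B).\<close>

lemma jet_recursion:
  fixes a :: "int^'d::{finite,linorder} \<Rightarrow> complex^'r^'r"
  assumes \<upsilon>: "finsupp \<upsilon>" and a: "finsupp a"
    and inv: "invertible (mat 1 - 2 ^ mdeg \<mu> *\<^sub>R symbol a 0)"
  shows "mpartial \<mu> (two_scale \<upsilon> a 0) 0 = mpartial \<mu> (symbol \<upsilon>) 0 \<longleftrightarrow>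
    mpartial \<mu> (symbol \<upsilon>) 0 = (\<Sum>\<beta> | \<beta> \<le> \<mu> \<and> \<beta> \<noteq> \<mu>.
           (2 ^ mdeg \<beta> * mfact \<mu> / (mfact \<beta> * mfact (\<mu> - \<beta>))) *\<^sub>R
           (mpartial \<beta> (symbol \<upsilon>) 0 ** mpartial (\<mu> - \<beta>) (symbol a) 0
              ** matrix_inv (mat 1 - 2 ^ mdeg \<mu> *\<^sub>R symbol a 0)))"
    (is "?h = ?v \<longleftrightarrow> ?v = ?sum")
proof -
  let ?N = "mat 1 - 2 ^ mdeg \<mu> *\<^sub>R symbol a 0"
  define S where "S = (\<Sum>\<beta> | \<beta> \<le> \<mu> \<and> \<beta> \<noteq> \<mu>. (2 ^ mdeg \<beta> * mchoose \<mu> \<beta>) *\<^sub>R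
    (mpartial \<beta> (symbol \<upsilon>) 0 ** mpartial (\<mu> - \<beta>) (symbol a) 0))"
  have "?sum = S ** matrix_inv ?N"
    unfolding S_def matmul.sum_left matmul.scaleR_left
    by (intro sum.cong refl) (simp add: mchoose_eq)
  moreover have "?h = 2 ^ mdeg \<mu> *\<^sub>R (?v ** symbol a 0) + S"
    unfolding mpartial_two_scale_0[OF \<upsilon> a] sum_le_split S_def by (simp add: mpartial_0)
  moreover have "?v ** ?N = ?v - 2 ^ mdeg \<mu> *\<^sub>R (?v ** symbol a 0)"
    by (simp add: matmul.diff_right matmul.scaleR_right)
  moreover have "?v ** ?N = S \<longleftrightarrow> ?v = S ** matrix_inv ?N"
  proof
    assume "?v ** ?N = S"
    then have "S ** matrix_inv ?N = ?v ** (?N ** matrix_inv ?N)" by (simp only: matrix_mul_assoc)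
    then show "?v = S ** matrix_inv ?N" by (simp add: matrix_inv[OF inv])
  next
    assume "?v = S ** matrix_inv ?N"
    then have "?v ** ?N = S ** (matrix_inv ?N ** ?N)" by (simp only: matrix_mul_assoc)
    then show "?v ** ?N = S" by (simp add: matrix_inv[OF inv])
  qed
  moreover have "X + S = v \<longleftrightarrow> v - X = S" for X v :: "complex^'r^1"
    by (auto simp: algebra_simps)
  ultimately show ?thesis by simp
qed

section \<open>Lattice values and dilates of the Fourier transform\<close>

context hermite_scheme
begin

abbreviation "A \<equiv> symbol a 0"

lemma smooth_fourier_\<phi>: "smooth (fourier \<phi>)"
  by (rule smooth_fourier) (rule compsupp_\<phi>)

text \<open>All dilates of a lattice point by powers of 2 are lattice points, where the periodic
  symbol takes its value at 0.\<close>

lemma fourier_\<phi>_power: "((*v) A ^^ n) (fourier \<phi> ((2 * pi) *\<^sub>R of_int_vec k)) =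
    fourier \<phi> (2 ^ n *\<^sub>R ((2 * pi) *\<^sub>R of_int_vec k))"
proof (induction n)
  case (Suc n)
  have "2 ^ n *\<^sub>R ((2 * pi) *\<^sub>R of_int_vec k) = 0 + (2 * pi) *\<^sub>R of_int_vec (2 ^ n *s k)"
    by (simp add: of_int_vec_smult mult_ac)
  then have "symbol a (2 ^ n *\<^sub>R ((2 * pi) *\<^sub>R of_int_vec k)) = A"
    by (simp only: symbol_periodic)
  then show ?case
    using refinement[of "2 ^ n *\<^sub>R ((2 * pi) *\<^sub>R of_int_vec k)"] Suc by simp
qed simp

text \<open>A jet of the transform is the transform of a polynomial multiple of \<phi>, which is
  again C^m with compact support.\<close>

lemma fourier_jet_decay:
  assumes "\<xi> \<noteq> 0"
  shows "(\<lambda>n. 2 ^ (m * n) *\<^sub>R mpartial \<beta> (fourier \<phi>) (2 ^ n *\<^sub>R \<xi>)) \<longlonglongrightarrow> 0"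
proof (rule vec_tendstoI)
  fix l
  let ?f = "\<lambda>x. dweight x \<beta> * \<phi> x $ l"
  have eq: "(\<lambda>x. dweight x \<beta>) = (\<lambda>x. (- \<i>) ^ mdeg \<beta> * of_real (mfact \<beta>) * monom_fun \<beta> x)"
    by (simp add: fun_eq_iff dweight_def monom_fun_def)
  have sm: "smooth (\<lambda>x. dweight x \<beta>)"
    unfolding eq by (rule smooth_bounded_linear[OF bounded_linear_mult_right smooth_monom_fun])
  have "C_class m ?f"
    using sm C_class_\<phi> unfolding smooth_def
    by (intro bounded_bilinear.C_class_prod[OF bounded_bilinear_mult]) auto
  moreover have "compsupp ?f"
    by (rule compsupp_mult[OF compsupp_\<phi> smooth_continuous[OF sm]])
  ultimately have "(\<lambda>n. 2 ^ (m * n) * ft ?f (2 ^ n *\<^sub>R \<xi>)) \<longlonglongrightarrow> 0"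
    using assms by (intro ft_decay)
  then show "(\<lambda>n. (2 ^ (m * n) *\<^sub>R mpartial \<beta> (fourier \<phi>) (2 ^ n *\<^sub>R \<xi>)) $ l) \<longlonglongrightarrow> 0 $ l"
    by (simp add: mpartial_fourier[OF compsupp_\<phi>] fourier_nth scaleR_conv_of_real[where 'a = complex])
qed

lemma lattice_nonzero: "k \<noteq> 0 \<Longrightarrow> (2 * pi) *\<^sub>R of_int_vec k \<noteq> 0"
  by (auto simp: vec_eq_iff)

lemma decays_lattice:
  assumes "k \<noteq> 0" shows "decays m A (fourier \<phi> ((2 * pi) *\<^sub>R of_int_vec k))"
  using fourier_jet_decay[OF lattice_nonzero[OF assms], of 0]
  by (simp only: decays_def fourier_\<phi>_power mpartial_0)

lemma fixed_vector: "A *v fourier \<phi> 0 = fourier \<phi> 0"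
  using refinement[of 0] by simp

text \<open>Each product is continuous in \<xi> and acts at 0 as the n-th power of \<open>A\<close>,
  so smallness of that power extends to a neighbourhood of 0.\<close>

primrec iterated_symbol :: "nat \<Rightarrow> real^'d::{finite,linorder} \<Rightarrow> complex^'r::{finite,linorder}^'r::{finite,linorder}" where
  "iterated_symbol 0 \<xi> = mat 1"
| "iterated_symbol (Suc n) \<xi> = symbol a (2 ^ n *\<^sub>R \<xi>) ** iterated_symbol n \<xi>"

lemma fourier_\<phi>_iterated: "fourier \<phi> (2 ^ n *\<^sub>R \<xi>) = iterated_symbol n \<xi> *v fourier \<phi> \<xi>"
proof (induction n)
  case (Suc n)
  then show ?case using refinement[of "2 ^ n *\<^sub>R \<xi>"] by (simp add: matrix_vector_mul_assoc)
qed simp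

lemma continuous_iterated_symbol: "continuous_on UNIV (iterated_symbol n)"
proof (induction n)
  case (Suc n)
  moreover have "continuous_on UNIV (\<lambda>\<xi>. symbol a (2 ^ n *\<^sub>R \<xi>))"
    by (intro smooth_continuous smooth_dilate smooth_symbol a)
  ultimately show ?case using matmul.continuous_on by auto
qed simp

lemma iterated_symbol_0: "iterated_symbol n 0 *v v = ((*v) A ^^ n) v"
  by (induction n) (simp_all add: matrix_vector_mul_assoc[symmetric])

text \<open>If all powers of \<open>A\<close> tend to zero, then near the origin $\widehat\phi$ is bounded by
  half of its own bound, hence vanishes.\<close>

lemma fourier_\<phi>_eq_0:
  assumes "\<And>v. decays m A v"
  shows "fourier \<phi> \<xi> = 0"
proof -
  let ?r = "real CARD('r)"
  have r: "?r > 0" by simp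
  \<comment> \<open>A matrix with r columns and entries below 1/(2r) at most halves the largest
    entry of a vector.\<close>
  have ev: "\<forall>\<^sub>F n in sequentially. \<forall>i j. cmod (iterated_symbol n 0 $ i $ j) < 1 / (2 * ?r)"
  proof -
    have "\<forall>\<^sub>F n in sequentially. cmod (iterated_symbol n 0 $ i $ j) < 1 / (2 * ?r)" for i j
    proof -
      let ?v = "\<lambda>n. ((*v) A ^^ n) (axis j 1)"
      have "(\<lambda>n. norm ((2 ^ (m * n) *\<^sub>R ?v n) $ i)) \<longlonglongrightarrow> norm ((0 :: complex^'r::{finite,linorder}) $ i)"
        using assms[of "axis j 1"] by (intro tendsto_norm tendsto_vec_nth) (simp add: decays_def)
      then have "\<forall>\<^sub>F n in sequentially. norm ((2 ^ (m * n) *\<^sub>R ?v n) $ i) < 1 / (2 * ?r)"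
        by (rule order_tendstoD) (use r in simp)
      then show ?thesis
      proof eventually_elim
        case (elim n)
        have "norm (?v n $ i) \<le> norm ((2 ^ (m * n) *\<^sub>R ?v n) $ i)"
          using mult_right_mono[of 1 "2 ^ (m * n)" "norm (?v n $ i)"] by simp
        moreover have "?v n $ i = iterated_symbol n 0 $ i $ j"
          by (simp add: iterated_symbol_0[symmetric] mult_axis_nth)
        ultimately show ?case using elim by simp
      qed
    qed
    then show ?thesis by (simp add: eventually_all_finite)
  qed
  then obtain N where N: "\<And>i j. cmod (iterated_symbol N 0 $ i $ j) < 1 / (2 * ?r)"
    by (auto simp: eventually_sequentially)
  have "\<forall>\<^sub>F \<xi> in nhds 0. \<forall>i j. cmod (iterated_symbol N \<xi> $ i $ j) < 1 / (2 * ?r)"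
  proof -
    have "\<forall>\<^sub>F \<xi> in nhds 0. cmod (iterated_symbol N \<xi> $ i $ j) < 1 / (2 * ?r)" for i j
    proof -
      have "isCont (iterated_symbol N) 0"
        using continuous_iterated_symbol by (simp add: continuous_on_eq_continuous_at)
      then have "(iterated_symbol N \<longlongrightarrow> iterated_symbol N 0) (nhds 0)"
        by (simp add: continuous_at tendsto_at_iff_tendsto_nhds)
      then have "((\<lambda>\<xi>. cmod (iterated_symbol N \<xi> $ i $ j)) \<longlongrightarrow> cmod (iterated_symbol N 0 $ i $ j)) (nhds 0)"
        by (intro tendsto_norm tendsto_vec_nth)
      then show ?thesis using N by (rule order_tendstoD)
    qed
    then show ?thesis by (simp add: eventually_all_finite)
  qed
  then obtain \<delta> where \<delta>: "\<delta> > 0"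
    "\<And>\<xi> i j. norm \<xi> < \<delta> \<Longrightarrow> cmod (iterated_symbol N \<xi> $ i $ j) < 1 / (2 * ?r)"
    unfolding eventually_nhds_metric by (auto simp: dist_norm)
  define C where "C = (\<Sum>l\<in>UNIV. LINT x|lborel. norm (\<phi> x $ l))"
  have C: "cmod (fourier \<phi> \<xi> $ l) \<le> C" for \<xi> l
  proof -
    have "cmod (fourier \<phi> \<xi> $ l) \<le> (LINT x|lborel. norm (\<phi> x $ l))"
      unfolding fourier_nth by (rule ft_bound[OF compsupp_\<phi>])
    also have "\<dots> \<le> C" unfolding C_def by (intro member_le_sum) auto
    finally show ?thesis .
  qed
  have bound: "cmod (fourier \<phi> \<xi> $ i) \<le> (1 / 2) ^ n * C" if "norm \<xi> < \<delta>" for n \<xi> i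
    using that
  proof (induction n arbitrary: \<xi> i)
    case 0
    then show ?case using C by simp
  next
    case (Suc n)
    \<comment> \<open>The induction hypothesis is used at this point, which stays in the ball; N
      refinement steps lead back to \<xi> and halve the bound.\<close>
    let ?\<xi> = "(1 / 2) ^ N *\<^sub>R \<xi>"
    have "(1 / 2 :: real) ^ N \<le> 1" by (intro power_le_one) auto
    then have "norm ?\<xi> \<le> norm \<xi>" by (simp add: mult_left_le_one_le)
    then have small: "norm ?\<xi> < \<delta>" using Suc.prems by simp
    have "fourier \<phi> \<xi> = iterated_symbol N ?\<xi> *v fourier \<phi> ?\<xi>"
      using fourier_\<phi>_iterated[of N ?\<xi>] by (simp add: power_divide)
    then have "cmod (fourier \<phi> \<xi> $ i) = cmod (\<Sum>j\<in>UNIV. iterated_symbol N ?\<xi> $ i $ j * fourier \<phi> ?\<xi> $ j)"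
      by (simp add: matrix_vector_mult_def)
    also have "\<dots> \<le> (\<Sum>j\<in>(UNIV :: 'r set). 1 / (2 * ?r) * ((1 / 2) ^ n * C))"
    proof (rule sum_norm_le)
      fix j
      show "cmod (iterated_symbol N ?\<xi> $ i $ j * fourier \<phi> ?\<xi> $ j) \<le> 1 / (2 * ?r) * ((1 / 2) ^ n * C)"
        unfolding norm_mult using \<delta>(2)[OF small, of i j] Suc.IH[OF small, of j]
        by (intro mult_mono) auto
    qed
    also have "\<dots> = (1 / 2) ^ Suc n * C" by simp
    finally show ?case .
  qed
  have near: "fourier \<phi> \<xi> = 0" if "norm \<xi> < \<delta>" for \<xi>
  proof -
    have "cmod (fourier \<phi> \<xi> $ i) \<le> 0" for i
    proof (rule LIMSEQ_le_const)
      show "(\<lambda>n. (1 / 2) ^ n * C) \<longlonglongrightarrow> 0"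
        using tendsto_mult[OF half_power_tendsto_0 tendsto_const] by simp
    qed (use bound[OF that] in blast)
    then show ?thesis by (simp add: vec_eq_iff)
  qed
  \<comment> \<open>An arbitrary point is scaled into the ball, and the refinement equation carries
    the zero back.\<close>
  have "(\<lambda>n. (1 / 2) ^ n * norm \<xi>) \<longlonglongrightarrow> 0 * norm \<xi>"
    by (intro tendsto_mult half_power_tendsto_0 tendsto_const)
  then have "\<forall>\<^sub>F n in sequentially. (1 / 2) ^ n * norm \<xi> < \<delta>"
    using \<delta>(1) by (intro order_tendstoD) auto
  then obtain n where "(1 / 2) ^ n * norm \<xi> < \<delta>" by (auto simp: eventually_sequentially)
  then have "fourier \<phi> ((1 / 2) ^ n *\<^sub>R \<xi>) = 0" by (intro near) simp
  then show ?thesis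
    using fourier_\<phi>_iterated[of n "(1 / 2) ^ n *\<^sub>R \<xi>"] by (simp add: power_divide)
qed

section \<open>Jets of the pairing between a filter and the transform\<close>

definition pairing :: "(int^'d::{finite,linorder} \<Rightarrow> complex^'r::{finite,linorder}^1) \<Rightarrow> int^'d::{finite,linorder} \<Rightarrow>
    real^'d::{finite,linorder} \<Rightarrow> complex^1" where
  "pairing \<upsilon> k \<xi> = symbol \<upsilon> \<xi> *v fourier \<phi> (\<xi> + (2 * pi) *\<^sub>R of_int_vec k)"

lemma smooth_pairing: "finsupp \<upsilon> \<Longrightarrow> smooth (pairing \<upsilon> k)"
  unfolding pairing_def [abs_def]
  by (intro matvec.smooth_prod smooth_translate smooth_symbol smooth_fourier_\<phi>)

text \<open>Doubling sends the offset pi \<omega> + 2 pi k to the lattice offset of \<omega> + 2k.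
  The refinement equation thus sorts the lattice values into cosets modulo 2, one for each
  \<omega>.\<close>

lemma two_scale_pairing:
  "two_scale \<upsilon> a (pi *\<^sub>R of_int_vec \<omega>) \<xi> *v fourier \<phi> (\<xi> + (pi *\<^sub>R of_int_vec \<omega> + (2 * pi) *\<^sub>R of_int_vec k)) =
    pairing \<upsilon> (\<omega> + 2 *s k) (2 *\<^sub>R \<xi>)"
proof -
  let ?c = "pi *\<^sub>R of_int_vec \<omega> :: real^'d::{finite,linorder}"
  let ?\<eta> = "\<xi> + (?c + (2 * pi) *\<^sub>R of_int_vec k)"
  have "symbol a (\<xi> + ?c) = symbol a ?\<eta>"
    using symbol_periodic[of a "\<xi> + ?c" k] by (simp only: add.assoc)
  then have "two_scale \<upsilon> a ?c \<xi> *v fourier \<phi> ?\<eta> = symbol \<upsilon> (2 *\<^sub>R \<xi>) *v fourier \<phi> (2 *\<^sub>R ?\<eta>)"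
    by (simp add: two_scale_def refinement matrix_vector_mul_assoc)
  also have "2 *\<^sub>R ?\<eta> = 2 *\<^sub>R \<xi> + (2 * pi) *\<^sub>R of_int_vec (\<omega> + 2 *s k)"
    by (simp add: of_int_vec_add of_int_vec_smult algebra_simps)
  finally show ?thesis by (simp only: pairing_def)
qed

lemma pairing_jet_dilate:
  assumes \<upsilon>: "finsupp \<upsilon>" and le: "mdeg \<mu> \<le> m"
    and jets: "\<And>\<mu>. mdeg \<mu> \<le> m \<Longrightarrow> mpartial \<mu> (two_scale \<upsilon> a 0) 0 = mpartial \<mu> (symbol \<upsilon>) 0"
  shows "mpartial \<mu> (pairing \<upsilon> k) 0 = 2 ^ mdeg \<mu> *\<^sub>R mpartial \<mu> (pairing \<upsilon> (2 *s k)) 0"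
proof -
  let ?f = "\<lambda>\<xi>. fourier \<phi> (\<xi> + (2 * pi) *\<^sub>R of_int_vec k)"
  have f: "smooth ?f" by (intro smooth_translate smooth_fourier_\<phi>)
  have eq: "mpartial \<beta> (symbol \<upsilon>) 0 = mpartial \<beta> (two_scale \<upsilon> a 0) 0" if "\<beta> \<le> \<mu>" for \<beta>
    using jets[of \<beta>] mdeg_mono[OF that] le by simp
  have "mpartial \<mu> (pairing \<upsilon> k) 0 = mpartial \<mu> (\<lambda>\<xi>. two_scale \<upsilon> a 0 \<xi> *v ?f \<xi>) 0"
    unfolding pairing_def [abs_def]
    by (intro matvec.mpartial_prod_cong smooth_symbol smooth_two_scale \<upsilon> a f eq)
  also have "(\<lambda>\<xi>. two_scale \<upsilon> a 0 \<xi> *v ?f \<xi>) = (\<lambda>\<xi>. pairing \<upsilon> (2 *s k) (2 *\<^sub>R \<xi>))"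
    using two_scale_pairing[of \<upsilon> 0 _ k] by (simp add: fun_eq_iff)
  also have "mpartial \<mu> \<dots> 0 = 2 ^ mdeg \<mu> *\<^sub>R mpartial \<mu> (pairing \<upsilon> (2 *s k)) 0"
    by (simp add: mpartial_dilate[OF smooth_pairing[OF \<upsilon>]])
  finally show ?thesis .
qed

text \<open>Passing from k to 2k changes the jet by a factor 2^|\<mu>|. For k = 0 this forces it to
  vanish unless \<mu> = 0. For other k, n such steps leave 2^(n|\<mu>|) times a jet at 2^n k of size
  o(2^(-mn)), which tends to 0 even for |\<mu>| = m.\<close>

lemma pairing_jet:
  assumes \<upsilon>: "finsupp \<upsilon>" and le: "mdeg \<mu> \<le> m"
    and jets: "\<And>\<mu>. mdeg \<mu> \<le> m \<Longrightarrow> mpartial \<mu> (two_scale \<upsilon> a 0) 0 = mpartial \<mu> (symbol \<upsilon>) 0"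
  shows "mpartial \<mu> (pairing \<upsilon> k) 0 = (if \<mu> = 0 \<and> k = 0 then symbol \<upsilon> 0 *v fourier \<phi> 0 else 0)"
proof (cases "k = 0")
  case True
  show ?thesis
  proof (cases "\<mu> = 0")
    case False
    have "2 *s (0 :: int^'d::{finite,linorder}) = 0" by (simp add: vec_eq_iff)
    with pairing_jet_dilate[OF \<upsilon> le jets, of 0]
    have "mpartial \<mu> (pairing \<upsilon> 0) 0 = 2 ^ mdeg \<mu> *\<^sub>R mpartial \<mu> (pairing \<upsilon> 0) 0" by simp
    then have "(1 - 2 ^ mdeg \<mu>) *\<^sub>R mpartial \<mu> (pairing \<upsilon> 0) 0 = 0" by (simp add: algebra_simps)
    moreover have "mdeg \<mu> > 0" using False mdeg_eq_0_iff[of \<mu>] by linarith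
    then have "(2 :: real) ^ mdeg \<mu> > 1" by (intro one_less_power) auto
    ultimately show ?thesis using True False by simp
  qed (simp add: True mpartial_0 pairing_def)
next
  case False
  let ?\<xi> = "(2 * pi) *\<^sub>R of_int_vec k :: real^'d::{finite,linorder}"
  have iter: "mpartial \<mu> (pairing \<upsilon> k) 0 = 2 ^ (mdeg \<mu> * n) *\<^sub>R mpartial \<mu> (pairing \<upsilon> (2 ^ n *s k)) 0" for n
  proof (induction n)
    case (Suc n)
    have "2 *s (2 ^ n *s k) = 2 ^ Suc n *s k" by (simp add: vec_eq_iff)
    with pairing_jet_dilate[OF \<upsilon> le jets, of "2 ^ n *s k"] Suc show ?case
      by (simp add: power_add mult.commute)
  qed (simp add: vec_eq_iff)
  have "(\<lambda>n. 2 ^ (m * n) *\<^sub>R mpartial \<mu> (pairing \<upsilon> (2 ^ n *s k)) 0) \<longlonglongrightarrow>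
    (\<Sum>\<beta> | \<beta> \<le> \<mu>. mchoose \<mu> \<beta> *\<^sub>R (mpartial \<beta> (symbol \<upsilon>) 0 *v 0))"
  proof -
    have "2 ^ (m * n) *\<^sub>R mpartial \<mu> (pairing \<upsilon> (2 ^ n *s k)) 0 =
        (\<Sum>\<beta> | \<beta> \<le> \<mu>. mchoose \<mu> \<beta> *\<^sub>R (mpartial \<beta> (symbol \<upsilon>) 0 *v
          (2 ^ (m * n) *\<^sub>R mpartial (\<mu> - \<beta>) (fourier \<phi>) (2 ^ n *\<^sub>R ?\<xi>))))" for n
    proof -
      have "(2 * pi) *\<^sub>R of_int_vec (2 ^ n *s k) = 2 ^ n *\<^sub>R ?\<xi>"
        by (simp add: of_int_vec_smult mult_ac)
      then show ?thesis
        unfolding pairing_def [abs_def]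
        using \<upsilon> by (simp add: matvec.mpartial_prod smooth_symbol smooth_translate smooth_fourier_\<phi>
            mpartial_translate matvec.scaleR_right scaleR_sum_right mult.commute)
    qed
    then show ?thesis
      by (simp only:) (intro tendsto_sum tendsto_scaleR tendsto_const matvec.tendsto
          fourier_jet_decay lattice_nonzero False)
  qed
  then have lim: "(\<lambda>n. 2 ^ (m * n) *\<^sub>R mpartial \<mu> (pairing \<upsilon> (2 ^ n *s k)) 0) \<longlonglongrightarrow> 0" by simp
  have "(\<lambda>n. mpartial \<mu> (pairing \<upsilon> k) 0) \<longlonglongrightarrow> 0"
  proof (rule Lim_null_comparison[OF always_eventually tendsto_norm_zero[OF lim]], rule allI)
    fix n
    have "(2 :: real) ^ (mdeg \<mu> * n) \<le> 2 ^ (m * n)" using le by (intro power_increasing) auto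
    then show "norm (mpartial \<mu> (pairing \<upsilon> k) 0) \<le> norm ((2 :: real) ^ (m * n) *\<^sub>R mpartial \<mu> (pairing \<upsilon> (2 ^ n *s k)) 0)"
      unfolding iter[of n] by (simp add: mult_right_mono)
  qed
  then show ?thesis using False by (simp add: LIMSEQ_const_iff)
qed

end

section \<open>Consequences of the spanning hypothesis\<close>

locale hermite_span = hermite_scheme m \<nu> a \<phi>
  for m :: nat
    and \<nu> :: "'r::{finite,linorder} \<Rightarrow> nat^'d::{finite,linorder}"
    and a :: "int^'d::{finite,linorder} \<Rightarrow> complex^'r::{finite,linorder}^'r::{finite,linorder}"
    and \<phi> :: "real^'d::{finite,linorder} \<Rightarrow> complex^'r::{finite,linorder}" +
  assumes span: "\<And>\<omega>. \<omega> \<in> cube \<Longrightarrow>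
    vec.span (range (\<lambda>k. fourier \<phi> (pi *\<^sub>R of_int_vec \<omega> + (2 * pi) *\<^sub>R of_int_vec k))) = UNIV"
begin

lemma span_0: "vec.span (range (\<lambda>k. fourier \<phi> ((2 * pi) *\<^sub>R of_int_vec k))) = UNIV"
  using span[of 0] by (simp add: cube_def)

lemma decomposition: "\<exists>c w. v = c *s fourier \<phi> 0 + w \<and> decays m A w"
proof -
  have "v = fourier \<phi> 0 \<or> decays m A v" if "v \<in> range (\<lambda>k. fourier \<phi> ((2 * pi) *\<^sub>R of_int_vec k))" for v
    using that decays_lattice by (auto simp: image_iff) (metis of_int_vec_0 scaleR_zero_right)
  from decays_span[OF this span_0] show ?thesis by metis
qed

text \<open>With value 0 the splitting would consist of decaying vectors only, so the transform
  would vanish everywhere and its lattice values could not span.\<close>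

lemma fourier_\<phi>_0_nonzero: "fourier \<phi> 0 \<noteq> 0"
proof
  assume "fourier \<phi> 0 = 0"
  then have "decays m A v" for v using decomposition[of v] by auto
  then have "range (\<lambda>k. fourier \<phi> ((2 * pi) *\<^sub>R of_int_vec k)) = {0}"
    using fourier_\<phi>_eq_0 by auto
  then have "vec.span {0} = (UNIV :: (complex^'r::{finite,linorder}) set)" using span_0 by simp
  then have "axis first 1 \<in> vec.span {0 :: complex^'r::{finite,linorder}}" by blast
  then show False by simp
qed

sublocale split: split_matrix m A "fourier \<phi> 0"
  using fixed_vector fourier_\<phi>_0_nonzero decomposition by unfold_locales

lemma two_scale_jets:
  assumes "finsupp \<upsilon>" "cond_A a \<phi> \<upsilon>" "cond_B m a \<upsilon>" "mdeg \<mu> \<le> m"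
  shows "mpartial \<mu> (two_scale \<upsilon> a 0) 0 = mpartial \<mu> (symbol \<upsilon>) 0"
proof (cases "\<mu> = 0")
  case True
  then show ?thesis using assms(2) by (simp add: mpartial_0 two_scale_def cond_A_def)
next
  case False
  then have "1 \<le> mdeg \<mu>" by (simp add: Suc_le_eq neq0_conv[symmetric])
  then have "invertible (mat 1 - 2 ^ mdeg \<mu> *\<^sub>R A)" using assms(4) by (rule split.invertible_dilated)
  from jet_recursion[OF assms(1) a this] show ?thesis
    using assms(3,4) False unfolding cond_B_def by blast
qed

lemma cond_A_pairing: "cond_A a \<phi> \<upsilon> \<Longrightarrow> symbol \<upsilon> 0 *v fourier \<phi> 0 = 1"
  by (simp add: cond_A_def vec_eq_iff forall_1)

lemma pairing_eq_O:
  assumes "finsupp \<upsilon>" "cond_A a \<phi> \<upsilon>" "cond_B m a \<upsilon>"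
  shows "eq_O (m + 1) (\<lambda>\<xi>. (symbol \<upsilon> \<xi> *v fourier \<phi> (\<xi> + (2 * pi) *\<^sub>R of_int_vec k)) $ 1) (\<lambda>\<xi>. delta k)"
  unfolding eq_O_def
proof (intro allI impI)
  fix \<mu> :: "nat^'d::{finite,linorder}"
  assume "mdeg \<mu> < m + 1"
  then have le: "mdeg \<mu> \<le> m" by simp
  have "mpartial \<mu> (\<lambda>\<xi>. pairing \<upsilon> k \<xi> $ 1) 0 = mpartial \<mu> (pairing \<upsilon> k) 0 $ 1"
    by (simp add: mpartial_bounded_linear[OF bounded_linear_vec_nth smooth_pairing[OF assms(1)]])
  also have "\<dots> = (if \<mu> = 0 \<and> k = 0 then 1 else 0)"
    using pairing_jet[OF assms(1) le two_scale_jets[OF assms]] cond_A_pairing[OF assms(2)] by simp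
  finally show "mpartial \<mu> (\<lambda>\<xi>. (symbol \<upsilon> \<xi> *v fourier \<phi> (\<xi> + (2 * pi) *\<^sub>R of_int_vec k)) $ 1) 0 =
      mpartial \<mu> (\<lambda>\<xi>. delta k) 0"
    by (simp add: pairing_def mpartial_const_0 delta_def)
qed

text \<open>Induction on |\<mu>|: in the Leibniz expansion of the product with the transform the
  lower jets are already 0, so the jet of order \<mu> annihilates every value at pi \<omega> + 2 pi
  k, and these span.\<close>

lemma two_scale_jet_zero:
  assumes \<upsilon>: "finsupp \<upsilon>" "cond_A a \<phi> \<upsilon>" "cond_B m a \<upsilon>" and \<omega>: "\<omega> \<in> cube - {0}"
  shows "mdeg \<mu> \<le> m \<Longrightarrow> mpartial \<mu> (two_scale \<upsilon> a (pi *\<^sub>R of_int_vec \<omega>)) 0 = 0"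
proof (induction "mdeg \<mu>" arbitrary: \<mu> rule: less_induct)
  case less
  let ?c = "pi *\<^sub>R of_int_vec \<omega> :: real^'d::{finite,linorder}"
  let ?h = "two_scale \<upsilon> a ?c"
  have h: "smooth ?h" by (rule smooth_two_scale[OF \<upsilon>(1) a])
  have "mpartial \<mu> ?h 0 *v fourier \<phi> (?c + (2 * pi) *\<^sub>R of_int_vec k) = 0" for k
  proof -
    let ?f = "\<lambda>\<xi>. fourier \<phi> (\<xi> + (?c + (2 * pi) *\<^sub>R of_int_vec k))"
    have f: "smooth ?f" by (intro smooth_translate smooth_fourier_\<phi>)
    \<comment> \<open>Entries of \<omega> are 0 or 1, so by parity the sum vanishes only for
      \<omega> = 0. All pairings involved are therefore at nonzero lattice points.\<close>
    have nz: "\<omega> + 2 *s k \<noteq> 0"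
    proof
      assume *: "\<omega> + 2 *s k = 0"
      have "\<omega> $ i = 0" for i
      proof -
        have "\<omega> $ i + 2 * k $ i = 0" using * by (simp add: vec_eq_iff)
        moreover have "0 \<le> \<omega> $ i" "\<omega> $ i \<le> 1" using \<omega> by (auto simp: cube_def)
        ultimately show ?thesis by presburger
      qed
      then show False using \<omega> by (simp add: vec_eq_iff)
    qed
    have "(\<lambda>\<xi>. ?h \<xi> *v ?f \<xi>) = (\<lambda>\<xi>. pairing \<upsilon> (\<omega> + 2 *s k) (2 *\<^sub>R \<xi>))"
      using two_scale_pairing by blast
    then have "mpartial \<mu> (\<lambda>\<xi>. ?h \<xi> *v ?f \<xi>) 0 = 0"
      using pairing_jet[OF \<upsilon>(1) less.prems two_scale_jets[OF \<upsilon>], of "\<omega> + 2 *s k"] nz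
      by (simp add: mpartial_dilate[OF smooth_pairing[OF \<upsilon>(1)]])
    moreover have "mpartial \<mu> (\<lambda>\<xi>. ?h \<xi> *v ?f \<xi>) 0 =
        mpartial \<mu> ?h 0 *v ?f 0 + (\<Sum>\<beta> | \<beta> \<le> \<mu> \<and> \<beta> \<noteq> \<mu>. mchoose \<mu> \<beta> *\<^sub>R
          (mpartial \<beta> ?h 0 *v mpartial (\<mu> - \<beta>) ?f 0))"
      by (simp add: matvec.mpartial_prod[OF h f] sum_le_split mpartial_0)
    moreover have "(\<Sum>\<beta> | \<beta> \<le> \<mu> \<and> \<beta> \<noteq> \<mu>. mchoose \<mu> \<beta> *\<^sub>R
          (mpartial \<beta> ?h 0 *v mpartial (\<mu> - \<beta>) ?f 0)) = 0"
    proof (rule sum.neutral, rule ballI)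
      fix \<beta> assume "\<beta> \<in> {\<beta>. \<beta> \<le> \<mu> \<and> \<beta> \<noteq> \<mu>}"
      then have "mdeg \<beta> < mdeg \<mu>" using mdeg_strict_mono by blast
      then have "mpartial \<beta> ?h 0 = 0" using less by simp
      then show "mchoose \<mu> \<beta> *\<^sub>R (mpartial \<beta> ?h 0 *v mpartial (\<mu> - \<beta>) ?f 0) = 0" by simp
    qed
    ultimately show ?thesis by simp
  qed
  then show ?case
    by (intro matrix_eq_0_on_span[OF _ span[of \<omega>]]) (use \<omega> in auto)
qed

lemma symbol_nonzero:
  assumes "cond_A a \<phi> \<upsilon>" shows "symbol \<upsilon> 0 \<noteq> 0"
  using cond_A_pairing[OF assms] by auto

lemma sum_rules_of_cond:
  assumes "finsupp \<upsilon>" "cond_A a \<phi> \<upsilon>" "cond_B m a \<upsilon>"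
  shows "sum_rules (m + 1) a \<upsilon>"
proof -
  have "(\<lambda>\<xi>. symbol \<upsilon> (2 *\<^sub>R \<xi>) ** symbol a \<xi>) = two_scale \<upsilon> a 0"
    "(\<lambda>\<xi>. symbol \<upsilon> (2 *\<^sub>R \<xi>) ** symbol a (\<xi> + c)) = two_scale \<upsilon> a c" for c
    by (simp_all add: two_scale_def fun_eq_iff)
  then show ?thesis
    using symbol_nonzero[OF assms(2)] two_scale_jets[OF assms] two_scale_jet_zero[OF assms]
    by (simp add: sum_rules_def eq_O_def less_Suc_eq_le mpartial_zero)
qed

end

section \<open>Polynomial eigenvectors from sum rules\<close>

lemma prod_sum_vec:
  fixes f :: "'i::finite \<Rightarrow> 'a \<Rightarrow> 'b::comm_semiring_1"
  assumes "\<And>i. finite (B i)"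
  shows "(\<Prod>i\<in>UNIV. \<Sum>t\<in>B i. f i t) = (\<Sum>v | \<forall>i. v $ i \<in> B i. \<Prod>i\<in>UNIV. f i (v $ i))"
proof -
  have "(\<Prod>i\<in>UNIV. \<Sum>t\<in>B i. f i t) = (\<Sum>v\<in>PiE UNIV B. \<Prod>i\<in>UNIV. f i (v i))"
    using assms by (intro prod_sum_PiE) auto
  also have "\<dots> = (\<Sum>v | \<forall>i. v $ i \<in> B i. \<Prod>i\<in>UNIV. f i (v $ i))"
    by (rule sum.reindex_bij_witness[where i = vec_nth and j = vec_lambda]) (auto simp: PiE_iff)
  finally show ?thesis .
qed

lemma monom_fun_prod: "monom_fun \<mu> x = (\<Prod>i\<in>UNIV. of_real ((x $ i) ^ (\<mu> $ i) / fact (\<mu> $ i)))"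
  by (simp add: monom_fun_def mpow_def mfact_def prod_dividef)

lemma monom_fun_add:
  "monom_fun \<mu> (x + y) = (\<Sum>\<beta> | \<beta> \<le> \<mu>. monom_fun \<beta> x * monom_fun (\<mu> - \<beta>) y)"
proof -
  let ?f = "\<lambda>i j. complex_of_real ((x $ i) ^ j / fact j) * of_real ((y $ i) ^ (\<mu> $ i - j) / fact (\<mu> $ i - j))"
  have 1: "(s + t) ^ n / fact n = (\<Sum>j\<le>n. s ^ j / fact j * (t ^ (n - j) / fact (n - j)))" for s t :: real and n
    by (simp add: binomial_ring sum_divide_distrib binomial_fact field_simps)
  have "monom_fun \<mu> (x + y) = (\<Prod>i\<in>UNIV. \<Sum>j\<in>{..\<mu> $ i}. ?f i j)"
    unfolding monom_fun_prod vector_add_component 1 by simp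
  also have "\<dots> = (\<Sum>\<beta> | \<forall>i. \<beta> $ i \<in> {..\<mu> $ i}. \<Prod>i\<in>UNIV. ?f i (\<beta> $ i))"
    by (rule prod_sum_vec) simp
  also have "\<dots> = (\<Sum>\<beta> | \<beta> \<le> \<mu>. monom_fun \<beta> x * monom_fun (\<mu> - \<beta>) y)"
    unfolding monom_fun_prod prod.distrib[symmetric]
    by (simp only: less_eq_vec_def atMost_iff vector_minus_component)
  finally show ?thesis .
qed

lemma monom_fun_scale: "monom_fun \<mu> (c *\<^sub>R x) = of_real (c ^ mdeg \<mu>) * monom_fun \<mu> x"
  by (simp add: monom_fun_def mpow_def mdeg_def power_mult_distrib prod.distrib power_sum)

lemma dweight_eq_monom_fun: "dweight x \<mu> = (- \<i>) ^ mdeg \<mu> * of_real (mfact \<mu>) * monom_fun \<mu> x"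
  by (simp add: dweight_def monom_fun_def)

section \<open>Cosets modulo 2 and their characters\<close>

lemma cube_eq: "cube = {\<omega>. \<forall>i. \<omega> $ i \<in> {0, 1}}"
proof -
  have "0 \<le> t \<and> t \<le> 1 \<longleftrightarrow> t \<in> {0, 1}" for t :: int by auto
  then show ?thesis unfolding cube_def by blast
qed

lemma finite_cube: "finite (cube :: (int^'d) set)"
proof -
  have "cube \<subseteq> ibox 1" by (auto simp: cube_def ibox_def)
  then show ?thesis using ibox_card(1)[of 1] finite_subset by auto
qed

lemma char_fun_add: "char_fun (j + k) \<xi> = char_fun j \<xi> * char_fun k \<xi>"
  by (simp add: of_int_vec_add inner_add_left algebra_simps flip: exp_add)

text \<open>Orthogonality of the characters of (Z/2)^d: the sum factors over the coordinates into 1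
  + (-1)^(n_i).\<close>

lemma char_fun_cube_sum:
  fixes n :: "int^'d"
  shows "(\<Sum>\<omega>\<in>cube. char_fun n (pi *\<^sub>R of_int_vec \<omega>)) = (if \<forall>i. even (n $ i) then 2 ^ CARD('d) else 0)"
proof -
  let ?f = "\<lambda>i t. exp (- (\<i> * of_int (n $ i) * of_real pi * of_int t)) :: complex"
  have exp_int: "exp (- (\<i> * of_int j * of_real pi)) = (if even j then 1 else - 1 :: complex)" for j :: int
  proof (cases "even j")
    case True
    then obtain l where "j = 2 * l" by blast
    then have "- (\<i> * of_int j * complex_of_real pi) = \<i> * (of_int (- l) * (of_real pi * 2))" by simp
    then have "exp (- (\<i> * of_int j * complex_of_real pi)) = 1" by (simp only: exp_2pi_1_int)
    then show ?thesis using True by simp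
  next
    case False
    then obtain l where l: "j = 2 * l + 1" by (elim oddE)
    then have "- (\<i> * of_int j * complex_of_real pi) = \<i> * (of_int (- l) * (of_real pi * 2)) + - (of_real pi * \<i>)"
      by (simp add: algebra_simps)
    then have "exp (- (\<i> * of_int j * complex_of_real pi)) = exp (- (of_real pi * \<i>))"
      by (simp only: exp_add exp_2pi_1_int mult_1)
    then show ?thesis using False by (simp add: exp_minus)
  qed
  have "char_fun n (pi *\<^sub>R of_int_vec \<omega>) = (\<Prod>i\<in>UNIV. ?f i (\<omega> $ i))" for \<omega>
    by (simp add: inner_vec_def sum_distrib_left exp_sum[symmetric] sum_negf mult_ac)
  then have "(\<Sum>\<omega>\<in>cube. char_fun n (pi *\<^sub>R of_int_vec \<omega>)) = (\<Sum>\<omega> | \<forall>i. \<omega> $ i \<in> {0, 1}. \<Prod>i\<in>UNIV. ?f i (\<omega> $ i))"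
    by (simp only: cube_eq)
  also have "\<dots> = (\<Prod>i\<in>UNIV. \<Sum>t\<in>{0, 1}. ?f i t)"
    by (rule prod_sum_vec[symmetric]) simp
  also have "\<dots> = (\<Prod>i\<in>UNIV. if even (n $ i) then 2 else 0)"
    by (intro prod.cong refl) (simp add: exp_int)
  also have "\<dots> = (if \<forall>i. even (n $ i) then 2 ^ CARD('d) else 0)"
    by (auto simp: prod_zero_iff)
  finally show ?thesis .
qed

lemma subdivision_finsupp_sum:
  fixes a :: "int^'d \<Rightarrow> complex^'r^'r" and v :: "int^'d \<Rightarrow> complex^'r^'s"
  assumes "finsupp a" "finsupp v"
  shows "subdivision a v j = (2 ^ CARD('d)) *\<^sub>R (\<Sum>k | v k \<noteq> 0. v k ** a (j - 2 *s k))"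
  using assms by (intro subdivision_eq_sum) (auto simp: finsupp_def)

lemma two_scale_eq_symbol:
  fixes a :: "int^'d \<Rightarrow> complex^'r^'r"
  assumes "finsupp a" "finsupp \<upsilon>"
  shows "2 ^ CARD('d) *\<^sub>R two_scale \<upsilon> a (pi *\<^sub>R of_int_vec \<omega>) \<xi> = symbol (subdivision a \<upsilon>) (\<xi> + pi *\<^sub>R of_int_vec \<omega>)"
proof -
  have "symbol \<upsilon> (2 *\<^sub>R (\<xi> + pi *\<^sub>R of_int_vec \<omega>)) = symbol \<upsilon> (2 *\<^sub>R \<xi>)"
    using symbol_periodic[of \<upsilon> "2 *\<^sub>R \<xi>" \<omega>] by (simp add: scaleR_add_right)
  then show ?thesis by (simp add: two_scale_def symbol_subdivision(2)[OF assms])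
qed

lemma sum_rules_two_scale:
  assumes "sum_rules (m + 1) a \<upsilon>" "mdeg \<mu> \<le> m" "\<omega> \<in> cube"
  shows "mpartial \<mu> (two_scale \<upsilon> a (pi *\<^sub>R of_int_vec \<omega>)) 0 = (if \<omega> = 0 then mpartial \<mu> (symbol \<upsilon>) 0 else 0)"
proof -
  have "(\<lambda>\<xi>. symbol \<upsilon> (2 *\<^sub>R \<xi>) ** symbol a \<xi>) = two_scale \<upsilon> a 0"
    "(\<lambda>\<xi>. symbol \<upsilon> (2 *\<^sub>R \<xi>) ** symbol a (\<xi> + c)) = two_scale \<upsilon> a c" for c
    by (simp_all add: two_scale_def fun_eq_iff)
  then show ?thesis
    using assms by (auto simp: sum_rules_def eq_O_def less_Suc_eq_le mpartial_zero)
qed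

text \<open>By the sum rules the jets of the symbol of \<open>subdivision a \<upsilon>\<close>
  vanish at pi \<omega> for \<omega> \<noteq> 0. Summing against characters isolates one coset
  modulo 2, so all cosets share the moments of \<upsilon>, for orders up to m. J is any finite set
  containing the support.\<close>

lemma coset_moments:
  fixes a :: "int^'d::{finite,linorder} \<Rightarrow> complex^'r^'r"
  assumes a: "finsupp a" and \<upsilon>: "finsupp \<upsilon>" and sr: "sum_rules (m + 1) a \<upsilon>" and \<beta>: "mdeg \<beta> \<le> m"
    and J: "finite J" "\<And>j. subdivision a \<upsilon> j \<noteq> 0 \<Longrightarrow> j \<in> J"
  shows "(\<Sum>j | j \<in> J \<and> (\<forall>i. even ((j - j0) $ i)). cscale (monom_fun \<beta> (of_int_vec j)) (subdivision a \<upsilon> j)) =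
    (\<Sum>k | \<upsilon> k \<noteq> 0. cscale (monom_fun \<beta> (of_int_vec k)) (\<upsilon> k))"
proof -
  let ?s = "subdivision a \<upsilon>" and ?c = "2 ^ CARD('d) :: real"
  let ?E = "\<lambda>j. \<forall>i. even ((j - j0) $ i)"
  let ?\<pi> = "\<lambda>\<omega>. pi *\<^sub>R of_int_vec \<omega> :: real^'d::{finite,linorder}"
  have s: "finsupp ?s" by (rule symbol_subdivision(1)[OF a \<upsilon>])
  have zero: "char_fun k 0 = 1" for k :: "int^'d::{finite,linorder}" by simp
  have moment: "(\<Sum>j\<in>J. cscale (dweight (of_int_vec j) \<beta> * char_fun j (?\<pi> \<omega>)) (?s j)) =
      (if \<omega> = 0 then ?c *\<^sub>R mpartial \<beta> (symbol \<upsilon>) 0 else 0)" if "\<omega> \<in> cube" for \<omega>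
  proof -
    have "(\<lambda>\<xi>. symbol ?s (\<xi> + ?\<pi> \<omega>)) = (\<lambda>\<xi>. ?c *\<^sub>R two_scale \<upsilon> a (?\<pi> \<omega>) \<xi>)"
      using two_scale_eq_symbol[OF a \<upsilon>] by (simp add: fun_eq_iff)
    then have "mpartial \<beta> (symbol ?s) (0 + ?\<pi> \<omega>) = ?c *\<^sub>R mpartial \<beta> (two_scale \<upsilon> a (?\<pi> \<omega>)) 0"
      using mpartial_translate[OF smooth_symbol[OF s], of \<beta> "?\<pi> \<omega>"]
        mpartial_bounded_linear[OF bounded_linear_scaleR_right smooth_two_scale[OF \<upsilon> a], of \<beta> ?c "?\<pi> \<omega>"]
      by metis
    moreover have "mpartial \<beta> (symbol ?s) (0 + ?\<pi> \<omega>) =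
        (\<Sum>j\<in>J. cscale (char_fun j (?\<pi> \<omega>)) (cscale (dweight (of_int_vec j) \<beta>) (?s j)))"
      unfolding mpartial_symbol[OF s] add_0_left
      by (rule symbol_eq_sum[OF J(1)], rule J(2)) auto
    ultimately show ?thesis
      by (simp only: cscale_cscale sum_rules_two_scale[OF sr \<beta> that] mult.commute[of "exp _"]
          if_distrib[of "scaleR ?c"] scaleR_zero_right)
  qed
  \<comment> \<open>Only \<omega> = 0 contributes, where the character of - j0 is 1; it is inserted
    here so that it later selects the coset of j0.\<close>
  have "?c *\<^sub>R mpartial \<beta> (symbol \<upsilon>) 0 =
      (\<Sum>\<omega>\<in>cube. cscale (char_fun (- j0) (?\<pi> \<omega>)) (if \<omega> = 0 then ?c *\<^sub>R mpartial \<beta> (symbol \<upsilon>) 0 else 0))"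
  proof -
    have "cscale (char_fun (- j0) (?\<pi> \<omega>)) (if \<omega> = 0 then ?c *\<^sub>R mpartial \<beta> (symbol \<upsilon>) 0 else 0) =
        (if \<omega> = 0 then ?c *\<^sub>R mpartial \<beta> (symbol \<upsilon>) 0 else 0)" for \<omega>
      by simp
    moreover have "0 \<in> (cube :: (int^'d::{finite,linorder}) set)" by (simp add: cube_def)
    moreover have "finite (cube :: (int^'d::{finite,linorder}) set)" by (rule finite_cube)
    ultimately show ?thesis by simp
  qed
  also have "\<dots> = (\<Sum>\<omega>\<in>cube. cscale (char_fun (- j0) (?\<pi> \<omega>))
      (\<Sum>j\<in>J. cscale (dweight (of_int_vec j) \<beta> * char_fun j (?\<pi> \<omega>)) (?s j)))"
    by (intro sum.cong refl) (simp only: moment)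
  also have "\<dots> = (\<Sum>\<omega>\<in>cube. \<Sum>j\<in>J. cscale (char_fun (j - j0) (?\<pi> \<omega>) * dweight (of_int_vec j) \<beta>) (?s j))"
  proof -
    have "char_fun (j - j0) p = char_fun j p * char_fun (- j0) p" for j p
      using char_fun_add[of j "- j0" p] by (simp only: add_uminus_conv_diff)
    then have "cscale (char_fun (- j0) p) (cscale (w * char_fun j p) (?s j)) = cscale (char_fun (j - j0) p * w) (?s j)"
      for j p w by (simp only: cscale_cscale mult_ac)
    then show ?thesis by (simp only: cscale.sum_right)
  qed
  also have "\<dots> = (\<Sum>j\<in>J. cscale ((\<Sum>\<omega>\<in>cube. char_fun (j - j0) (?\<pi> \<omega>)) * dweight (of_int_vec j) \<beta>) (?s j))"
    by (subst sum.swap) (simp only: sum_distrib_right cscale.sum_left)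
  also have "\<dots> = (\<Sum>j\<in>J. if ?E j then cscale (of_real ?c * dweight (of_int_vec j) \<beta>) (?s j) else 0)"
    unfolding char_fun_cube_sum by (intro sum.cong refl) auto
  also have "\<dots> = (\<Sum>j | j \<in> J \<and> ?E j. cscale (of_real ?c * dweight (of_int_vec j) \<beta>) (?s j))"
    by (rule sum.inter_filter[OF J(1), symmetric])
  also have "\<dots> = cscale (of_real ?c * ((- \<i>) ^ mdeg \<beta> * of_real (mfact \<beta>)))
      (\<Sum>j | j \<in> J \<and> ?E j. cscale (monom_fun \<beta> (of_int_vec j)) (?s j))"
    by (simp add: cscale.sum_right cscale_cscale dweight_eq_monom_fun mult.assoc)
  also have "?c *\<^sub>R mpartial \<beta> (symbol \<upsilon>) 0 = cscale (of_real ?c * ((- \<i>) ^ mdeg \<beta> * of_real (mfact \<beta>)))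
      (\<Sum>k | \<upsilon> k \<noteq> 0. cscale (monom_fun \<beta> (of_int_vec k)) (\<upsilon> k))"
  proof -
    have "mpartial \<beta> (symbol \<upsilon>) 0 = (\<Sum>k | \<upsilon> k \<noteq> 0. cscale (char_fun k 0) (cscale (dweight (of_int_vec k) \<beta>) (\<upsilon> k)))"
      unfolding mpartial_symbol[OF \<upsilon>] using \<upsilon> by (intro symbol_eq_sum) (auto simp: finsupp_def)
    then have "?c *\<^sub>R mpartial \<beta> (symbol \<upsilon>) 0 =
        (\<Sum>k | \<upsilon> k \<noteq> 0. cscale (of_real ?c) (cscale (dweight (of_int_vec k) \<beta>) (\<upsilon> k)))"
      by (simp add: zero scaleR_sum_right) (simp add: vec_eq_iff scaleR_conv_of_real[where 'a = complex])
    then show ?thesis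
      by (simp add: cscale.sum_right cscale_cscale dweight_eq_monom_fun mult.assoc)
  qed
  finally have eq: "cscale (of_real ?c * ((- \<i>) ^ mdeg \<beta> * of_real (mfact \<beta>)))
      (\<Sum>k | \<upsilon> k \<noteq> 0. cscale (monom_fun \<beta> (of_int_vec k)) (\<upsilon> k)) =
    cscale (of_real ?c * ((- \<i>) ^ mdeg \<beta> * of_real (mfact \<beta>)))
      (\<Sum>j | j \<in> J \<and> ?E j. cscale (monom_fun \<beta> (of_int_vec j)) (?s j))" .
  have "X = Y" if "cscale z X = cscale z Y" "z \<noteq> 0" for z and X Y :: "complex^'r^1"
    using that by (simp add: vec_eq_iff)
  from this[OF eq] show ?thesis by simp
qed

lemma poly_conv_eq: "poly_conv p v x = (\<Sum>k | v k \<noteq> 0. cscale (p (x - of_int_vec k)) (v k))"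
  by (simp add: poly_conv_def vec_eq_iff)

lemma poly_conv_monom_scale:
  "poly_conv (monom_fun \<mu>) v (c *\<^sub>R x) =
    c ^ mdeg \<mu> *\<^sub>R (\<Sum>k | v k \<noteq> 0. cscale (monom_fun \<mu> (x - (1 / c) *\<^sub>R of_int_vec k)) (v k))" if "c \<noteq> 0"
proof -
  have "c *\<^sub>R x - of_int_vec k = c *\<^sub>R (x - (1 / c) *\<^sub>R of_int_vec k)" for k
    using that by (simp add: scaleR_diff_right)
  then show ?thesis
    by (simp add: poly_conv_eq monom_fun_scale scaleR_sum_right)
      (simp add: vec_eq_iff scaleR_conv_of_real[where 'a = complex] mult.assoc)
qed

text \<open>Homogeneity turns the right side into moments of \<upsilon> about j0 with halved
  argument. These equal the moments of \<open>subdivision a \<upsilon>\<close> over the coset of j0,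
  and unfolding that sequence with the substitution j = j0 - 2k + 2l gives the left side.\<close>

lemma subdivision_poly_conv:
  fixes a :: "int^'d::{finite,linorder} \<Rightarrow> complex^'r^'r"
  assumes a: "finsupp a" and \<upsilon>: "finsupp \<upsilon>" and sr: "sum_rules (m + 1) a \<upsilon>" and \<mu>: "mdeg \<mu> \<le> m"
  shows "subdivision a (\<lambda>k. poly_conv (monom_fun \<mu>) \<upsilon> (of_int_vec k)) j0 =
    (1 / 2) ^ mdeg \<mu> *\<^sub>R poly_conv (monom_fun \<mu>) \<upsilon> (of_int_vec j0)"
proof -
  let ?c = "2 ^ CARD('d) :: real"
  let ?A = "{k. a k \<noteq> 0}" and ?V = "{k. \<upsilon> k \<noteq> 0}" and ?K = "{k. a (j0 - 2 *s k) \<noteq> 0}"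
  let ?s = "subdivision a \<upsilon>"
  let ?x = "of_int_vec :: int^'d::{finite,linorder} \<Rightarrow> real^'d::{finite,linorder}"
  define J where "J = (\<lambda>(k, l). 2 *s k + l) ` (?V \<times> ?A)"
  let ?J = "{j. j \<in> J \<and> (\<forall>i. even ((j - j0) $ i))}"
  have fin: "finite ?A" "finite ?V" "finite J" using a \<upsilon> by (auto simp: finsupp_def J_def)
  have J: "j \<in> J" if "?s j \<noteq> 0" for j
    unfolding J_def by (rule subdivision_support[OF a that])
  have half: "monom_fun \<mu> ((1 / 2) *\<^sub>R (?x j0 - ?x k)) =
      (\<Sum>\<beta> | \<beta> \<le> \<mu>. of_real ((- 1 / 2) ^ mdeg \<beta>) * monom_fun (\<mu> - \<beta>) ((1 / 2) *\<^sub>R ?x j0) * monom_fun \<beta> (?x k))" for k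
  proof -
    have "(1 / 2) *\<^sub>R (?x j0 - ?x k) = (- 1 / 2) *\<^sub>R ?x k + (1 / 2) *\<^sub>R ?x j0"
      by (simp add: scaleR_diff_right)
    then show ?thesis
      by (simp only: monom_fun_add monom_fun_scale[of _ "- 1 / 2"] mult_ac)
  qed
  \<comment> \<open>The binomial theorem reduces the centred monomial to the plain moments of order
    \<beta> \<le> \<mu>, to which the coset identity applies.\<close>
  have expand: "(\<Sum>k\<in>K. cscale (monom_fun \<mu> ((1 / 2) *\<^sub>R (?x j0 - ?x k))) (u k)) =
      (\<Sum>\<beta> | \<beta> \<le> \<mu>. cscale (of_real ((- 1 / 2) ^ mdeg \<beta>) * monom_fun (\<mu> - \<beta>) ((1 / 2) *\<^sub>R ?x j0))
        (\<Sum>k\<in>K. cscale (monom_fun \<beta> (?x k)) (u k)))" for K and u :: "int^'d::{finite,linorder} \<Rightarrow> complex^'r^1"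
    unfolding half cscale.sum_left cscale.sum_right cscale_cscale by (rule sum.swap)
  have "(1 / 2) ^ mdeg \<mu> *\<^sub>R poly_conv (monom_fun \<mu>) \<upsilon> (?x j0) =
      (\<Sum>k\<in>?V. cscale (monom_fun \<mu> ((1 / 2) *\<^sub>R (?x j0 - ?x k))) (\<upsilon> k))"
    unfolding poly_conv_eq monom_fun_scale scaleR_sum_right
    by (simp add: vec_eq_iff scaleR_conv_of_real[where 'a = complex] mult_ac)
  also have "\<dots> = (\<Sum>j\<in>?J. cscale (monom_fun \<mu> ((1 / 2) *\<^sub>R (?x j0 - ?x j))) (?s j))"
  proof -
    have "(\<Sum>j\<in>?J. cscale (monom_fun \<beta> (?x j)) (?s j)) = (\<Sum>k\<in>?V. cscale (monom_fun \<beta> (?x k)) (\<upsilon> k))"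
      if "\<beta> \<le> \<mu>" for \<beta>
      using mdeg_mono[OF that] \<mu> fin J by (intro coset_moments[OF a \<upsilon> sr]) auto
    then show ?thesis unfolding expand by (intro sum.cong refl) simp
  qed
  also have "\<dots> = ?c *\<^sub>R (\<Sum>j\<in>?J. \<Sum>l\<in>?V. cscale (monom_fun \<mu> ((1 / 2) *\<^sub>R (?x j0 - ?x j))) (\<upsilon> l ** a (j - 2 *s l)))"
    unfolding subdivision_finsupp_sum[OF a \<upsilon>] cscale.scaleR_right cscale.sum_right scaleR_sum_right ..
  also have "(\<Sum>j\<in>?J. \<Sum>l\<in>?V. cscale (monom_fun \<mu> ((1 / 2) *\<^sub>R (?x j0 - ?x j))) (\<upsilon> l ** a (j - 2 *s l))) =
      (\<Sum>l\<in>?V. \<Sum>j\<in>?J. cscale (monom_fun \<mu> ((1 / 2) *\<^sub>R (?x j0 - ?x j))) (\<upsilon> l ** a (j - 2 *s l)))"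
    by (rule sum.swap)
  also have "\<dots> = (\<Sum>l\<in>?V. \<Sum>k\<in>?K. cscale (monom_fun \<mu> (?x k - ?x l)) (\<upsilon> l ** a (j0 - 2 *s k)))"
  proof (rule sum.cong[OF refl])
    fix l assume l: "l \<in> ?V"
    \<comment> \<open>Chosen so that j - 2l = j0 - 2k and (j0 - j)/2 = k - l: the mask argument
      becomes that of subdivision at j0, the monomial argument that of the convolution at k.\<close>
    let ?g = "\<lambda>k. j0 - 2 *s k + 2 *s l"
    have inj: "inj_on ?g ?K" by (auto simp: inj_on_def vec_eq_iff)
    have sub: "?g ` ?K \<subseteq> ?J"
    proof
      fix j assume "j \<in> ?g ` ?K"
      then obtain k where k: "a (j0 - 2 *s k) \<noteq> 0" "j = ?g k" by blast
      then have "j \<in> J" using l unfolding J_def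
        by (intro image_eqI[where x = "(l, j0 - 2 *s k)"]) auto
      then show "j \<in> ?J" by (simp add: k(2))
    qed
    have zero: "cscale (monom_fun \<mu> ((1 / 2) *\<^sub>R (?x j0 - ?x j))) (\<upsilon> l ** a (j - 2 *s l)) = 0"
      if "j \<in> ?J - ?g ` ?K" for j
    proof -
      have ev: "\<And>i. even ((j - j0) $ i)" using that by blast
      \<comment> \<open>The integer division is exact, since j and j0 lie in the same coset.\<close>
      define k where "k = (\<chi> i. (j0 $ i - j $ i) div 2 + l $ i)"
      have k2: "2 * ((j0 $ i - j $ i) div 2) = j0 $ i - j $ i" for i
        using ev[of i] by simp
      have j: "j = ?g k" by (simp add: k_def vec_eq_iff distrib_left k2)
      have "a (j0 - 2 *s k) = 0"
      proof (rule ccontr)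
        assume "a (j0 - 2 *s k) \<noteq> 0"
        then have "?g k \<in> ?g ` ?K" by (intro imageI) simp
        then have "j \<in> ?g ` ?K" by (simp only: j[symmetric])
        then show False using that by blast
      qed
      moreover have "j - 2 *s l = j0 - 2 *s k" by (simp add: k_def vec_eq_iff distrib_left k2)
      ultimately show ?thesis by simp
    qed
    have "(\<Sum>j\<in>?J. cscale (monom_fun \<mu> ((1 / 2) *\<^sub>R (?x j0 - ?x j))) (\<upsilon> l ** a (j - 2 *s l))) =
        (\<Sum>j\<in>?g ` ?K. cscale (monom_fun \<mu> ((1 / 2) *\<^sub>R (?x j0 - ?x j))) (\<upsilon> l ** a (j - 2 *s l)))"
      using fin sub zero by (intro sum.mono_neutral_right) auto
    also have "\<dots> = (\<Sum>k\<in>?K. cscale (monom_fun \<mu> (?x k - ?x l)) (\<upsilon> l ** a (j0 - 2 *s k)))"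
    proof -
      have "(1 / 2) *\<^sub>R (?x j0 - ?x (?g k)) = ?x k - ?x l" for k
        by (simp add: vec_eq_iff algebra_simps)
      then show ?thesis by (simp add: sum.reindex[OF inj])
    qed
    finally show "(\<Sum>j\<in>?J. cscale (monom_fun \<mu> ((1 / 2) *\<^sub>R (?x j0 - ?x j))) (\<upsilon> l ** a (j - 2 *s l))) = \<dots>" .
  qed
  also have "\<dots> = (\<Sum>k\<in>?K. \<Sum>l\<in>?V. cscale (monom_fun \<mu> (?x k - ?x l)) (\<upsilon> l) ** a (j0 - 2 *s k))"
    unfolding cscale_matrix_mult by (rule sum.swap)
  also have "?c *\<^sub>R \<dots> = subdivision a (\<lambda>k. poly_conv (monom_fun \<mu>) \<upsilon> (?x k)) j0"
    unfolding subdivision_def poly_conv_eq matmul.sum_left ..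
  finally show ?thesis by simp
qed

text \<open>Dictionary between the jets of a filter, in which the Hermite property is stated, and
  the values at 0 on which the scheme can be tested.\<close>

lemma poly_conv_monom_0:
  fixes \<upsilon> :: "int^'d::{finite,linorder} \<Rightarrow> complex^'r^1"
  assumes "finsupp \<upsilon>"
  shows "mpartial \<mu> (symbol \<upsilon>) 0 = cscale (\<i> ^ mdeg \<mu> * of_real (mfact \<mu>)) (poly_conv (monom_fun \<mu>) \<upsilon> 0)"
proof -
  have neg: "monom_fun \<mu> (- x) = (- 1) ^ mdeg \<mu> * monom_fun \<mu> x" for x :: "real^'d::{finite,linorder}"
    using monom_fun_scale[of \<mu> "- 1" x] by simp
  have "mpartial \<mu> (symbol \<upsilon>) 0 = (\<Sum>k | \<upsilon> k \<noteq> 0. cscale (char_fun k 0) (cscale (dweight (of_int_vec k) \<mu>) (\<upsilon> k)))"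
    unfolding mpartial_symbol[OF assms] using assms by (intro symbol_eq_sum) (auto simp: finsupp_def)
  also have "\<dots> = cscale (\<i> ^ mdeg \<mu> * of_real (mfact \<mu>)) (poly_conv (monom_fun \<mu>) \<upsilon> 0)"
    unfolding poly_conv_eq cscale.sum_right
    by (intro sum.cong refl)
      (simp add: cscale_cscale dweight_eq_monom_fun neg power_minus[of \<i>] mult_ac)
  finally show ?thesis .
qed

lemma poly_conv_monom_expand:
  "poly_conv (monom_fun \<mu>) \<upsilon> x = (\<Sum>\<beta> | \<beta> \<le> \<mu>. cscale (monom_fun (\<mu> - \<beta>) x) (poly_conv (monom_fun \<beta>) \<upsilon> 0))"
proof -
  have "monom_fun \<mu> (x - y) = (\<Sum>\<beta> | \<beta> \<le> \<mu>. monom_fun (\<mu> - \<beta>) x * monom_fun \<beta> (0 - y))" for y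
    using monom_fun_add[of \<mu> "- y" x] by (simp add: mult.commute)
  then show ?thesis
    unfolding poly_conv_eq by (simp add: cscale.sum_left cscale.sum_right cscale_cscale sum.swap[of _ "{\<beta>. \<beta> \<le> \<mu>}"])
qed

section \<open>Polynomial reproduction and the Hermite property\<close>

lemma has_sum_finite_sum:
  fixes f :: "'b \<Rightarrow> 'c \<Rightarrow> complex"
  assumes "\<And>b. b \<in> B \<Longrightarrow> (f b has_sum s b) X"
  shows "((\<lambda>k. \<Sum>b\<in>B. f b k) has_sum (\<Sum>b\<in>B. s b)) X"
  using assms by (induction B rule: infinite_finite_induct) (auto intro: has_sum_add)

lemma symbol_0: "symbol u 0 = (\<Sum>k | u k \<noteq> 0. u k)"
  by (simp add: symbol_def vec_eq_iff sum_component)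

lemma poly_conv_lincomb:
  fixes p :: "'b \<Rightarrow> real^'d \<Rightarrow> complex"
  shows "poly_conv (\<lambda>x. \<Sum>b\<in>B. c b * p b x) \<upsilon> x = (\<Sum>b\<in>B. cscale (c b) (poly_conv (p b) \<upsilon> x))"
  by (simp add: poly_conv_eq cscale.sum_left cscale.sum_right cscale_cscale sum.swap[of _ B])

lemma subdivision_scaleR:
  "subdivision a (\<lambda>k. c *\<^sub>R v k) = (\<lambda>k. c *\<^sub>R subdivision a v k)" for v :: "int^'d \<Rightarrow> complex^'r^'s"
  by (simp add: fun_eq_iff subdivision_def matmul.scaleR_left scaleR_sum_right mult.commute)

context hermite_scheme
begin

context
  fixes \<upsilon> :: "int^'d::{finite,linorder} \<Rightarrow> complex^'r::{finite,linorder}^1"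
  assumes \<upsilon>: "finsupp \<upsilon>" and sr: "sum_rules (m + 1) a \<upsilon>"
begin

lemma funpow_subdivision_poly_conv:
  assumes "mdeg \<mu> \<le> m"
  shows "(subdivision a ^^ n) (\<lambda>k. poly_conv (monom_fun \<mu>) \<upsilon> (of_int_vec k)) =
    (\<lambda>k. (1 / 2) ^ (n * mdeg \<mu>) *\<^sub>R poly_conv (monom_fun \<mu>) \<upsilon> (of_int_vec k))"
proof (induction n)
  case (Suc n)
  have "subdivision a (\<lambda>k. poly_conv (monom_fun \<mu>) \<upsilon> (of_int_vec k)) =
     (\<lambda>k. (1 / 2) ^ mdeg \<mu> *\<^sub>R poly_conv (monom_fun \<mu>) \<upsilon> (of_int_vec k))"
    using subdivision_poly_conv[OF a \<upsilon> sr assms] by blast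
  then show ?case using Suc by (simp add: subdivision_scaleR power_add mult.commute)
qed simp

lemma limit_function_poly_conv:
  assumes \<mu>: "mdeg \<mu> \<le> m"
  shows "is_limit_function m \<nu> a (\<lambda>k. poly_conv (monom_fun \<mu>) \<upsilon> (of_int_vec k))
    (\<lambda>x. symbol \<upsilon> 0 $ 1 $ first * monom_fun \<mu> x)"
proof -
  let ?w = "\<lambda>k. poly_conv (monom_fun \<mu>) \<upsilon> (of_int_vec k)" and ?c = "symbol \<upsilon> 0 $ 1 $ first"
  obtain \<eta> where \<eta>: "is_limit_function m \<nu> a ?w \<eta>"
    using convergent by (auto simp: hermite_convergent_def)
  have "\<eta> = (\<lambda>x. ?c * monom_fun \<mu> x)"
  proof (rule dyadic_ext)
    show "continuous_on UNIV \<eta>" using \<eta> C_class_continuous by (auto simp: is_limit_function_def)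
    show "continuous_on UNIV (\<lambda>x. ?c * monom_fun \<mu> x)"
      by (intro continuous_on_mult continuous_monom_fun continuous_on_const)
    fix n and k :: "int^'d::{finite,linorder}"
    let ?x = "(1 / 2) ^ n *\<^sub>R of_int_vec k :: real^'d::{finite,linorder}"
    show "\<eta> ?x = ?c * monom_fun \<mu> ?x"
    proof (rule LIMSEQ_unique)
      show "(\<lambda>N. (subdivision a ^^ (N + n)) ?w (2 ^ N *s k) $ 1 $ first) \<longlonglongrightarrow> \<eta> ?x"
        using limit_function_dyadic[OF \<eta>, of n k first] by (simp add: iter_first mpartial_first)
      have iter: "(subdivision a ^^ (N + n)) ?w (2 ^ N *s k) $ 1 $ first =
          (\<Sum>j | \<upsilon> j \<noteq> 0. monom_fun \<mu> (?x - (1 / 2) ^ (N + n) *\<^sub>R of_int_vec j) * \<upsilon> j $ 1 $ first)" for N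
      proof -
        have x: "of_int_vec (2 ^ N *s k) = 2 ^ (N + n) *\<^sub>R ?x"
          by (simp add: of_int_vec_smult power_add power_divide)
        \<comment> \<open>The accumulated eigenvalue cancels the factor that the homogeneous
          monomial releases; what remains is a sum over shifts of ?x that shrink to 0.\<close>
        have "(1 / 2 :: real) ^ ((N + n) * mdeg \<mu>) * (2 ^ (N + n)) ^ mdeg \<mu> = 1"
          by (simp add: power_divide flip: power_mult)
        then have "(subdivision a ^^ (N + n)) ?w (2 ^ N *s k) =
            (\<Sum>j | \<upsilon> j \<noteq> 0. cscale (monom_fun \<mu> (?x - (1 / 2 ^ (N + n)) *\<^sub>R of_int_vec j)) (\<upsilon> j))"
          unfolding funpow_subdivision_poly_conv[OF \<mu>] x
          by (subst poly_conv_monom_scale) simp_all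
        then show ?thesis by (simp add: sum_component power_divide)
      qed
      have "(\<lambda>N. \<Sum>j | \<upsilon> j \<noteq> 0. monom_fun \<mu> (?x - (1 / 2) ^ (N + n) *\<^sub>R of_int_vec j) * \<upsilon> j $ 1 $ first)
          \<longlonglongrightarrow> (\<Sum>j | \<upsilon> j \<noteq> 0. monom_fun \<mu> (?x - 0 *\<^sub>R of_int_vec j) * \<upsilon> j $ 1 $ first)"
      proof (intro tendsto_sum tendsto_mult tendsto_const)
        fix j :: "int^'d::{finite,linorder}"
        have "isCont (monom_fun \<mu>) (?x - 0 *\<^sub>R of_int_vec j)"
          using continuous_monom_fun[of \<mu>] by (simp add: continuous_on_eq_continuous_at)
        then show "(\<lambda>N. monom_fun \<mu> (?x - (1 / 2) ^ (N + n) *\<^sub>R of_int_vec j)) \<longlonglongrightarrow>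
            monom_fun \<mu> (?x - 0 *\<^sub>R of_int_vec j)"
          by (rule isCont_tendsto_compose)
            (intro tendsto_diff tendsto_const tendsto_scaleR LIMSEQ_ignore_initial_segment half_power_tendsto_0)
      qed
      also have "(\<Sum>j | \<upsilon> j \<noteq> 0. monom_fun \<mu> (?x - 0 *\<^sub>R of_int_vec j) * \<upsilon> j $ 1 $ first) = ?c * monom_fun \<mu> ?x"
        by (simp add: symbol_0 sum_component sum_distrib_left mult.commute)
      finally show "(\<lambda>N. (subdivision a ^^ (N + n)) ?w (2 ^ N *s k) $ 1 $ first) \<longlonglongrightarrow> ?c * monom_fun \<mu> ?x"
        unfolding iter .
    qed
  qed
  then show ?thesis using \<eta> by simp
qed

text \<open>At the origin the l-th component of the N-th iterate is 2^(N (|\<nu>_l| - |\<mu>|))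
  times the value in question, and it tends to a derivative of the limit monomial. For equal degrees
  the sequence is constant; for lower degree the limit is 0 while the factor is at least 1.\<close>

lemma poly_conv_low_degree:
  assumes le: "mdeg \<mu> \<le> mdeg (\<nu> l)"
  shows "poly_conv (monom_fun \<mu>) \<upsilon> 0 $ 1 $ l = (if \<mu> = \<nu> l then symbol \<upsilon> 0 $ 1 $ first else 0)"
proof -
  let ?c = "symbol \<upsilon> 0 $ 1 $ first" and ?p = "poly_conv (monom_fun \<mu>) \<upsilon> 0 $ 1 $ l"
  let ?w = "\<lambda>k. poly_conv (monom_fun \<mu>) \<upsilon> (of_int_vec k)"
  let ?r = "if \<mu> = \<nu> l then ?c else 0"
  have \<mu>: "mdeg \<mu> \<le> m" using le mdeg_\<nu> order_trans by blast
  have "mpartial (\<nu> l) (\<lambda>x. ?c * monom_fun \<mu> x) 0 = ?r"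
    by (simp only: mpartial_bounded_linear[OF bounded_linear_mult_right smooth_monom_fun] mpartial_monom_fun_0)
      auto
  moreover have "scheme_iter \<nu> a ?w N 0 $ 1 $ l = 2 ^ (N * (mdeg (\<nu> l) - mdeg \<mu>)) * ?p" for N
  proof -
    have "N * mdeg (\<nu> l) = N * (mdeg (\<nu> l) - mdeg \<mu>) + N * mdeg \<mu>"
      using le by (simp flip: distrib_left)
    then have "(2 :: complex) ^ (N * mdeg (\<nu> l)) = 2 ^ (N * (mdeg (\<nu> l) - mdeg \<mu>)) * 2 ^ (N * mdeg \<mu>)"
      by (simp only: power_add)
    then show ?thesis
      unfolding scheme_iter_nth funpow_subdivision_poly_conv[OF \<mu>]
      by (simp add: scaleR_conv_of_real[where 'a = complex] power_divide)
  qed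
  ultimately have lim: "(\<lambda>N. 2 ^ (N * (mdeg (\<nu> l) - mdeg \<mu>)) * ?p) \<longlonglongrightarrow> ?r"
    using limit_function_dyadic[OF limit_function_poly_conv[OF \<mu>], of 0 0 l] by simp
  show ?thesis
  proof (cases "mdeg \<mu> = mdeg (\<nu> l)")
    case True
    then show ?thesis using lim by (simp add: LIMSEQ_const_iff)
  next
    case False
    then have r: "?r = 0" by auto
    have "norm ?p \<le> norm (2 ^ (N * (mdeg (\<nu> l) - mdeg \<mu>)) * ?p)" for N
      using mult_right_mono[of 1 "2 ^ (N * (mdeg (\<nu> l) - mdeg \<mu>))" "norm ?p"]
      by (simp add: norm_mult norm_power)
    then have "norm ?p \<le> norm ?r"
      by (intro LIMSEQ_le_const[OF tendsto_norm[OF lim]]) blast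
    then show ?thesis using r by simp
  qed
qed

text \<open>Convergence fixes all jets of order up to |\<nu>_l| up to the common factor
  \<open>symbol \<upsilon> 0 $ 1 $ first\<close>, so only its normalisation is left.\<close>

lemma hermite_filter_iff: "hermite_filter \<nu> \<upsilon> \<longleftrightarrow> symbol \<upsilon> 0 $ 1 $ first = 1"
proof -
  have lhs: "mpartial \<mu> (\<lambda>\<xi>. symbol \<upsilon> \<xi> $ 1 $ l) 0 =
      (if \<mu> = \<nu> l then \<i> ^ mdeg \<mu> * of_real (mfact \<mu>) * symbol \<upsilon> 0 $ 1 $ first else 0)"
    if "mdeg \<mu> \<le> mdeg (\<nu> l)" for \<mu> l
  proof -
    have "bounded_linear (\<lambda>M :: complex^'r::{finite,linorder}^1. M $ 1 $ l)"
      by (rule bounded_linear_compose[OF bounded_linear_vec_nth bounded_linear_vec_nth])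
    from mpartial_bounded_linear[OF this smooth_symbol[OF \<upsilon>]]
    show ?thesis by (simp add: poly_conv_monom_0[OF \<upsilon>] poly_conv_low_degree[OF that])
  qed
  have rhs: "mpartial \<mu> (\<lambda>\<xi>. \<i> ^ mdeg (\<nu> l) * of_real (mpow \<xi> (\<nu> l))) 0 =
      (if \<mu> = \<nu> l then \<i> ^ mdeg \<mu> * of_real (mfact \<mu>) else 0)" for \<mu> l
  proof -
    have "(\<lambda>\<xi>. \<i> ^ mdeg (\<nu> l) * of_real (mpow \<xi> (\<nu> l))) =
        (\<lambda>\<xi>. \<i> ^ mdeg (\<nu> l) * of_real (mfact (\<nu> l)) * monom_fun (\<nu> l) \<xi>)"
      by (simp add: monom_fun_def fun_eq_iff)
    then have "mpartial \<mu> (\<lambda>\<xi>. \<i> ^ mdeg (\<nu> l) * of_real (mpow \<xi> (\<nu> l))) 0 =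
        \<i> ^ mdeg (\<nu> l) * of_real (mfact (\<nu> l)) * mpartial \<mu> (monom_fun (\<nu> l)) 0"
      by (simp only: mpartial_bounded_linear[OF bounded_linear_mult_right smooth_monom_fun])
    then show ?thesis by (simp add: mpartial_monom_fun_0)
  qed
  show ?thesis
  proof
    assume "hermite_filter \<nu> \<upsilon>"
    then have "mpartial 0 (\<lambda>\<xi>. symbol \<upsilon> \<xi> $ 1 $ first) 0 =
        mpartial 0 (\<lambda>\<xi>. \<i> ^ mdeg (\<nu> first) * of_real (mpow \<xi> (\<nu> first))) 0"
      unfolding hermite_filter_def eq_O_def by (metis less_add_one \<nu>_first)
    then show "symbol \<upsilon> 0 $ 1 $ first = 1" by (simp add: mpartial_0 \<nu>_first)
  qed (simp add: hermite_filter_def eq_O_def less_Suc_eq_le lhs rhs)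
qed

lemma reproduction:
  assumes "symbol \<upsilon> 0 $ 1 $ first = 1" "mdeg \<mu> \<le> m"
  shows "((\<lambda>k. (poly_conv (monom_fun \<mu>) \<upsilon> (of_int_vec k) *v \<phi> (x - of_int_vec k)) $ 1)
    has_sum monom_fun \<mu> x) UNIV"
  using limit_function_has_sum[OF limit_function_poly_conv[OF assms(2)], of x] assms(1) by simp

lemma poly_fun_reproduction:
  assumes "symbol \<upsilon> 0 $ 1 $ first = 1" "p \<in> poly_fun m"
  shows "((\<lambda>k. (poly_conv p \<upsilon> (of_int_vec k) *v \<phi> (x - of_int_vec k)) $ 1) has_sum p x) UNIV"
proof -
  let ?M = "{\<mu> :: nat^'d::{finite,linorder}. mdeg \<mu> \<le> m}"
  obtain c where "p = (\<lambda>x. \<Sum>\<mu>\<in>?M. c \<mu> * of_real (mpow x \<mu>))"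
    using assms(2) by (auto simp: poly_fun_def)
  then have p: "p = (\<lambda>x. \<Sum>\<mu>\<in>?M. (c \<mu> * of_real (mfact \<mu>)) * monom_fun \<mu> x)"
    by (simp add: monom_fun_def)
  have lin: "(cscale z B *v v) $ i = z * (B *v v) $ i" for z and B :: "complex^'r::{finite,linorder}^1" and v i
    by (simp add: matrix_vector_mult_def sum_distrib_left mult.assoc)
  have "((\<lambda>k. \<Sum>\<mu>\<in>?M. (c \<mu> * of_real (mfact \<mu>)) *
      (poly_conv (monom_fun \<mu>) \<upsilon> (of_int_vec k) *v \<phi> (x - of_int_vec k)) $ 1)
      has_sum (\<Sum>\<mu>\<in>?M. (c \<mu> * of_real (mfact \<mu>)) * monom_fun \<mu> x)) UNIV"
    by (intro has_sum_finite_sum has_sum_cmult_right reproduction assms(1)) simp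
  then show ?thesis
    unfolding p poly_conv_lincomb by (simp add: matvec.sum_left sum_component lin)
qed

text \<open>The Taylor expansion of the convolution is cut at degree |\<nu>_l|: below the cut only
  \<beta> = \<nu>_l survives, above it the coefficients are rewritten as jets of the filter.\<close>

lemma poly_conv_hermite:
  assumes first: "symbol \<upsilon> 0 $ 1 $ first = 1"
  shows "poly_conv (monom_fun \<mu>) \<upsilon> x $ 1 $ l =
    (if \<nu> l \<le> \<mu> then monom_fun (\<mu> - \<nu> l) x else 0) +
    (\<Sum>\<beta> | \<beta> \<le> \<mu> \<and> mdeg \<beta> > mdeg (\<nu> l).
      (- \<i>) ^ mdeg \<beta> / of_real (mfact \<beta>) * monom_fun (\<mu> - \<beta>) x * mpartial \<beta> (symbol \<upsilon>) 0 $ 1 $ l)"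
proof -
  let ?q = "\<lambda>\<beta>. poly_conv (monom_fun \<beta>) \<upsilon> 0 $ 1 $ l"
  let ?hi = "{\<beta>. \<beta> \<le> \<mu> \<and> mdeg \<beta> > mdeg (\<nu> l)}" and ?lo = "{\<beta>. \<beta> \<le> \<mu> \<and> mdeg \<beta> \<le> mdeg (\<nu> l)}"
  have fin: "finite ?lo" "finite ?hi"
    by (rule finite_subset[OF _ finite_le_multiindex[of \<mu>]], blast)+
  have inv: "(- \<i>) ^ n * \<i> ^ n = 1" for n by (simp flip: power_mult_distrib)
  have split: "{\<beta>. \<beta> \<le> \<mu>} = ?lo \<union> ?hi" "?lo \<inter> ?hi = {}" by auto
  have "poly_conv (monom_fun \<mu>) \<upsilon> x $ 1 $ l = (\<Sum>\<beta>\<in>?lo \<union> ?hi. monom_fun (\<mu> - \<beta>) x * ?q \<beta>)"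
    by (subst poly_conv_monom_expand) (simp only: split(1) sum_component cscale_nth)
  also have "\<dots> = (\<Sum>\<beta>\<in>?lo. monom_fun (\<mu> - \<beta>) x * ?q \<beta>) + (\<Sum>\<beta>\<in>?hi. monom_fun (\<mu> - \<beta>) x * ?q \<beta>)"
    by (rule sum.union_disjoint[OF fin split(2)])
  finally have "poly_conv (monom_fun \<mu>) \<upsilon> x $ 1 $ l =
      (\<Sum>\<beta>\<in>?lo. monom_fun (\<mu> - \<beta>) x * ?q \<beta>) + (\<Sum>\<beta>\<in>?hi. monom_fun (\<mu> - \<beta>) x * ?q \<beta>)" .
  moreover have "(\<Sum>\<beta>\<in>?lo. monom_fun (\<mu> - \<beta>) x * ?q \<beta>) =
      (\<Sum>\<beta>\<in>?lo. if \<beta> = \<nu> l then monom_fun (\<mu> - \<nu> l) x else 0)"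
    by (intro sum.cong refl) (simp add: poly_conv_low_degree first)
  moreover have "\<dots> = (if \<nu> l \<le> \<mu> then monom_fun (\<mu> - \<nu> l) x else 0)"
    using fin by simp
  moreover have "monom_fun (\<mu> - \<beta>) x * ?q \<beta> =
      (- \<i>) ^ mdeg \<beta> / of_real (mfact \<beta>) * monom_fun (\<mu> - \<beta>) x * mpartial \<beta> (symbol \<upsilon>) 0 $ 1 $ l" for \<beta>
  proof -
    have "(- \<i>) ^ mdeg \<beta> / of_real (mfact \<beta>) * monom_fun (\<mu> - \<beta>) x * mpartial \<beta> (symbol \<upsilon>) 0 $ 1 $ l =
        ((- \<i>) ^ mdeg \<beta> * \<i> ^ mdeg \<beta>) * (monom_fun (\<mu> - \<beta>) x * ?q \<beta>)"
      by (simp add: poly_conv_monom_0[OF \<upsilon>] del: power_mult_distrib)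
    then show ?thesis by (simp only: inv mult_1)
  qed
  ultimately show ?thesis by simp
qed

end

text \<open>At frequency 0 the product formula says that the first columns of the powers of
  \<open>A\<close> tend to the transform at 0, and r does not see the powers. This makes the
  normalisation in (A) the Hermite one.\<close>

lemma left_fixed_first:
  fixes r :: "complex^'r::{finite,linorder}^1"
  assumes "r ** A = r"
  shows "(r *v fourier \<phi> 0) $ 1 = r $ 1 $ first"
proof (rule LIMSEQ_unique)
  have const: "r *v (mprod (\<lambda>j. A) n *v axis first 1) = r *v axis first 1" for n
  proof -
    have "r ** mprod (\<lambda>j. A) n = r" by (induction n) (simp_all add: matrix_mul_assoc assms)
    then show ?thesis by (simp only: matrix_vector_mul_assoc)
  qed
  have "(\<lambda>n. mprod (\<lambda>j. A) n *v axis first 1) \<longlonglongrightarrow> fourier \<phi> 0"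
    using fourier_\<phi>_limit[of 0] by simp
  then have "(\<lambda>n. (r *v (mprod (\<lambda>j. A) n *v axis first 1)) $ 1) \<longlonglongrightarrow> (r *v fourier \<phi> 0) $ 1"
    by (intro tendsto_vec_nth matvec.tendsto tendsto_const)
  then show "(\<lambda>n. r $ 1 $ first) \<longlonglongrightarrow> (r *v fourier \<phi> 0) $ 1"
    unfolding const by (simp add: mult_axis_nth)
qed auto

end

section \<open>Filters with prescribed jets\<close>

text \<open>The coefficients of the Lagrange basis polynomials at the nodes 0, ..., m invert the
  Vandermonde matrix, giving weights dual to the power moments.\<close>

lemma lagrange_coefficients:
  obtains c :: "nat \<Rightarrow> int \<Rightarrow> complex"
  where "\<And>i j. i \<le> m \<Longrightarrow> (\<Sum>t\<in>{0..int m}. c j t * of_int t ^ i) = (if i = j then 1 else 0)"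
proof -
  let ?T = "{0..int m}"
  define L :: "int \<Rightarrow> complex poly" where
    "L t = (\<Prod>s\<in>?T - {t}. smult (1 / of_int (t - s)) [:- of_int s, 1:])" for t
  have L: "poly (L t) (of_int s) = (if s = t then 1 else 0)" if "s \<in> ?T" "t \<in> ?T" for s t
  proof (cases "s = t")
    case True
    have "poly (L t) (of_int t) = (\<Prod>s\<in>?T - {t}. 1)"
      unfolding L_def poly_prod
    proof (rule prod.cong[OF refl])
      fix s assume "s \<in> ?T - {t}"
      then have "complex_of_int (t - s) \<noteq> 0" by (simp del: of_int_diff)
      then show "poly (smult (1 / of_int (t - s)) [:- of_int s, 1:]) (of_int t) = (1 :: complex)"
        by (simp flip: diff_divide_distrib)
    qed
    then show ?thesis using True by simp
  next
    case False
    then have "s \<in> ?T - {t}" using that by simp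
    then have "poly (L t) (of_int s) = 0"
      unfolding L_def poly_prod by (intro prod_zero) auto
    then show ?thesis using False by simp
  qed
  have deg: "degree (L t) \<le> m" if "t \<in> ?T" for t
  proof -
    have "degree (L t) \<le> (\<Sum>s\<in>?T - {t}. degree (smult (1 / of_int (t - s)) [:- of_int s, 1 :: complex:]))"
      unfolding L_def by (rule degree_prod_sum_le[unfolded o_def]) simp
    also have "\<dots> \<le> (\<Sum>s\<in>?T - {t}. 1)" by (intro sum_mono) simp
    also have "\<dots> = m" using that by simp
    finally show ?thesis .
  qed
  \<comment> \<open>Interpolation at m + 1 nodes is exact up to degree m; the claim follows by
    comparing coefficients.\<close>
  have expand: "monom 1 i = (\<Sum>t\<in>?T. smult (of_int t ^ i) (L t))" if "i \<le> m" for i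
  proof (rule poly_eqI_degree[where A = "of_int ` ?T"])
    show "poly (monom 1 i) x = poly (\<Sum>t\<in>?T. smult (of_int t ^ i) (L t)) x" if x: "x \<in> of_int ` ?T" for x
    proof -
      obtain s where s: "s \<in> ?T" "x = of_int s" using x by blast
      have "poly (\<Sum>t\<in>?T. smult (of_int t ^ i) (L t)) x = (\<Sum>t\<in>?T. if t = s then of_int s ^ i else 0)"
        unfolding poly_sum by (intro sum.cong refl) (use s in \<open>auto simp: L\<close>)
      then show ?thesis using s by (simp add: poly_monom)
    qed
    have card: "card ((of_int :: int \<Rightarrow> complex) ` ?T) = Suc m"
      by (subst card_image) (auto simp: inj_on_def)
    show "degree (monom 1 i :: complex poly) < card ((of_int :: int \<Rightarrow> complex) ` ?T)"
      using that by (simp add: card degree_monom_eq)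
    have "degree (\<Sum>t\<in>?T. smult (of_int t ^ i) (L t)) \<le> m"
      by (intro degree_sum_le) (auto intro: deg)
    then show "degree (\<Sum>t\<in>?T. smult (of_int t ^ i) (L t)) < card ((of_int :: int \<Rightarrow> complex) ` ?T)"
      by (simp add: card)
  qed
  have "(\<Sum>t\<in>?T. coeff (L t) j * of_int t ^ i) = (if i = j then 1 else 0)" if "i \<le> m" for i j
  proof -
    have "coeff (monom 1 i) j = (\<Sum>t\<in>?T. of_int t ^ i * coeff (L t) j)"
      unfolding expand[OF that] by (simp add: coeff_sum)
    then show ?thesis by (simp add: mult.commute)
  qed
  then show ?thesis by (rule that[of "\<lambda>j t. coeff (L t) j"])
qed

text \<open>Tensor products of the one-dimensional weights are dual to the multivariate moments.
  This realises the recursively defined jets of (B) by a finitely supported sequence.\<close>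

lemma filter_with_jets:
  fixes J :: "nat^'d::{finite,linorder} \<Rightarrow> complex^'r^1"
  obtains \<upsilon> :: "int^'d::{finite,linorder} \<Rightarrow> complex^'r^1"
  where "finsupp \<upsilon>" "\<And>\<mu>. mdeg \<mu> \<le> m \<Longrightarrow> mpartial \<mu> (symbol \<upsilon>) 0 = J \<mu>"
proof -
  obtain c :: "nat \<Rightarrow> int \<Rightarrow> complex"
    where c: "\<And>i j. i \<le> m \<Longrightarrow> (\<Sum>t\<in>{0..int m}. c j t * of_int t ^ i) = (if i = j then 1 else 0)"
    by (rule lagrange_coefficients) blast
  let ?M = "{\<mu> :: nat^'d::{finite,linorder}. mdeg \<mu> \<le> m}"
  let ?K = "{k :: int^'d::{finite,linorder}. \<forall>i. k $ i \<in> {0..int m}}"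
  define C where "C \<mu> k = (\<Prod>i\<in>UNIV. c (\<mu> $ i) (k $ i))" for \<mu> :: "nat^'d::{finite,linorder}" and k :: "int^'d::{finite,linorder}"
  \<comment> \<open>The division cancels the power of - \<i> that differentiation of the exponential
    brings down.\<close>
  define \<upsilon> :: "int^'d::{finite,linorder} \<Rightarrow> complex^'r^1"
    where "\<upsilon> k = (if k \<in> ?K then \<Sum>\<mu>\<in>?M. cscale (C \<mu> k / (- \<i>) ^ mdeg \<mu>) (J \<mu>) else 0)" for k
  have finK: "finite ?K"
  proof (rule finite_subset)
    show "?K \<subseteq> ibox (real m)" by (auto simp: ibox_def) (metis of_int_le_iff of_int_of_nat_eq)
  qed (rule ibox_card, simp)
  have fs: "finsupp \<upsilon>" unfolding finsupp_def by (rule finite_subset[OF _ finK]) (auto simp: \<upsilon>_def)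
  have orth: "(\<Sum>k\<in>?K. C \<mu> k * of_real (mpow (of_int_vec k) \<beta>)) = (if \<mu> = \<beta> then 1 else 0)" if "mdeg \<beta> \<le> m" for \<mu> \<beta>
  proof -
    have "(\<Sum>k\<in>?K. C \<mu> k * of_real (mpow (of_int_vec k) \<beta>)) =
        (\<Sum>k\<in>?K. \<Prod>i\<in>UNIV. c (\<mu> $ i) (k $ i) * of_int (k $ i) ^ (\<beta> $ i))"
      by (simp add: C_def mpow_def prod.distrib)
    also have "\<dots> = (\<Prod>i\<in>UNIV. \<Sum>t\<in>{0..int m}. c (\<mu> $ i) t * of_int t ^ (\<beta> $ i))"
      by (rule prod_sum_vec[symmetric]) simp
    also have "\<dots> = (\<Prod>i\<in>UNIV. if \<beta> $ i = \<mu> $ i then 1 else 0)"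
      using le_mdeg[of \<beta>] that by (intro prod.cong refl c) (metis order_trans)
    also have "\<dots> = (if \<mu> = \<beta> then 1 else 0)"
      by (auto simp: vec_eq_iff) metis
    finally show ?thesis .
  qed
  have jet: "mpartial \<beta> (symbol \<upsilon>) 0 = J \<beta>" if \<beta>: "mdeg \<beta> \<le> m" for \<beta>
  proof -
    have "mpartial \<beta> (symbol \<upsilon>) 0 = (\<Sum>k\<in>?K. cscale (char_fun k 0) (cscale (dweight (of_int_vec k) \<beta>) (\<upsilon> k)))"
      unfolding mpartial_symbol[OF fs] using finK by (intro symbol_eq_sum) (auto simp: \<upsilon>_def split: if_splits)
    also have "\<dots> = (\<Sum>k\<in>?K. \<Sum>\<mu>\<in>?M. cscale ((- \<i>) ^ mdeg \<beta> / (- \<i>) ^ mdeg \<mu> *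
        (C \<mu> k * of_real (mpow (of_int_vec k) \<beta>))) (J \<mu>))"
      by (intro sum.cong refl)
        (simp add: \<upsilon>_def cscale.sum_right cscale_cscale dweight_def mult_ac)
    also have "\<dots> = (\<Sum>\<mu>\<in>?M. cscale ((- \<i>) ^ mdeg \<beta> / (- \<i>) ^ mdeg \<mu> *
        (\<Sum>k\<in>?K. C \<mu> k * of_real (mpow (of_int_vec k) \<beta>))) (J \<mu>))"
      by (subst sum.swap) (simp only: sum_distrib_left cscale.sum_left)
    also have "\<dots> = (\<Sum>\<mu>\<in>?M. if \<mu> = \<beta> then J \<beta> else 0)"
      unfolding orth[OF \<beta>] by (intro sum.cong refl) auto
    also have "\<dots> = J \<beta>" using \<beta> finite_mdeg_le[where 'd = 'd and m = m] by simp
    finally show ?thesis .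
  qed
  show ?thesis using that[OF fs jet] .
qed

section \<open>Existence and uniqueness of the jets in (A) and (B)\<close>

context hermite_span
begin

lemma cond_filter_exists: "\<exists>\<upsilon>. finsupp \<upsilon> \<and> cond_A a \<phi> \<upsilon> \<and> cond_B m a \<upsilon>"
proof -
  obtain r :: "complex^'r::{finite,linorder}^1" where r: "r ** A = r" "(r *v fourier \<phi> 0) $ 1 = 1"
    by (rule split.left_eigenvector_exists)
  \<comment> \<open>The right side of (B) as an operator on families of jets. It reads only strictly
    lower degrees, so J is built up degree by degree.\<close>
  define F where "F J \<mu> = (\<Sum>\<beta> | \<beta> \<le> \<mu> \<and> \<beta> \<noteq> \<mu>.
           (2 ^ mdeg \<beta> * mfact \<mu> / (mfact \<beta> * mfact (\<mu> - \<beta>))) *\<^sub>R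
           (J \<beta> ** mpartial (\<mu> - \<beta>) (symbol a) 0 ** matrix_inv (mat 1 - 2 ^ mdeg \<mu> *\<^sub>R A)))"
    for J :: "nat^'d::{finite,linorder} \<Rightarrow> complex^'r::{finite,linorder}^1" and \<mu>
  have cong: "F J \<mu> = F J' \<mu>" if "\<And>\<beta>. mdeg \<beta> < mdeg \<mu> \<Longrightarrow> J \<beta> = J' \<beta>" for J J' \<mu>
    unfolding F_def by (intro sum.cong refl) (auto simp: that[OF mdeg_strict_mono])
  have "\<exists>J. J 0 = r \<and> (\<forall>\<mu>. \<mu> \<noteq> 0 \<and> mdeg \<mu> \<le> n \<longrightarrow> J \<mu> = F J \<mu>)" for n
  proof (induction n)
    case 0
    then show ?case by (intro exI[of _ "\<lambda>_. r"]) simp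
  next
    case (Suc n)
    then obtain J where J: "J 0 = r" "\<And>\<mu>. \<mu> \<noteq> 0 \<Longrightarrow> mdeg \<mu> \<le> n \<Longrightarrow> J \<mu> = F J \<mu>" by blast
    \<comment> \<open>Values in degree above n + 1 are arbitrary fillers; the claim reaches only to
      degree n + 1, where F reads the unchanged part.\<close>
    let ?J = "\<lambda>\<mu>. if mdeg \<mu> \<le> n then J \<mu> else F J \<mu>"
    have "?J \<mu> = F ?J \<mu>" if "\<mu> \<noteq> 0" "mdeg \<mu> \<le> Suc n" for \<mu>
    proof -
      have "F ?J \<mu> = F J \<mu>" using that by (intro cong) auto
      then show ?thesis using J(2) that by simp
    qed
    then show ?case using J(1) by (intro exI[of _ ?J]) auto
  qed
  then obtain J where J: "J 0 = r" "\<And>\<mu>. \<mu> \<noteq> 0 \<Longrightarrow> mdeg \<mu> \<le> m \<Longrightarrow> J \<mu> = F J \<mu>" by blast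
  obtain \<upsilon> where \<upsilon>: "finsupp \<upsilon>" "\<And>\<mu>. mdeg \<mu> \<le> m \<Longrightarrow> mpartial \<mu> (symbol \<upsilon>) 0 = J \<mu>"
    using filter_with_jets[of m J] by blast
  have "symbol \<upsilon> 0 = r" using \<upsilon>(2)[of 0] J(1) by (simp add: mpartial_0)
  then have "cond_A a \<phi> \<upsilon>" using r by (simp add: cond_A_def)
  moreover have "cond_B m a \<upsilon>"
  proof -
    have "mpartial \<mu> (symbol \<upsilon>) 0 = F (\<lambda>\<beta>. mpartial \<beta> (symbol \<upsilon>) 0) \<mu>" if "\<mu> \<noteq> 0" "mdeg \<mu> \<le> m" for \<mu>
    proof -
      have "F (\<lambda>\<beta>. mpartial \<beta> (symbol \<upsilon>) 0) \<mu> = F J \<mu>" using that \<upsilon>(2) by (intro cong) simp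
      then show ?thesis using J(2) \<upsilon>(2) that by simp
    qed
    then show ?thesis unfolding cond_B_def F_def by blast
  qed
  ultimately show ?thesis using \<upsilon>(1) by blast
qed

lemma cond_filter_unique:
  assumes "cond_A a \<phi> \<upsilon>" "cond_B m a \<upsilon>" "cond_A a \<phi> \<upsilon>'" "cond_B m a \<upsilon>'"
  shows "mdeg \<mu> \<le> m \<Longrightarrow> mpartial \<mu> (symbol \<upsilon>) 0 = mpartial \<mu> (symbol \<upsilon>') 0"
proof (induction "mdeg \<mu>" arbitrary: \<mu> rule: less_induct)
  case less
  show ?case
  proof (cases "\<mu> = 0")
    case True
    have "symbol \<upsilon> 0 = symbol \<upsilon>' 0"
    proof (rule split.left_eigenvector_unique)
      show "symbol \<upsilon> 0 ** A = symbol \<upsilon> 0" "symbol \<upsilon>' 0 ** A = symbol \<upsilon>' 0"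
        using assms(1,3) by (simp_all add: cond_A_def)
    qed (simp only: cond_A_pairing[OF assms(1)] cond_A_pairing[OF assms(3)])
    then show ?thesis using True by (simp add: mpartial_0)
  next
    case False
    let ?S = "\<lambda>\<upsilon>. \<Sum>\<beta> | \<beta> \<le> \<mu> \<and> \<beta> \<noteq> \<mu>. (2 ^ mdeg \<beta> * mfact \<mu> / (mfact \<beta> * mfact (\<mu> - \<beta>))) *\<^sub>R
      (mpartial \<beta> (symbol \<upsilon>) 0 ** mpartial (\<mu> - \<beta>) (symbol a) 0 ** matrix_inv (mat 1 - 2 ^ mdeg \<mu> *\<^sub>R A))"
    have "mpartial \<beta> (symbol \<upsilon>) 0 = mpartial \<beta> (symbol \<upsilon>') 0" if "\<beta> \<le> \<mu>" "\<beta> \<noteq> \<mu>" for \<beta>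
      using less mdeg_strict_mono[OF that] by simp
    then have "?S \<upsilon> = ?S \<upsilon>'" by (intro sum.cong refl) simp
    moreover have "mpartial \<mu> (symbol \<upsilon>) 0 = ?S \<upsilon>" "mpartial \<mu> (symbol \<upsilon>') 0 = ?S \<upsilon>'"
      using assms(2,4) False less.prems unfolding cond_B_def by blast+
    ultimately show ?thesis by (simp only:)
  qed
qed

lemma cond_A_first: "cond_A a \<phi> \<upsilon> \<Longrightarrow> symbol \<upsilon> 0 $ 1 $ first = 1"
  using left_fixed_first[of "symbol \<upsilon> 0"] by (simp add: cond_A_def)

end

lemma monom_fun_abs: "(\<lambda>x. of_real (mpow x \<mu> / mfact \<mu>)) = monom_fun \<mu>"
  by (simp add: monom_fun_def fun_eq_iff)

theorem theorem1p1:
  fixes m :: nat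
    and \<nu> :: "'r::{finite,linorder} \<Rightarrow> nat^'d::{finite,linorder}"
    and a :: "int^'d::{finite,linorder} \<Rightarrow> complex^'r::{finite,linorder}^'r::{finite,linorder}"
    and \<phi> :: "real^'d::{finite,linorder} \<Rightarrow> complex^'r::{finite,linorder}"
  assumes "\<And>l. mdeg (\<nu> l) \<le> m"
    and "\<nu> first = 0"
    and "finsupp a"
    and "hermite_convergent m \<nu> a"
    and "basis_vector_function m \<nu> a \<phi>"
  shows
    "compact (closure {x. \<phi> x \<noteq> 0}) \<and>
     (\<forall>j. C_class m (\<lambda>x. \<phi> x $ j)) \<and>
     (\<forall>\<xi>. (\<lambda>n. mprod (\<lambda>j. symbol a ((1 / 2) ^ j *\<^sub>R \<xi>)) n *v axis first 1)
              \<longlonglongrightarrow> fourier \<phi> \<xi>) \<and>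
     (\<forall>\<xi>. fourier \<phi> (2 *\<^sub>R \<xi>) = symbol a \<xi> *v fourier \<phi> \<xi>) \<and>
     ((\<forall>\<omega>\<in>cube. vec.span (range (\<lambda>k. fourier \<phi> (pi *\<^sub>R of_int_vec \<omega> + (2 * pi) *\<^sub>R of_int_vec k)))
                 = (UNIV :: (complex^'r::{finite,linorder}) set))
      \<longrightarrow>
      fourier \<phi> 0 \<noteq> 0 \<and>
      \<comment> \<open>(1)\<close>
      (symbol a 0 = (\<Sum>k | a k \<noteq> 0. a k) \<and>
       simple_eigenvalue (symbol a 0) 1 \<and>
       (\<forall>z. eigenvalue (symbol a 0) z \<and> z \<noteq> 1 \<longrightarrow> cmod z < (1 / 2) ^ m) \<and>
       (\<forall>\<mu>::nat^'d::{finite,linorder}. \<mu> \<noteq> 0 \<and> mdeg \<mu> \<le> m \<longrightarrow>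
          invertible (mat 1 - 2 ^ mdeg \<mu> *\<^sub>R symbol a 0)) \<and>
       (\<exists>\<upsilon>. finsupp \<upsilon> \<and> cond_A a \<phi> \<upsilon> \<and> cond_B m a \<upsilon>) \<and>
       (\<forall>\<upsilon> \<upsilon>'. finsupp \<upsilon> \<and> cond_A a \<phi> \<upsilon> \<and> cond_B m a \<upsilon> \<and>
                finsupp \<upsilon>' \<and> cond_A a \<phi> \<upsilon>' \<and> cond_B m a \<upsilon>' \<longrightarrow>
          (\<forall>\<mu>. mdeg \<mu> \<le> m \<longrightarrow> mpartial \<mu> (symbol \<upsilon>) 0 = mpartial \<mu> (symbol \<upsilon>') 0))) \<and>
      \<comment> \<open>(2)\<close>
      (\<forall>\<upsilon>. finsupp \<upsilon> \<and> cond_A a \<phi> \<upsilon> \<and> cond_B m a \<upsilon> \<longrightarrow>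
         (\<forall>k. eq_O (m + 1)
                (\<lambda>\<xi>. (symbol \<upsilon> \<xi> *v fourier \<phi> (\<xi> + (2 * pi) *\<^sub>R of_int_vec k)) $ 1)
                (\<lambda>\<xi>. delta k)) \<and>
         (\<forall>p\<in>poly_fun m. \<forall>x.
            ((\<lambda>k. (poly_conv p \<upsilon> (of_int_vec k) *v \<phi> (x - of_int_vec k)) $ 1)
               has_sum p x) UNIV)) \<and>
      \<comment> \<open>(3)\<close>
      (\<exists>\<upsilon>. finsupp \<upsilon> \<and> sum_rules (m + 1) a \<upsilon> \<and> hermite_filter \<nu> \<upsilon>) \<and>
      \<comment> \<open>(4)\<close>
      (\<forall>\<upsilon>. finsupp \<upsilon> \<and> sum_rules (m + 1) a \<upsilon> \<and> hermite_filter \<nu> \<upsilon> \<longrightarrow>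
         (\<forall>\<mu>. mdeg \<mu> \<le> m \<longrightarrow>
           (let p = poly_conv (\<lambda>x. of_real (mpow x \<mu> / mfact \<mu>)) \<upsilon> in
              (\<forall>k. subdivision a (\<lambda>k. p (of_int_vec k)) k = (1 / 2) ^ mdeg \<mu> *\<^sub>R p (of_int_vec k)) \<and>
              (\<forall>x. ((\<lambda>k. (p (of_int_vec k) *v \<phi> (x - of_int_vec k)) $ 1)
                      has_sum of_real (mpow x \<mu> / mfact \<mu>)) UNIV) \<and>
              (\<forall>l x. p x $ 1 $ l =
                 (if \<nu> l \<le> \<mu> then of_real (mpow x (\<mu> - \<nu> l) / mfact (\<mu> - \<nu> l)) else 0) +
                 (\<Sum>\<beta> | \<beta> \<le> \<mu> \<and> mdeg \<beta> > mdeg (\<nu> l).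
                    (- \<i>) ^ mdeg \<beta> / of_real (mfact \<beta>) *
                    of_real (mpow x (\<mu> - \<beta>) / mfact (\<mu> - \<beta>)) *
                    mpartial \<beta> (symbol \<upsilon>) 0 $ 1 $ l))))))"
proof -
  interpret hermite_scheme m \<nu> a \<phi>
    using assms by unfold_locales
  show ?thesis
  proof (intro conjI, goal_cases)
    case 1
    show ?case by (rule compact_support_\<phi>)
  next
    case 2
    show ?case using C_class_\<phi> by blast
  next
    case 3
    show ?case using fourier_\<phi>_limit by blast
  next
    case 4
    show ?case using refinement by blast
  next
    case 5
    show ?case
    proof (rule impI, goal_cases)
      case span: 1
      interpret hermite_span m \<nu> a \<phi>
        using span by unfold_locales blast
      show ?case
      proof (intro conjI, goal_cases)
        case 1
        show ?case by (rule fourier_\<phi>_0_nonzero)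
      next
        case 2
        show ?case by (rule symbol_0)
      next
        case 3
        show ?case by (rule split.simple_eigenvalue_1)
      next
        case 4
        show ?case using split.eigenvalue_bound by blast
      next
        case 5
        show ?case
        proof (intro allI impI)
          fix \<mu> :: "nat^'d::{finite,linorder}"
          assume "\<mu> \<noteq> 0 \<and> mdeg \<mu> \<le> m"
          then show "invertible (mat 1 - 2 ^ mdeg \<mu> *\<^sub>R symbol a 0)"
            using mdeg_eq_0_iff[of \<mu>] by (intro split.invertible_dilated) (auto simp: Suc_le_eq simp del: mdeg_eq_0_iff)
        qed
      next
        case 6
        show ?case by (rule cond_filter_exists)
      next
        case 7
        show ?case using cond_filter_unique by blast
      next
        case 8
        show ?case
        proof (intro allI impI, elim conjE, intro conjI allI ballI)
          fix \<upsilon> assume \<upsilon>: "finsupp \<upsilon>" "cond_A a \<phi> \<upsilon>" "cond_B m a \<upsilon>"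
          show "eq_O (m + 1) (\<lambda>\<xi>. (symbol \<upsilon> \<xi> *v fourier \<phi> (\<xi> + (2 * pi) *\<^sub>R of_int_vec k)) $ 1)
              (\<lambda>\<xi>. delta k)" for k
            by (rule pairing_eq_O[OF \<upsilon>])
          show "((\<lambda>k. (poly_conv p \<upsilon> (of_int_vec k) *v \<phi> (x - of_int_vec k)) $ 1) has_sum p x) UNIV"
            if "p \<in> poly_fun m" for p x
            by (rule poly_fun_reproduction[OF \<upsilon>(1) sum_rules_of_cond[OF \<upsilon>] cond_A_first[OF \<upsilon>(2)] that])
        qed
      next
        case 9
        \<comment> \<open>The filter of item (1) serves here as well, since (A) makes its first
          entry at 0 equal to 1.\<close>
        obtain \<upsilon> where \<upsilon>: "finsupp \<upsilon>" "cond_A a \<phi> \<upsilon>" "cond_B m a \<upsilon>"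
          using cond_filter_exists by blast
        show ?case
          using \<upsilon>(1) sum_rules_of_cond[OF \<upsilon>] hermite_filter_iff[OF \<upsilon>(1) sum_rules_of_cond[OF \<upsilon>]]
            cond_A_first[OF \<upsilon>(2)] by blast
      next
        case 10
        show ?case
          unfolding Let_def monom_fun_abs monom_fun_def[symmetric]
        proof (intro allI impI, elim conjE, intro conjI allI)
          fix \<upsilon> and \<mu> :: "nat^'d::{finite,linorder}"
          assume \<upsilon>: "finsupp \<upsilon>" "sum_rules (m + 1) a \<upsilon>" and h: "hermite_filter \<nu> \<upsilon>" and \<mu>: "mdeg \<mu> \<le> m"
          \<comment> \<open>The filter is an arbitrary one with sum rules, so the normalisation
            comes from the Hermite property and not from (A).\<close>
          have first: "symbol \<upsilon> 0 $ 1 $ first = 1"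
            using h hermite_filter_iff[OF \<upsilon>] by blast
          show "subdivision a (\<lambda>k. poly_conv (monom_fun \<mu>) \<upsilon> (of_int_vec k)) k =
              (1 / 2) ^ mdeg \<mu> *\<^sub>R poly_conv (monom_fun \<mu>) \<upsilon> (of_int_vec k)" for k
            by (rule subdivision_poly_conv[OF assms(3) \<upsilon> \<mu>])
          show "((\<lambda>k. (poly_conv (monom_fun \<mu>) \<upsilon> (of_int_vec k) *v \<phi> (x - of_int_vec k)) $ 1)
              has_sum monom_fun \<mu> x) UNIV" for x
            by (rule reproduction[OF \<upsilon> first \<mu>])
          show "poly_conv (monom_fun \<mu>) \<upsilon> x $ 1 $ l =
              (if \<nu> l \<le> \<mu> then monom_fun (\<mu> - \<nu> l) x else 0) +
              (\<Sum>\<beta> | \<beta> \<le> \<mu> \<and> mdeg \<beta> > mdeg (\<nu> l).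
                (- \<i>) ^ mdeg \<beta> / of_real (mfact \<beta>) * monom_fun (\<mu> - \<beta>) x *
                mpartial \<beta> (symbol \<upsilon>) 0 $ 1 $ l)" for l x
            by (rule poly_conv_hermite[OF \<upsilon> first])
        qed
      qed
    qed
  qed
qed

end
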